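(* Let $N\ge1$ be an integer and suppose $a>\max\{0,2-N\}$. Let $h_a(x,y;t)$ be the $a$-deformed heat kernel on $\mathbb{R}^N$, let $l,m\in\mathbb{N}$, let $p\in\mathscr{H}^l(\mathbb{R}^N)$, and put $\lambda_{a,l}=\frac{N+2l-2}{a}$. Then for all $x\in\mathbb{R}^N$ and $t>0$, $$c_a\int_{\mathbb{R}^N}h_a(x,y;t)\,|y|^{ma}p(y)\,\frac{dy}{|y|^{2-a}}=\left(\sum_{i=0}^m a^i\binom mi\frac{\Gamma(\lambda_{a,l}+m+1)}{\Gamma(\lambda_{a,l}+m-i+1)}|x|^{(m-i)a}t^i\right)p(x).$$
   Context: $\mathscr{H}^l(\mathbb{R}^N)$ is the space of homogeneous harmonic polynomials of degree $l$ on $\mathbb{R}^N$. Normalized I-Bessel function: for $\mu\in\mathbb{R}$ and $w\in\mathbb{C}$, $\tilde I_\mu(w)=\sum_{j=0}^\infty\frac{(w/2)^{2j}}{j!\,\Gamma(\mu+j+1)}$ (with $1/\Gamma=0$ at the poles of $\Gamma$). Normalized Gegenbauer polynomials $\check C^\nu_m(t)$ are defined by the formal power series expansion $\frac{1-x^2}{(1-2tx+x^2)^{\nu+1}}=\sum_{m=0}^\infty\check C^\nu_m(t)x^m$. For $b>0$, $\nu\in\mathbb{R}$ with $1+b\nu>0$, $w\in\mathbb{C}$, $t\in[-1,1]$, $$\mathscr{I}(b,\nu,w,t):=\Gamma(b\nu+1)\sum_{m=0}^\infty\left(\frac w2\right)^{bm}\tilde I_{b(m+\nu)}(w)\,\check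 C^\nu_m(t),$$ where $(w/2)^s=(|w|/2)^se^{i\theta s}$ for $w=|w|e^{i\theta}$, $\theta\in(-\pi,\pi]$; the series converges absolutely and locally uniformly. For $a>\max\{0,2-N\}$ put $B_a(r\omega,s\mu)=\mathscr{I}\left(\frac2a,\frac{N-2}{2},\frac{2(rs)^{a/2}}{ai},\langle\omega,\mu\rangle\right)$ for $r,s\ge0$, $\omega,\mu\in S^{N-1}$, and $c_a=\left(\int_{\mathbb{R}^N}e^{-\frac1a|x|^a}\frac{dx}{|x|^{2-a}}\right)^{-1}$. The $a$-deformed heat kernel is $$h_a(x,y;t)=c_a\int_{\mathbb{R}^N}\overline{B_a(x,\xi)}\,B_a(y,\xi)\,e^{-\frac ta|\xi|^a}\frac{d\xi}{|\xi|^{2-a}}\qquad(x,y\in\mathbb{R}^N,\ t>0),$$ an absolutely convergent integral. *)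

theory Defs
  imports "HOL-Analysis.Analysis"
begin

text \<open>Throughout, \<open>\<real>\<^sup>N\<close> is \<^typ>\<open>real^'n\<close> with \<open>N = CARD('n)\<close>.\<close>


definition homogeneous_polynomial :: "nat \<Rightarrow> (real^'n \<Rightarrow> complex) \<Rightarrow> bool" where
  "homogeneous_polynomial l p \<longleftrightarrow>
     (\<exists>c :: ('n \<Rightarrow> nat) \<Rightarrow> complex. \<forall>x.
        p x = (\<Sum>\<alpha> | (\<Sum>i\<in>UNIV. \<alpha> i) = l. c \<alpha> * of_real (\<Prod>i\<in>UNIV. x $ i ^ \<alpha> i)))"

definition partial_derivative :: "'n \<Rightarrow> (real^'n \<Rightarrow> complex) \<Rightarrow> real^'n \<Rightarrow> complex" where
  "partial_derivative i f x = frechet_derivative f (at x) (axis i 1)"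

definition laplacian :: "(real^'n \<Rightarrow> complex) \<Rightarrow> real^'n \<Rightarrow> complex" where
  "laplacian f x = (\<Sum>i\<in>UNIV. partial_derivative i (partial_derivative i f) x)"

definition harmonic_polynomials :: "nat \<Rightarrow> (real^'n \<Rightarrow> complex) set" where
  "harmonic_polynomials l = {p. homogeneous_polynomial l p \<and> (\<forall>x. laplacian p x = 0)}"


text \<open>\<^const>\<open>rGamma\<close> is the entire function \<open>1/\<Gamma>\<close>, which vanishes at the poles of \<open>\<Gamma>\<close>.\<close>

definition normalized_bessel_I :: "real \<Rightarrow> complex \<Rightarrow> complex" where
  "normalized_bessel_I \<mu> w =
     (\<Sum>j. (w / 2) ^ (2 * j) * of_real (rGamma (\<mu> + real j + 1)) / fact j)"

text \<open>
  The coefficients of the formal power series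
  \<open>(1 - X\<^sup>2) (1 - 2tX + X\<^sup>2) powr (-(\<nu> + 1))\<close>; the real power is the binomial series
  composed with \<open>X\<^sup>2 - 2tX\<close>, which has zero constant term.
\<close>

definition normalized_gegenbauer :: "real \<Rightarrow> nat \<Rightarrow> real \<Rightarrow> real" where
  "normalized_gegenbauer \<nu> m t =
     fps_nth ((1 - fps_X ^ 2) *
       fps_compose (fps_binomial (- (\<nu> + 1))) (fps_X ^ 2 - fps_const (2 * t) * fps_X)) m"

text \<open>
  The complex \<open>powr\<close> uses the principal logarithm with \<open>Im \<in> (-\<pi>, \<pi>]\<close>.
  The case \<open>m = 0\<close> is separate only because \<open>0 powr 0 = 0\<close> in the library, whereas
  \<open>(w/2)\<^sup>0 = 1\<close> is needed also for \<open>w = 0\<close>.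
\<close>

definition deformed_I :: "real \<Rightarrow> real \<Rightarrow> complex \<Rightarrow> real \<Rightarrow> complex" where
  "deformed_I b \<nu> w t =
     of_real (Gamma (b * \<nu> + 1)) *
     (\<Sum>m. (if m = 0 then 1 else (w / 2) powr of_real (b * real m)) *
           normalized_bessel_I (b * (real m + \<nu>)) w *
           of_real (normalized_gegenbauer \<nu> m t))"

text \<open>
  In polar coordinates \<open>x = r\<omega>\<close> with \<open>r = norm x\<close> and \<open>\<omega> = sgn x\<close>. If \<open>x = 0\<close> or \<open>y = 0\<close>,
  only the term \<open>m = 0\<close> of \<^const>\<open>deformed_I\<close> survives, which does not depend on the choice
  of \<open>\<omega>\<close>, so \<open>sgn 0 = 0\<close> is harmless.
\<close>

definition deformed_kernel :: "real \<Rightarrow> real^'n \<Rightarrow> real^'n \<Rightarrow> complex" where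
  "deformed_kernel a x y =
     deformed_I (2 / a) ((real CARD('n) - 2) / 2)
       (2 * of_real ((norm x * norm y) powr (a / 2)) / (of_real a * \<i>)) (sgn x \<bullet> sgn y)"

definition deformed_const :: "'n::finite itself \<Rightarrow> real \<Rightarrow> real" where
  "deformed_const _ a =
     inverse (LINT x|lborel. exp (- (1 / a) * norm (x :: real^'n) powr a) / norm x powr (2 - a))"

definition deformed_heat_kernel :: "real \<Rightarrow> real^'n \<Rightarrow> real^'n \<Rightarrow> real \<Rightarrow> complex" where
  "deformed_heat_kernel a x y t =
     of_real (deformed_const TYPE('n) a) *
     (LINT \<xi>|lborel. cnj (deformed_kernel a x \<xi>) * deformed_kernel a y \<xi> *
        of_real (exp (- (t / a) * norm \<xi> powr a)) / of_real (norm \<xi> powr (2 - a)))"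

end

theory Submission
  imports Defs "HOL-Probability.Distributions"
begin

text \<open>
  The polynomial \<open>Z\<^sub>k(x,y) = (|x||y|)\<^sup>k C\<^sub>k(\<langle>x/|x|, y/|y|\<rangle>)\<close>, with \<open>C\<^sub>k\<close> the normalized Gegenbauer polynomial,
  is harmonic in \<open>y\<close> and reproduces harmonic polynomials: integration of \<open>Z\<^sub>k(x,\<cdot>)\<close> against
  \<open>p \<in> H\<^sup>l\<close> over the sphere gives \<open>\<delta>\<^sub>k\<^sub>l p(x)\<close> up to the total mass. Therefore, in polar coordinates
  with radial variable \<open>v = |\<xi>|\<^sup>a/a\<close>, the heat kernel becomes a series over \<open>k\<close> of radial Weber integrals
  times \<open>Z\<^sub>k(x,y)\<close>. Against \<open>|y|\<^sup>m\<^sup>a p(y)\<close> only the term \<open>k = l\<close> survives, and its radial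
  integral is a Laguerre polynomial.

  The reproducing property follows from the spherical moments \<open>\<integral> \<langle>x,\<eta>\<rangle>\<^sup>j p(\<eta>) d\<eta>\<close>, which are read off
  from the power series in \<open>u\<close> of \<open>E[exp(u\<langle>x,G\<rangle>) p(G)] = exp(u\<^sup>2|x|\<^sup>2/2) p(ux)\<close> for a standard Gaussian
  vector \<open>G\<close>; this identity is the Gaussian mean value property \<open>E[p(x + G)] = p(x)\<close> after a translation.
\<close>

text \<open>The choice of radial variable turns the weighted measure, up to a constant, into
  \<open>v powr bessel_index _ a 0\<close> times Lebesgue measure times the cone measure, and
  \<open>exp (- (t / a) * norm \<xi> powr a)\<close> into \<open>exp (- (t * v))\<close>; every
  radial integral is then of Gamma type. The Bessel index grows by 2/a with each degree, and so does
  the exponent of v produced by two homogeneous factors, so Weber's integral applies to every k. The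
  analytic obstacle is the exchange of the series in k with integrals. Zonal polynomials are bounded
  only by a geometric rate in k with large ratio, and the decay of 1/Gamma has to beat it. The
  estimates give C (1/2)^k exp (D rho^(a/2)) for the k-th term: summable in k, and of order exp (D'
  sqrt v) radially, which exp (- t v) absorbs. Each degree meets its own conjugate, so the phases of
  the kernel drop out. The mass of the sphere is never computed; it cancels against the constant
  c_a. The detour through Gaussian means replaces Green's formula on the sphere by one-dimensional
  moments and polynomial identities.\<close>

section \<open>Zonal polynomials\<close>

text \<open>With nu = s - 1 this is the coefficient of t^(k - 2j) in (k + nu) / nu times the
  classical Gegenbauer polynomial. The quotient of \<open>pochhammer nu (k - j)\<close> by nu is
  written as \<open>pochhammer s (k - j - 1)\<close>, so nu = 0, that is dimension 2, needs no
  limit. For k = 0 the truncated subtraction would give s - 1 instead of 1.\<close>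

definition zonal_coeff :: "real \<Rightarrow> nat \<Rightarrow> nat \<Rightarrow> real" where
  "zonal_coeff s k j = (if k = 0 then 1 else
     (- 1) ^ j * 2 ^ (k - 2 * j) * pochhammer s (k - j - 1) * (s + real k - 1) / (fact j * fact (k - 2 * j)))"

text \<open>
  \<open>Z\<^sub>k(x,y) = (|x||y|)\<^sup>k C\<^sub>k(\<langle>x/|x|, y/|y|\<rangle>)\<close>, written as a polynomial so that it also makes sense
  for \<open>x = 0\<close> or \<open>y = 0\<close>.
\<close>

definition zonal :: "nat \<Rightarrow> real^'n \<Rightarrow> real^'n \<Rightarrow> real" where
  "zonal k x y = (\<Sum>j\<le>k div 2. zonal_coeff (real CARD('n) / 2) k j *
      (x \<bullet> x) ^ j * (y \<bullet> y) ^ j * (x \<bullet> y) ^ (k - 2 * j))"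

lemma fps_X_plus_const_power_nth:
  "fps_nth ((fps_X + fps_const (c::real)) ^ n) m = (if m \<le> n then real (n choose m) * c ^ (n - m) else 0)"
proof -
  have "(fps_X + fps_const c) ^ n = (\<Sum>i\<le>n. fps_const (real (n choose i) * c ^ (n - i)) * fps_X ^ i)"
    by (subst binomial_ring, intro sum.cong refl)
       (simp add: fps_const_power fps_of_nat [symmetric] fps_const_mult [symmetric] ac_simps del: fps_const_mult)
  then show ?thesis
    by (simp add: fps_sum_nth fps_X_power_nth if_distrib cong: if_cong)
qed

text \<open>Classical Gegenbauer polynomials from their generating function. In (X^2 - 2tX)^n only
  exponents n with k/2 <= n <= k reach X^k, and j = k - n counts the factors from which X^2 is
  chosen.\<close>

lemma binomial_series_nth:
  "fps_nth (fps_compose (fps_binomial (- s)) (fps_X ^ 2 - fps_const (2 * t) * fps_X)) k =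
     (\<Sum>j\<le>k div 2. (- 1) ^ j * pochhammer s (k - j) / (fact j * fact (k - 2 * j)) * (2 * t) ^ (k - 2 * j))"
    for s t :: real
proof -
  have pw: "fps_nth ((fps_X ^ 2 - fps_const (2 * t) * fps_X) ^ n) k =
      (if n \<le> k \<and> k - n \<le> n then real (n choose (k - n)) * (- (2 * t)) ^ (n - (k - n)) else 0)" for n
  proof -
    have "(fps_X ^ 2 - fps_const (2 * t) * fps_X) = fps_X * (fps_X + fps_const (- (2 * t)))"
      by (simp add: algebra_simps power2_eq_square flip: fps_const_neg)
    then have "(fps_X ^ 2 - fps_const (2 * t) * fps_X) ^ n = fps_X ^ n * (fps_X + fps_const (- (2 * t))) ^ n"
      by (simp only: power_mult_distrib)
    then show ?thesis
      by (simp only: fps_X_power_mult_nth fps_X_plus_const_power_nth) auto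
  qed
  have "fps_nth (fps_compose (fps_binomial (- s)) (fps_X ^ 2 - fps_const (2 * t) * fps_X)) k =
     (\<Sum>n=0..k. (- s gchoose n) * (if n \<le> k \<and> k - n \<le> n then real (n choose (k - n)) * (- (2 * t)) ^ (n - (k - n)) else 0))"
    by (simp only: fps_compose_nth fps_binomial_nth pw)
  also have "\<dots> = (\<Sum>n\<in>{n. n \<le> k \<and> k - n \<le> n}. (- s gchoose n) * (real (n choose (k - n)) * (- (2 * t)) ^ (n - (k - n))))"
    by (rule sum.mono_neutral_cong_right) auto
  also have "\<dots> = (\<Sum>j\<le>k div 2. (- s gchoose (k - j)) * (real ((k - j) choose j) * (- (2 * t)) ^ (k - 2 * j)))"
  proof (rule sum.reindex_bij_witness [of _ "\<lambda>j. k - j" "\<lambda>n. k - n"])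
    fix n assume "n \<in> {n. n \<le> k \<and> k - n \<le> n}"
    then have 1: "k - (k - n) = n" and 2: "k - 2 * (k - n) = n - (k - n)" by auto
    show "(- s gchoose (k - (k - n))) * (real ((k - (k - n)) choose (k - n)) * (- (2 * t)) ^ (k - 2 * (k - n)))
      = (- s gchoose n) * (real (n choose (k - n)) * (- (2 * t)) ^ (n - (k - n)))"
      unfolding 1 2 by (rule refl)
  qed auto
  also have "\<dots> = (\<Sum>j\<le>k div 2. (- 1) ^ j * pochhammer s (k - j) / (fact j * fact (k - 2 * j)) * (2 * t) ^ (k - 2 * j))"
  proof (rule sum.cong [OF refl])
    fix j assume "j \<in> {..k div 2}"
    then have j: "2 * j \<le> k" by auto
    have ch: "real ((k - j) choose j) = fact (k - j) / (fact j * fact (k - 2 * j))"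
      using j by (subst binomial_fact) (auto simp: mult_2)
    have "(- 1) ^ (k - j) * (- 1 :: real) ^ (k - 2 * j) = (- 1) ^ j"
    proof -
      have "(k - j) + (k - 2 * j) = 2 * (k - 2 * j) + j" using j by auto
      then have "(- 1 :: real) ^ ((k - j) + (k - 2 * j)) = (- 1) ^ (2 * (k - 2 * j) + j)" by (rule arg_cong)
      then show ?thesis by (simp add: power_add power_mult)
    qed
    moreover have "(- (2 * t)) ^ (k - 2 * j) = (- 1) ^ (k - 2 * j) * (2 * t) ^ (k - 2 * j)"
      by (metis mult_minus1 power_mult_distrib)
    ultimately show "(- s gchoose (k - j)) * (real ((k - j) choose j) * (- (2 * t)) ^ (k - 2 * j)) =
       (- 1) ^ j * pochhammer s (k - j) / (fact j * fact (k - 2 * j)) * (2 * t) ^ (k - 2 * j)"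
      unfolding ch gbinomial_pochhammer by (simp add: field_simps)
  qed
  finally show ?thesis .
qed

text \<open>The factor 1 - X^2 subtracts the coefficient at k - 2, whose summand j - 1 carries the
  same power of t as the summand j at k. Both share \<open>pochhammer s (k - j - 1)\<close>, and
  what is left combines to (s + k - j - 1) + j = s + k - 1.\<close>

lemma normalized_gegenbauer_expansion:
  "normalized_gegenbauer (s - 1) k t = (\<Sum>j\<le>k div 2. zonal_coeff s k j * t ^ (k - 2 * j))"
proof -
  define Q where "Q = fps_compose (fps_binomial (- s)) (fps_X ^ 2 - fps_const (2 * t) * fps_X)"
  define c where "c = (\<lambda>k j. (- 1) ^ j * pochhammer s (k - j) / (fact j * fact (k - 2 * j)) * (2 * t) ^ (k - 2 * j))"
  have Q: "fps_nth Q k = (\<Sum>j\<le>k div 2. c k j)" for k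
    unfolding Q_def c_def by (rule binomial_series_nth)
  have main: "normalized_gegenbauer (s - 1) k t = fps_nth Q k - (if k < 2 then 0 else fps_nth Q (k - 2))"
    unfolding normalized_gegenbauer_def Q_def by (simp add: ring_distribs fps_X_power_mult_nth)
  show ?thesis
  proof (cases "k < 2")
    case True
    then have "k = 0 \<or> k = 1" by auto
    then show ?thesis by (auto simp: main Q c_def zonal_coeff_def)
  next
    case False
    then have k: "k \<ge> 2" by auto
    have "(\<Sum>j\<le>(k - 2) div 2. c (k - 2) j) = (\<Sum>j\<in>{1..k div 2}. c (k - 2) (j - 1))"
      using k by (intro sum.reindex_bij_witness [of _ "\<lambda>j. j - 1" "Suc"]) auto
    also have "\<dots> = (\<Sum>j\<le>k div 2. if j = 0 then 0 else c (k - 2) (j - 1))"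
      by (rule sum.mono_neutral_cong_left) auto
    finally have "normalized_gegenbauer (s - 1) k t = (\<Sum>j\<le>k div 2. c k j - (if j = 0 then 0 else c (k - 2) (j - 1)))"
      using False by (simp add: main Q sum_subtractf)
    also have "\<dots> = (\<Sum>j\<le>k div 2. zonal_coeff s k j * t ^ (k - 2 * j))"
    proof (rule sum.cong [OF refl])
      fix j assume "j \<in> {..k div 2}"
      then have j: "2 * j \<le> k" by auto
      have p: "pochhammer s (k - j) = pochhammer s (k - j - 1) * (s + real k - real j - 1)"
      proof -
        have "k - j = Suc (k - j - 1)" using j k by auto
        then have "pochhammer s (k - j) = pochhammer s (k - j - 1) * (s + real (k - j - 1))"
          by (metis pochhammer_Suc)
        moreover have "real (k - j - 1) = real k - real j - 1" using j k by auto
        ultimately show ?thesis by (simp add: algebra_simps)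
      qed
      show "c k j - (if j = 0 then 0 else c (k - 2) (j - 1)) = zonal_coeff s k j * t ^ (k - 2 * j)"
      proof (cases j)
        case 0
        then show ?thesis using k p by (simp add: c_def zonal_coeff_def power_mult_distrib)
      next
        case (Suc i)
        have e: "k - 2 - i = k - j - 1" "k - 2 - 2 * i = k - 2 * j" using Suc j by auto
        have f: "fact j = real j * fact i" using Suc by simp
        have j0: "real j \<noteq> 0" using Suc by simp
        show ?thesis using k j0 Suc unfolding c_def zonal_coeff_def p
          by (simp add: e[unfolded Suc, simplified] power_mult_distrib divide_simps) (simp add: algebra_simps)
      qed
    qed
    finally show ?thesis .
  qed
qed

lemma fact_ratio_le: "2 * j \<le> k \<Longrightarrow> fact (k - j - 1) \<le> 2 ^ k * (fact j * fact (k - 2 * j) :: real)"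
proof -
  assume j: "2 * j \<le> k"
  have "fact (k - j - 1) \<le> (fact (k - j) :: real)" by (rule fact_mono) auto
  also have "\<dots> = real ((k - j) choose j) * (fact j * fact (k - 2 * j))"
    using j by (subst binomial_fact) (auto simp: mult_2)
  also have "\<dots> \<le> 2 ^ k * (fact j * fact (k - 2 * j))"
  proof (rule mult_right_mono)
    have "(k - j) choose j \<le> 2 ^ (k - j)" by (rule binomial_le_pow2)
    also have "\<dots> \<le> 2 ^ k" by (rule power_increasing) auto
    finally show "real ((k - j) choose j) \<le> 2 ^ k" by (metis of_nat_le_iff of_nat_numeral of_nat_power)
  qed auto
  finally show ?thesis .
qed

lemma pochhammer_le_power_fact: "s \<ge> 0 \<Longrightarrow> pochhammer s n \<le> (s + 1) ^ n * (fact n :: real)"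
proof (induction n)
  case (Suc n)
  have "s + real n \<le> (s + 1) * real (Suc n)" using Suc.prems by (simp add: algebra_simps)
  then have "pochhammer s n * (s + real n) \<le> ((s + 1) ^ n * fact n) * ((s + 1) * real (Suc n))"
    using Suc by (intro mult_mono) (auto intro: pochhammer_nonneg)
  then show ?case by (simp add: pochhammer_Suc algebra_simps)
qed auto

text \<open>Geometric growth in k is all that is required. The factorial hidden in the Pochhammer
  symbol is, by \<open>fact_ratio_le\<close>, at most 2^k times the denominators. The 8 collects
  this 2^k, the power of 2 in the coefficient, and the linear factor, which is at most (s + 1) *
  2^k.\<close>

lemma zonal_coeff_bound:
  assumes "s > 0" "2 * j \<le> k"
  shows "\<bar>zonal_coeff s k j\<bar> \<le> (s + 1) * (8 * (s + 1)) ^ k"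
proof (cases "k = 0")
  case True
  then show ?thesis using assms by (simp add: zonal_coeff_def)
next
  case False
  have k2: "real k \<le> 2 ^ k" using of_nat_less_two_power[of k, where 'a = real] by linarith
  have k1: "(1::real) \<le> 2 ^ k" by simp
  have A: "s + real k - 1 \<le> (s + 1) * 2 ^ k"
    using mult_left_mono[OF k1, of s] assms(1) k2 unfolding distrib_right by linarith
  have "\<bar>zonal_coeff s k j\<bar> = 2 ^ (k - 2 * j) * (s + real k - 1) * (pochhammer s (k - j - 1) / (fact j * fact (k - 2 * j)))"
    using False assms(1) pochhammer_nonneg[of s "k - j - 1"] by (simp add: zonal_coeff_def abs_mult power_abs)
  also have "\<dots> \<le> 2 ^ k * ((s + 1) * 2 ^ k) * ((s + 1) ^ k * 2 ^ k)"
  proof (intro mult_mono A)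
    have "pochhammer s (k - j - 1) \<le> (s + 1) ^ (k - j - 1) * fact (k - j - 1)"
      using assms by (intro pochhammer_le_power_fact) auto
    also have "\<dots> \<le> (s + 1) ^ k * (2 ^ k * (fact j * fact (k - 2 * j)))"
      using assms fact_ratio_le[OF assms(2)] by (intro mult_mono power_increasing) auto
    finally show "pochhammer s (k - j - 1) / (fact j * fact (k - 2 * j)) \<le> (s + 1) ^ k * 2 ^ k"
      by (simp add: divide_simps mult.assoc)
  qed (use assms False in \<open>auto intro!: pochhammer_nonneg divide_nonneg_nonneg\<close>)
  also have "\<dots> = (s + 1) * (8 * (s + 1)) ^ k"
  proof -
    have "(8 * (s + 1)) ^ k = 2 ^ k * (2 ^ k * (2 ^ k * (s + 1) ^ k))"
      unfolding power_mult_distrib [symmetric] by (simp add: algebra_simps)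
    then show ?thesis by simp
  qed
  finally show ?thesis .
qed

text \<open>Passing from 8 to 16 pays for the number of summands, which is at most 2^k.\<close>

lemma zonal_bound:
  fixes x y :: "real^'n"
  defines "s \<equiv> real CARD('n) / 2"
  shows "\<bar>zonal k x y\<bar> \<le> (s + 1) * (16 * (s + 1)) ^ k * (norm x * norm y) ^ k"
proof -
  have s: "s > 0" unfolding s_def by simp
  have "\<bar>zonal k x y\<bar> \<le> (\<Sum>j\<le>k div 2. (s + 1) * (8 * (s + 1)) ^ k * (norm x * norm y) ^ k)"
    unfolding zonal_def s_def [symmetric]
  proof (intro order_trans[OF sum_abs] sum_mono)
    fix j assume "j \<in> {..k div 2}"
    then have j: "2 * j \<le> k" by auto
    have "\<bar>zonal_coeff s k j * (x \<bullet> x) ^ j * (y \<bullet> y) ^ j * (x \<bullet> y) ^ (k - 2 * j)\<bar>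
        = \<bar>zonal_coeff s k j\<bar> * ((norm x * norm y) ^ (2 * j) * \<bar>x \<bullet> y\<bar> ^ (k - 2 * j))"
      by (simp add: abs_mult power_abs power_mult_distrib power_mult power2_norm_eq_inner)
    also have "\<dots> \<le> ((s + 1) * (8 * (s + 1)) ^ k) * ((norm x * norm y) ^ (2 * j) * (norm x * norm y) ^ (k - 2 * j))"
      using s by (intro mult_mono zonal_coeff_bound j power_mono Cauchy_Schwarz_ineq2) auto
    also have "\<dots> = (s + 1) * (8 * (s + 1)) ^ k * (norm x * norm y) ^ k"
      using j by (simp flip: power_add)
    finally show "\<bar>zonal_coeff s k j * (x \<bullet> x) ^ j * (y \<bullet> y) ^ j * (x \<bullet> y) ^ (k - 2 * j)\<bar> \<le> \<dots>" .
  qed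
  also have "\<dots> = real (k div 2 + 1) * ((s + 1) * (8 * (s + 1)) ^ k * (norm x * norm y) ^ k)"
    by (simp add: add.commute)
  also have "\<dots> \<le> 2 ^ k * ((s + 1) * (8 * (s + 1)) ^ k * (norm x * norm y) ^ k)"
  proof (rule mult_right_mono)
    have "k div 2 + 1 \<le> 2 ^ k"
    proof (cases "k = 0")
      case False
      then have "k div 2 + 1 \<le> k" by linarith
      also have "k \<le> 2 ^ k" by (rule less_imp_le) simp
      finally show ?thesis .
    qed simp
    then show "real (k div 2 + 1) \<le> 2 ^ k" by (metis of_nat_le_iff of_nat_numeral of_nat_power)
  qed (use s in auto)
  also have "\<dots> = (s + 1) * (16 * (s + 1)) ^ k * (norm x * norm y) ^ k"
  proof -
    have "(16 * (s + 1)) ^ k = 2 ^ k * (8 * (s + 1)) ^ k" by (subst power_mult_distrib [symmetric]) (simp add: algebra_simps)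
    then show ?thesis by (simp only: mult.assoc mult.left_commute mult.commute)
  qed
  finally show ?thesis .
qed

text \<open>Turns the angular factor of the kernel into a polynomial. The points x = 0 and y = 0,
  where \<open>sgn 0 = 0\<close>, are covered: there both sides are 1 for k = 0 and 0
  otherwise.\<close>

lemma zonal_sgn:
  fixes x y :: "real^'n"
  shows "(norm x * norm y) ^ k * normalized_gegenbauer ((real CARD('n) - 2) / 2) k (sgn x \<bullet> sgn y) = zonal k x y"
proof -
  have e: "(real CARD('n) - 2) / 2 = real CARD('n) / 2 - 1" by (simp add: field_simps)
  have i: "norm x * norm y * (sgn x \<bullet> sgn y) = x \<bullet> y"
  proof (cases "x = 0 \<or> y = 0")
    case False
    then have "norm x \<noteq> 0" "norm y \<noteq> 0" by auto
    then show ?thesis by (simp add: sgn_div_norm divide_simps)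
  qed auto
  show ?thesis
    unfolding e normalized_gegenbauer_expansion zonal_def sum_distrib_left
  proof (rule sum.cong [OF refl])
    fix j assume "j \<in> {..k div 2}"
    then have j: "2 * j \<le> k" by auto
    have "(norm x * norm y) ^ k * (sgn x \<bullet> sgn y) ^ (k - 2 * j)
       = (norm x * norm y) ^ (2 * j) * ((norm x * norm y) ^ (k - 2 * j) * (sgn x \<bullet> sgn y) ^ (k - 2 * j))"
      using j by (simp add: mult.assoc [symmetric] flip: power_add)
    also have "\<dots> = (x \<bullet> x) ^ j * (y \<bullet> y) ^ j * (x \<bullet> y) ^ (k - 2 * j)"
      unfolding power_mult_distrib [symmetric] i
      by (simp add: power_mult_distrib power_mult power2_norm_eq_inner)
    finally show "(norm x * norm y) ^ k * (zonal_coeff (real CARD('n) / 2) k j * (sgn x \<bullet> sgn y) ^ (k - 2 * j)) =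
         zonal_coeff (real CARD('n) / 2) k j * (x \<bullet> x) ^ j * (y \<bullet> y) ^ j * (x \<bullet> y) ^ (k - 2 * j)"
      by (simp add: algebra_simps)
  qed
qed

lemma zonal_scale: "zonal k x (c *\<^sub>R y) = c ^ k * zonal k x y"
  unfolding zonal_def sum_distrib_left
proof (rule sum.cong [OF refl])
  fix j assume "j \<in> {..k div 2}"
  then have "c ^ k = c ^ (2 * j) * c ^ (k - 2 * j)" by (simp flip: power_add)
  then show "zonal_coeff (real CARD('a) / 2) k j * (x \<bullet> x) ^ j * (c *\<^sub>R y \<bullet> c *\<^sub>R y) ^ j * (x \<bullet> c *\<^sub>R y) ^ (k - 2 * j)
     = c ^ k * (zonal_coeff (real CARD('a) / 2) k j * (x \<bullet> x) ^ j * (y \<bullet> y) ^ j * (x \<bullet> y) ^ (k - 2 * j))"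
    by (simp add: power_mult_distrib power_mult power2_eq_square)
qed

section \<open>Polar coordinates\<close>

text \<open>
  The cone measure on the unit sphere; its total mass is the volume of the unit ball, not the
  surface area.
\<close>

definition sphere_measure :: "'a::euclidean_space measure" where
  "sphere_measure = distr (density lborel (indicator (cball 0 1))) borel sgn"

abbreviation sphere_mass :: "'a::euclidean_space itself \<Rightarrow> real" where
  "sphere_mass (T :: 'a itself) \<equiv> measure (sphere_measure :: 'a measure) UNIV"

lemma borel_measurable_sgn_vec [measurable]: "(sgn :: 'a::euclidean_space \<Rightarrow> 'a) \<in> borel_measurable borel"
  unfolding sgn_div_norm by measurable

lemma sets_sphere_measure [simp, measurable_cong]: "sets sphere_measure = sets borel"
  and space_sphere_measure [simp]: "space sphere_measure = UNIV"
  by (auto simp: sphere_measure_def)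

lemma emeasure_sphere_measure:
  fixes A :: "'a::euclidean_space set"
  assumes [measurable]: "A \<in> sets borel"
  shows "emeasure sphere_measure A = emeasure lborel (cball 0 1 \<inter> sgn -` A)"
proof -
  have [measurable]: "sgn -` A \<in> sets borel" using measurable_sets_borel[OF borel_measurable_sgn_vec assms] by simp
  have "emeasure sphere_measure A = (\<integral>\<^sup>+x. indicator (cball 0 1) x * indicator (sgn -` A) x \<partial>lborel)"
    unfolding sphere_measure_def by (subst emeasure_distr) (simp_all add: emeasure_density borel_measurable_indicator')
  also have "\<dots> = (\<integral>\<^sup>+x. indicator (cball 0 1 \<inter> sgn -` A) x \<partial>lborel)"
    by (intro nn_integral_cong) (auto simp: indicator_def)
  finally show ?thesis by simp
qed

lemma finite_measure_sphere_measure: "finite_measure sphere_measure"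
  by (rule finite_measureI)
     (use emeasure_lborel_cball_finite[of 0 1] in \<open>simp add: emeasure_sphere_measure less_top\<close>)

interpretation sphere: finite_measure sphere_measure
  by (rule finite_measure_sphere_measure)

lemma sphere_measure_pos: "sphere_mass TYPE('a::euclidean_space) > 0"
  using content_cball_pos[of 1 "0::'a"] by (simp add: measure_def emeasure_sphere_measure)

lemma AE_sphere_measure: "AE x in sphere_measure. norm x = 1"
proof -
  have "AE x in lborel. x \<noteq> (0::'a)" by (rule AE_lborel_singleton)
  then have "AE x in density lborel (indicator (cball 0 1)). norm (sgn x :: 'a) = 1"
    by (subst AE_density) (auto simp: norm_sgn intro: borel_measurable_indicator')
  then show ?thesis
    unfolding sphere_measure_def by (subst AE_distr_iff) auto
qed

text \<open>The v-derivative of \<open>(a * v) powr (N / a)\<close>, the volume of the ball |x|^a /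
  a <= v relative to the unit ball. The volume of the unit ball itself sits in the mass of
  \<open>sphere_measure\<close>.\<close>

definition radial_density :: "'a::euclidean_space itself \<Rightarrow> real \<Rightarrow> real \<Rightarrow> real" where
  "radial_density _ a v = indicator {0<..} v * (real DIM('a) * (a * v) powr (real DIM('a) / a - 1))"

lemma radial_density_measurable [measurable]: "radial_density T a \<in> borel_measurable borel"
  unfolding radial_density_def [abs_def] by measurable

lemma radial_density_nonneg: "a > 0 \<Longrightarrow> radial_density T a v \<ge> 0"
  by (simp add: radial_density_def)

lemma emeasure_radial_density:
  assumes a: "a > 0"
  shows "emeasure (density lborel (\<lambda>v. ennreal (radial_density TYPE('a::euclidean_space) a v))) {..V} =
     ennreal (if V > 0 then (a * V) powr (real DIM('a) / a) else 0)"
proof (cases "V > 0")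
  case False
  then show ?thesis
    by (subst emeasure_density, simp, simp)
       (auto simp: radial_density_def indicator_def nn_integral_0_iff_AE intro!: AE_I2)
next
  case True
  define d where "d = real DIM('a) / a"
  have d: "d > 0" using a by (simp add: d_def)
  have "((\<lambda>v. v powr (d - 1)) has_integral (V powr (d - 1 + 1) / (d - 1 + 1))) {0..V}"
    using d True by (intro has_integral_powr_from_0) auto
  then have "((\<lambda>v. (real DIM('a) * a powr (d - 1)) * v powr (d - 1)) has_integral
      ((real DIM('a) * a powr (d - 1)) * (V powr d / d))) {0..V}"
    by (intro has_integral_mult_right) simp
  moreover have "(real DIM('a) * a powr (d - 1)) * (V powr d / d) = (a * V) powr d"
    using a True by (simp add: d_def powr_diff powr_mult)
  ultimately have I: "((\<lambda>v. (real DIM('a) * a powr (d - 1)) * v powr (d - 1)) has_integral ((a * V) powr d)) {0..V}"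
    by simp
  have "emeasure (density lborel (\<lambda>v. ennreal (radial_density TYPE('a) a v))) {..V}
     = (\<integral>\<^sup>+v. ennreal (indicator {0..V} v *\<^sub>R ((real DIM('a) * a powr (d - 1)) * v powr (d - 1))) \<partial>lborel)"
    by (subst emeasure_density)
       (use a in \<open>auto intro!: nn_integral_cong simp: radial_density_def indicator_def d_def powr_mult\<close>)
  also have "\<dots> = ennreal ((a * V) powr d)"
  proof (rule nn_integral_has_integral_lborel)
    have "(\<lambda>v. indicator {0..V} v *\<^sub>R ((real DIM('a) * a powr (d - 1)) * v powr (d - 1))) =
        (\<lambda>v. if v \<in> {0..V} then (real DIM('a) * a powr (d - 1)) * v powr (d - 1) else 0)"
      by (auto simp: indicator_def fun_eq_iff)
    then show "((\<lambda>v. indicator {0..V} v *\<^sub>R ((real DIM('a) * a powr (d - 1)) * v powr (d - 1))) has_integral (a * V) powr d) UNIV"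
      using I by (simp only: has_integral_restrict_UNIV)
  qed auto
  finally show ?thesis using True by (simp add: d_def)
qed

lemma emeasure_cone:
  fixes B :: "'a::euclidean_space set"
  assumes B: "B \<in> sets borel" and R: "R > 0"
  shows "emeasure lborel (cball 0 R \<inter> sgn -` B) = ennreal (R ^ DIM('a)) * emeasure sphere_measure B"
proof -
  have S: "sgn -` B \<in> sets borel" using B measurable_sets_borel[OF borel_measurable_sgn_vec B] by simp
  have eq: "(*\<^sub>R) R -` (cball 0 R \<inter> sgn -` B) = cball 0 1 \<inter> sgn -` B"
    using R by (auto simp: sgn_scaleR)
  have "emeasure lborel (cball 0 R \<inter> sgn -` B) =
     emeasure (density (distr lborel borel (\<lambda>x. 0 + R *\<^sub>R x)) (\<lambda>_. ennreal (\<bar>R\<bar> ^ DIM('a)))) (cball 0 R \<inter> sgn -` B)"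
    using R lborel_affine[of R "0::'a"] by simp
  also have "\<dots> = ennreal (R ^ DIM('a)) * emeasure (distr lborel borel (\<lambda>x::'a. R *\<^sub>R x)) (cball 0 R \<inter> sgn -` B)"
    using R S by (subst emeasure_density_const) auto
  also have "emeasure (distr lborel borel (\<lambda>x::'a. R *\<^sub>R x)) (cball 0 R \<inter> sgn -` B) = emeasure sphere_measure B"
    using S B eq by (subst emeasure_distr) (auto simp: emeasure_sphere_measure simp del: vimage_Int)
  finally show ?thesis .
qed

text \<open>Both measures are compared on rectangles A x B. For fixed B, two measures on the line
  remain; they need to agree only on half-lines, whose preimages are truncated cones, and dilation
  gives the volume of those.\<close>

lemma distr_polar:
  assumes a: "a > 0"
  shows "density lborel (\<lambda>v. ennreal (radial_density TYPE('a::euclidean_space) a v)) \<Otimes>\<^sub>M sphere_measure =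
     distr lborel (borel \<Otimes>\<^sub>M borel) (\<lambda>x::'a. (norm x powr a / a, sgn x))"
    (is "?M1 \<Otimes>\<^sub>M _ = ?D")
proof (rule pair_measure_eqI)
  have fin: "emeasure ?M1 {..V} \<noteq> \<infinity>" for V
    by (simp add: emeasure_radial_density[OF a])
  show "sigma_finite_measure ?M1"
  proof
    show "\<exists>A. countable A \<and> A \<subseteq> sets ?M1 \<and> \<Union> A = space ?M1 \<and> (\<forall>a\<in>A. emeasure ?M1 a \<noteq> \<infinity>)"
      by (rule exI[of _ "range (\<lambda>n::nat. {..real n})"]) (use fin in \<open>auto simp: real_arch_simple\<close>)
  qed
  show "sigma_finite_measure (sphere_measure :: 'a measure)" by (rule sphere.sigma_finite_measure_axioms)
  show "sets (?M1 \<Otimes>\<^sub>M sphere_measure) = sets ?D" by (simp cong: sets_pair_measure_cong)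
  fix A :: "real set" and B :: "'a set" assume A: "A \<in> sets ?M1" and B: "B \<in> sets sphere_measure"
  then have [measurable]: "A \<in> sets borel" "B \<in> sets borel" by auto
  define c where "c = measure sphere_measure B"
  have c: "emeasure sphere_measure B = ennreal c" "c \<ge> 0" by (auto simp: c_def sphere.emeasure_eq_measure)
  let ?N = "distr (density lborel (indicator (sgn -` B))) borel (\<lambda>x::'a. norm x powr a / a)"
  have S [measurable]: "sgn -` B \<in> sets borel" using measurable_sets_borel[OF borel_measurable_sgn_vec \<open>B \<in> sets borel\<close>] by simp
  have N: "emeasure ?N X = emeasure lborel {x. norm x powr a / a \<in> X \<and> sgn x \<in> B}" if [measurable]: "X \<in> sets borel" for X
  proof -
    have [measurable]: "(\<lambda>x. norm x powr a / a) -` X \<in> sets (borel :: 'a measure)"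
      by (rule measurable_sets_borel[OF _ that]) measurable
    have "emeasure ?N X = (\<integral>\<^sup>+x. indicator (sgn -` B) x * indicator ((\<lambda>x. norm x powr a / a) -` X) x \<partial>lborel)"
      by (subst emeasure_distr) (simp_all add: emeasure_density)
    also have "\<dots> = (\<integral>\<^sup>+x. indicator {x. norm x powr a / a \<in> X \<and> sgn x \<in> B} x \<partial>lborel)"
      by (intro nn_integral_cong) (auto simp: indicator_def)
    finally show ?thesis by simp
  qed
  have "density ?M1 (\<lambda>_. ennreal c) = ?N"
  proof (rule measure_eqI_generator_eq[where E = "range (\<lambda>V. {..V})" and \<Omega> = UNIV and A = "\<lambda>n. {..real n}"])
    show "Int_stable (range (\<lambda>V::real. {..V}))" by (auto simp: Int_stable_def)
    show "sets (density ?M1 (\<lambda>_. ennreal c)) = sigma_sets UNIV (range (\<lambda>V::real. {..V}))"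
      by (simp add: borel_eq_atMost)
    show "sets ?N = sigma_sets UNIV (range (\<lambda>V::real. {..V}))"
      by (simp add: borel_eq_atMost)
    show "(\<Union>i. {..real i}) = (UNIV :: real set)" by (auto simp: real_arch_simple)
    show "emeasure (density ?M1 (\<lambda>_. ennreal c)) {..real n} \<noteq> \<infinity>" for n
      using fin by (subst emeasure_density_const) (auto simp: ennreal_mult_eq_top_iff)
    fix X assume "X \<in> range (\<lambda>V::real. {..V})"
    then obtain V where X: "X = {..V}" by auto
    have L: "emeasure (density ?M1 (\<lambda>_. ennreal c)) X = ennreal c * ennreal (if V > 0 then (a * V) powr (real DIM('a) / a) else 0)"
      unfolding X by (subst emeasure_density_const) (auto simp: emeasure_radial_density[OF a])
    show "emeasure (density ?M1 (\<lambda>_. ennreal c)) X = emeasure ?N X"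
    proof (cases "V > 0")
      case True
      define R where "R = (a * V) powr (1 / a)"
      have R: "R > 0" using a True by (simp add: R_def)
      have "{x. norm x powr a / a \<in> X \<and> sgn x \<in> B} = cball 0 R \<inter> sgn -` B"
      proof -
        have iff: "norm x powr a / a \<le> V \<longleftrightarrow> norm x \<le> R" for x :: 'a
        proof -
          have "norm x powr a / a \<le> V \<longleftrightarrow> norm x powr a \<le> R powr a"
            using a True by (simp add: R_def powr_powr field_simps)
          also have "\<dots> \<longleftrightarrow> norm x \<le> R" using a R powr_less_mono2[of a R "norm x"] powr_mono2[of a "norm x" R]
            by (cases "norm x \<le> R") auto
          finally show ?thesis .
        qed
        show ?thesis by (intro set_eqI) (simp only: X mem_Collect_eq atMost_iff iff Int_iff mem_cball_0 vimage_eq)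
      qed
      then have "emeasure ?N X = ennreal (R ^ DIM('a)) * ennreal c"
        by (subst N) (simp_all only: X atMost_borel emeasure_cone[OF \<open>B \<in> sets borel\<close> R] c)
      also have "R ^ DIM('a) = (a * V) powr (real DIM('a) / a)"
        using R by (simp add: R_def powr_powr flip: powr_realpow)
      finally show ?thesis using True L by (simp add: mult.commute)
    next
      case False
      \<comment> \<open>For V <= 0 only the origin can occur, and it is a null set.\<close>
      have "{x. norm x powr a / a \<in> X \<and> sgn x \<in> B} \<subseteq> {0}"
      proof
        fix x assume "x \<in> {x. norm x powr a / a \<in> X \<and> sgn x \<in> B}"
        then have "norm x powr a / a \<le> 0" using False by (simp add: X)
        then have "norm x powr a \<le> 0" using a by (simp add: divide_le_0_iff)
        then show "x \<in> {0}" by simp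
      qed
      then have "emeasure lborel {x. norm x powr a / a \<in> X \<and> sgn x \<in> B} \<le> emeasure lborel {0::'a}"
        by (intro emeasure_mono) auto
      then have "emeasure ?N X = 0" by (subst N) (auto simp: X)
      then show ?thesis using False L by simp
    qed
  qed auto
  then have "ennreal c * emeasure ?M1 A = emeasure ?N A"
    by (metis emeasure_density_const A)
  also have "\<dots> = emeasure ?D (A \<times> B)"
    by (subst N, measurable, subst emeasure_distr) (auto intro!: arg_cong2[where f = emeasure])
  finally show "emeasure ?M1 A * emeasure sphere_measure B = emeasure ?D (A \<times> B)"
    by (simp add: c mult.commute)
qed

text \<open>The exponents combine as N/a - 1 - (2 - a)/a = d, so the weight |x|^(a - 2) leaves a
  plain power of v. The radial majorant g reduces the integrability needed for Fubini to dimension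
  one.\<close>

lemma polar_integral:
  fixes F :: "'a::euclidean_space \<Rightarrow> complex" and a :: real
  defines "d \<equiv> (real DIM('a) - 2) / a"
  assumes a: "a > 0" and F [measurable]: "F \<in> borel_measurable borel"
    and bound: "\<And>x. x \<noteq> 0 \<Longrightarrow> norm (F x) \<le> g (norm x powr a / a)"
    and g: "integrable lborel (\<lambda>v. indicator {0<..} v * (v powr d * g v))"
  shows "integrable lborel (\<lambda>x. F x / of_real (norm x powr (2 - a)))"
    and "(LINT x|lborel. F x / of_real (norm x powr (2 - a))) =
      of_real (real DIM('a) * a powr d) *
        (LINT v|lborel. indicator {0<..} v *\<^sub>R (v powr d *\<^sub>R (LINT \<eta>|sphere_measure. F ((a * v) powr (1 / a) *\<^sub>R \<eta>))))"
proof -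
  let ?J = "\<lambda>v. LINT \<eta>|sphere_measure. F ((a * v) powr (1 / a) *\<^sub>R \<eta>)"
  define M where "M = density lborel (\<lambda>v. ennreal (radial_density TYPE('a) a v))"
  define G where "G = (\<lambda>(v, \<eta>). F ((a * v) powr (1 / a) *\<^sub>R \<eta>) / of_real (((a * v) powr (1 / a)) powr (2 - a)))"
  define T where "T = (\<lambda>x::'a. (norm x powr a / a, sgn x))"
  have T [measurable]: "T \<in> borel \<rightarrow>\<^sub>M borel \<Otimes>\<^sub>M borel" unfolding T_def by measurable
  have G [measurable]: "G \<in> borel_measurable (borel \<Otimes>\<^sub>M borel)" unfolding G_def by measurable
  have MS: "M \<Otimes>\<^sub>M sphere_measure = distr lborel (borel \<Otimes>\<^sub>M borel) T"
    unfolding M_def T_def by (rule distr_polar[OF a])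
  have sM [measurable_cong]: "sets M = sets borel" by (simp add: M_def)
  have sMS [measurable_cong]: "sets (M \<Otimes>\<^sub>M (sphere_measure :: 'a measure)) = sets (borel \<Otimes>\<^sub>M borel)"
    by (simp add: sM cong: sets_pair_measure_cong)
  interpret M: sigma_finite_measure M
  proof
    show "\<exists>A. countable A \<and> A \<subseteq> sets M \<and> \<Union> A = space M \<and> (\<forall>a\<in>A. emeasure M a \<noteq> \<infinity>)"
      by (rule exI[of _ "range (\<lambda>n::nat. {..real n})"])
         (auto simp: real_arch_simple M_def emeasure_radial_density[OF a])
  qed
  interpret S: sigma_finite_measure "sphere_measure :: 'a measure" by (rule sphere.sigma_finite_measure_axioms)
  interpret P: pair_sigma_finite M "sphere_measure :: 'a measure" ..
  \<comment> \<open>At x = 0 both sides are quotients by \<open>0 powr _ = 0\<close> and hence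
    0.\<close>
  have GT: "G (T x) = F x / of_real (norm x powr (2 - a))" for x
  proof (cases "x = 0")
    case False
    then have "(a * (norm x powr a / a)) powr (1 / a) = norm x" using a by (simp add: powr_powr)
    then show ?thesis using False by (simp add: G_def T_def norm_sgn sgn_div_norm)
  qed (simp add: G_def T_def)
  have w: "radial_density TYPE('a) a v / ((a * v) powr (1 / a)) powr (2 - a) = indicator {0<..} v * (real DIM('a) * a powr d * v powr d)" for v
  proof (cases "v > 0")
    case True
    have e: "real DIM('a) / a - 1 = d + (1 / a) * (2 - a)" using a by (simp add: d_def field_simps)
    show ?thesis using True a unfolding radial_density_def e powr_powr powr_add
      by (simp add: powr_mult)
  qed (simp add: radial_density_def)
  \<comment> \<open>The majorant g with the weight restored. Measurability is known only for the
    weighted product that contains g, so h is recovered from that product by division on v >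
    0.\<close>
  define h where "h = (\<lambda>v. if v > 0 then g v / ((a * v) powr (1 / a)) powr (2 - a) else 0)"
  have hM: "integrable M h"
  proof -
    have eq: "radial_density TYPE('a) a v *\<^sub>R h v = real DIM('a) * a powr d * (indicator {0<..} v * (v powr d * g v))" for v
    proof -
      have "radial_density TYPE('a) a v *\<^sub>R h v = g v * (radial_density TYPE('a) a v / ((a * v) powr (1 / a)) powr (2 - a))"
        by (simp add: h_def radial_density_def)
      then show ?thesis unfolding w by simp
    qed
    have "h v = (if v > 0 then (indicator {0<..} v * (v powr d * g v)) / v powr d / ((a * v) powr (1 / a)) powr (2 - a) else 0)" for v
      by (simp add: h_def)
    moreover have [measurable]: "(\<lambda>v. indicator {0<..} v * (v powr d * g v)) \<in> borel_measurable borel"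
      using g by (simp add: borel_measurable_integrable flip: measurable_lborel1)
    ultimately have [measurable]: "h \<in> borel_measurable borel"
      by (simp add: fun_eq_iff [symmetric] cong: measurable_cong)
    have "integrable lborel (\<lambda>v. radial_density TYPE('a) a v *\<^sub>R h v)"
      unfolding eq using g by (rule integrable_mult_right)
    then show ?thesis
      unfolding M_def by (subst integrable_density) (auto simp: radial_density_nonneg[OF a])
  qed
  have G_int: "integrable (M \<Otimes>\<^sub>M sphere_measure) G"
  proof (rule Bochner_Integration.integrable_bound)
    show "integrable (M \<Otimes>\<^sub>M (sphere_measure :: 'a measure)) (\<lambda>(v, \<eta>). h v)"
    proof (rule P.Fubini_integrable)
      have [measurable]: "h \<in> borel_measurable M" using hM by (rule borel_measurable_integrable)
      show "(\<lambda>(v, \<eta>). h v) \<in> borel_measurable (M \<Otimes>\<^sub>M (sphere_measure :: 'a measure))" by measurable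
      show "integrable M (\<lambda>v. LINT \<eta>|(sphere_measure :: 'a measure). norm (case (v, \<eta>) of (v, \<eta>) \<Rightarrow> h v))"
        using hM by simp
    qed auto
    show "AE p in M \<Otimes>\<^sub>M (sphere_measure :: 'a measure). norm (G p) \<le> norm (case p of (v, \<eta>) \<Rightarrow> h v)"
    proof -
      have "AE x in lborel. norm (G (T x)) \<le> norm (case T x of (v, \<eta>) \<Rightarrow> h v)"
      proof (rule AE_mp[OF AE_lborel_singleton[of 0]], rule AE_I2, rule impI)
        fix x :: 'a assume x: "x \<noteq> 0"
        then have e: "(a * (norm x powr a / a)) powr (1 / a) = norm x" using a by (simp add: powr_powr)
        have "norm (G (T x)) \<le> g (norm x powr a / a) / norm x powr (2 - a)"
          unfolding GT by (simp add: norm_divide divide_right_mono bound x)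
        also have "\<dots> = h (norm x powr a / a)" using x a by (simp add: h_def powr_powr)
        finally show "norm (G (T x)) \<le> norm (case T x of (v, \<eta>) \<Rightarrow> h v)"
          by (simp add: T_def)
      qed
      moreover have [measurable]: "h \<in> borel_measurable borel" 
        using borel_measurable_integrable[OF hM] by (simp add: M_def)
      ultimately show ?thesis
        unfolding MS by (subst AE_distr_iff) auto
    qed
  qed (simp add: sMS)
  then have "integrable (distr lborel (borel \<Otimes>\<^sub>M borel) T) G" by (simp only: MS)
  then show "integrable lborel (\<lambda>x. F x / of_real (norm x powr (2 - a)))"
    by (subst (asm) integrable_distr_eq) (simp_all add: GT)
  have "(LINT x|lborel. F x / of_real (norm x powr (2 - a))) = integral\<^sup>L (M \<Otimes>\<^sub>M sphere_measure) G"
    unfolding MS by (subst integral_distr) (simp_all add: GT)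
  also have "\<dots> = (LINT v|M. LINT \<eta>|sphere_measure. G (v, \<eta>))"
    using P.integral_fst'[OF G_int] by simp
  also have "\<dots> = (LINT v|lborel. radial_density TYPE('a) a v *\<^sub>R (LINT \<eta>|sphere_measure. G (v, \<eta>)))"
    unfolding M_def
    by (subst integral_density) (auto simp: radial_density_nonneg[OF a])
  also have "\<dots> = (LINT v|lborel. of_real (real DIM('a) * a powr d) *
        (indicator {0<..} v *\<^sub>R (v powr d *\<^sub>R ?J v)))"
  proof (rule Bochner_Integration.integral_cong[OF refl])
    fix v
    have "radial_density TYPE('a) a v *\<^sub>R (LINT \<eta>|sphere_measure. G (v, \<eta>)) =
        (radial_density TYPE('a) a v / ((a * v) powr (1 / a)) powr (2 - a)) *\<^sub>R ?J v"
      by (simp add: G_def scaleR_conv_of_real)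
    then show "radial_density TYPE('a) a v *\<^sub>R (LINT \<eta>|sphere_measure. G (v, \<eta>)) = of_real (real DIM('a) * a powr d) *
        (indicator {0<..} v *\<^sub>R (v powr d *\<^sub>R ?J v))"
      unfolding w by (simp add: scaleR_conv_of_real)
  qed
  also have "\<dots> = of_real (real DIM('a) * a powr d) *
        (LINT v|lborel. indicator {0<..} v *\<^sub>R (v powr d *\<^sub>R ?J v))"
    by (rule integral_mult_right_zero)
  finally show "(LINT x|lborel. F x / of_real (norm x powr (2 - a))) = \<dots>" .
qed

section \<open>Gaussian means of harmonic polynomials\<close>

definition std_normal_moment :: "nat \<Rightarrow> real" where
  "std_normal_moment k = (LINT z|lborel. std_normal_density z * z ^ k)"

lemma std_normal_moment_0 [simp]: "std_normal_moment 0 = 1"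
  using integral_std_normal_moment_even[of 0] by (simp add: std_normal_moment_def)

lemma std_normal_moment_1 [simp]: "std_normal_moment (Suc 0) = 0"
  using integral_std_normal_moment_odd[of 0] by (simp add: std_normal_moment_def)

text \<open>Integration by parts, here read off from the closed forms of the moments. This
  recurrence is the algebraic content of the heat equation in
  \<open>heat_monomial_deriv\<close>.\<close>

lemma std_normal_moment_rec: "std_normal_moment (Suc (Suc k)) = (real k + 1) * std_normal_moment k"
proof (cases "even k")
  case True
  then obtain j where j: "k = 2 * j" by auto
  have "std_normal_moment (2 * (j + 1)) = (fact (2 * (j + 1)) / (2 ^ (j + 1) * fact (j + 1)) :: real)"
    unfolding std_normal_moment_def by (rule integral_std_normal_moment_even)
  moreover have "std_normal_moment (2 * j) = (fact (2 * j) / (2 ^ j * fact j) :: real)"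
    unfolding std_normal_moment_def by (rule integral_std_normal_moment_even)
  moreover have "fact (2 * (j + 1)) / (2 ^ (j + 1) * fact (j + 1)) = (real k + 1) * (fact (2 * j) / (2 ^ j * fact j) :: real)"
  proof -
    have "fact (2 * (j + 1)) = (2 * (real j + 1)) * ((2 * real j + 1) * fact (2 * j))"
      by (simp add: algebra_simps)
    moreover have "2 ^ (j + 1) * fact (j + 1) = (2 * (real j + 1)) * (2 ^ j * fact j)"
      by (simp add: algebra_simps)
    moreover have "2 * (real j + 1) \<noteq> 0" by simp
    ultimately show ?thesis unfolding j by (simp only: mult_divide_mult_cancel_left) simp
  qed
  moreover have "Suc (Suc k) = 2 * (j + 1)" by (simp add: j)
  ultimately show ?thesis by (simp only: j)
next
  case False
  then obtain j where j: "k = 2 * j + 1" by (auto elim: oddE)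
  have "std_normal_moment (2 * (j + 1) + 1) = 0" "std_normal_moment (2 * j + 1) = 0"
    unfolding std_normal_moment_def by (rule integral_std_normal_moment_odd)+
  then show ?thesis by (simp add: j)
qed

text \<open>The solution of the heat equation \<open>\<partial>u/\<partial>(s\<^sup>2/2) = \<partial>\<^sup>2u/\<partial>x\<^sup>2\<close> with initial value \<open>x\<^sup>n\<close>.\<close>

definition heat_monomial :: "nat \<Rightarrow> real \<Rightarrow> real \<Rightarrow> real" where
  "heat_monomial n x s = (LINT z|lborel. std_normal_density z * (x + s * z) ^ n)"

lemma heat_monomial_expand:
  "std_normal_density z * (x + s * z) ^ n =
     (\<Sum>k\<le>n. (real (n choose k) * x ^ (n - k) * s ^ k) * (std_normal_density z * z ^ k))"
  by (subst add.commute, subst binomial_ring, subst sum_distrib_left)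
     (auto intro!: sum.cong simp: power_mult_distrib)

lemma integrable_heat_monomial: "integrable lborel (\<lambda>z. std_normal_density z * (x + s * z) ^ n)"
  unfolding heat_monomial_expand
  by (intro Bochner_Integration.integrable_sum integrable_mult_right integrable_std_normal_moment)

lemma heat_monomial_eq:
  "heat_monomial n x s = (\<Sum>k\<le>n. real (n choose k) * x ^ (n - k) * s ^ k * std_normal_moment k)"
  unfolding heat_monomial_def heat_monomial_expand
  by (subst Bochner_Integration.integral_sum)
     (auto intro!: integrable_mult_right integrable_std_normal_moment simp: std_normal_moment_def)

lemma heat_monomial_0: "heat_monomial n x 0 = x ^ n"
  by (subst heat_monomial_eq, subst sum.remove[of _ 0]) (auto simp: power_0_left)

text \<open>The heat equation in the variable s^2/2; the chain rule contributes the factor s. For n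
  < 2 the coefficient vanishes, so the truncated n - 2 does no harm.\<close>

lemma heat_monomial_deriv:
  "(heat_monomial n x has_real_derivative real n * real (n - 1) * s * heat_monomial (n - 2) x s) (at s)"
proof -
  have D: "(heat_monomial n x has_real_derivative
      (\<Sum>k\<le>n. real (n choose k) * x ^ (n - k) * (real k * s ^ (k - 1)) * std_normal_moment k)) (at s)"
    unfolding heat_monomial_eq [abs_def]
    by (auto intro!: derivative_eq_intros sum.cong)
  consider "n = 0" | "n = 1" | m where "n = Suc (Suc m)" by (metis One_nat_def not0_implies_Suc)
  then show ?thesis
  proof cases
    case 3
    have ch: "real (Suc (Suc m) choose Suc (Suc j)) * (real j + 2) * (real j + 1) = (real m + 2) * (real m + 1) * real (m choose j)" for j
    proof -
      have "real (Suc (Suc m) choose Suc (Suc j)) * real (Suc (Suc j)) = real (Suc (Suc m)) * real (Suc m choose Suc j)"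
        using arg_cong[OF Suc_times_binomial_eq[of "Suc m" "Suc j"], of real] by (simp only: of_nat_mult)
      moreover have "real (Suc m choose Suc j) * real (Suc j) = real (Suc m) * real (m choose j)"
        using arg_cong[OF Suc_times_binomial_eq[of m j], of real] by (simp only: of_nat_mult)
      ultimately have "real (Suc (Suc m) choose Suc (Suc j)) * real (Suc (Suc j)) * real (Suc j) =
         real (Suc (Suc m)) * (real (Suc m) * real (m choose j))"
        by (metis mult.assoc)
      moreover have "real (Suc (Suc i)) = real i + 2" "real (Suc i) = real i + 1" for i by auto
      ultimately show ?thesis by (simp only: mult.assoc)
    qed
    \<comment> \<open>The terms k = 0 and k = 1 drop out, the latter because the first moment is 0,
      so the index moves by two.\<close>
    have "(\<Sum>k\<le>n. real (n choose k) * x ^ (n - k) * (real k * s ^ (k - 1)) * std_normal_moment k)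
       = (\<Sum>j\<le>m. real (Suc (Suc m) choose Suc (Suc j)) * x ^ (m - j) * ((real j + 2) * s ^ Suc j) * std_normal_moment (Suc (Suc j)))"
      unfolding 3 by (subst sum.atMost_Suc_shift, subst sum.atMost_Suc_shift) (simp add: add.commute[of 2] del: binomial_Suc_Suc power_Suc)
    also have "\<dots> = (\<Sum>j\<le>m. (real m + 2) * (real m + 1) * s * (real (m choose j) * x ^ (m - j) * s ^ j * std_normal_moment j))"
    proof (rule sum.cong [OF refl])
      fix j
      have "real (Suc (Suc m) choose Suc (Suc j)) * x ^ (m - j) * ((real j + 2) * s ^ Suc j) * std_normal_moment (Suc (Suc j))
        = (real (Suc (Suc m) choose Suc (Suc j)) * (real j + 2) * (real j + 1)) * (s * (x ^ (m - j) * s ^ j * std_normal_moment j))"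
        by (simp only: std_normal_moment_rec power_Suc ac_simps)
      then show "real (Suc (Suc m) choose Suc (Suc j)) * x ^ (m - j) * ((real j + 2) * s ^ Suc j) * std_normal_moment (Suc (Suc j))
        = (real m + 2) * (real m + 1) * s * (real (m choose j) * x ^ (m - j) * s ^ j * std_normal_moment j)"
        unfolding ch by (simp only: ac_simps)
    qed
    also have "\<dots> = real n * real (n - 1) * s * heat_monomial (n - 2) x s"
      by (simp add: 3 heat_monomial_eq sum_distrib_left add.commute[of 2] add.commute[of 1])
    finally show ?thesis using D by simp
  qed (use D in auto)
qed

section \<open>Gaussian vectors and the Laplacian in coordinates\<close>

definition gaussian :: "real^'n \<Rightarrow> real" where
  "gaussian z = (\<Prod>i\<in>UNIV. std_normal_density (z $ i))"

definition monomial :: "('n::finite \<Rightarrow> nat) \<Rightarrow> real^'n \<Rightarrow> real" where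
  "monomial \<alpha> x = (\<Prod>i\<in>UNIV. x $ i ^ \<alpha> i)"

text \<open>Fubini for functions that split over the coordinates. Lebesgue measure on
  \<open>real^'n\<close> is the image of a product measure indexed by basis vectors, so each
  coordinate i has to be matched with \<open>axis i 1\<close>.\<close>

lemma lborel_integral_prod:
  fixes f :: "'n::finite \<Rightarrow> real \<Rightarrow> real"
  assumes f: "\<And>i. integrable lborel (f i)"
  shows "integrable lborel (\<lambda>x::real^'n. \<Prod>i\<in>UNIV. f i (x $ i))"
    and "(LINT x|lborel. (\<Prod>i\<in>UNIV. f i ((x::real^'n) $ i))) = (\<Prod>i\<in>UNIV. (LINT z|lborel. f i z))"
proof -
  interpret product_sigma_finite "\<lambda>_::real^'n. lborel :: real measure" ..
  let ?B = "Basis :: (real^'n) set"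
  have B: "?B = (\<lambda>i. axis i 1) ` UNIV" by (auto simp: Basis_vec_def)
  have inj: "inj (\<lambda>i. axis i (1::real))" by (auto simp: inj_on_def axis_eq_axis)
  have [measurable]: "f i \<in> borel_measurable borel" for i
    using f[of i] borel_measurable_integrable by fastforce
  define g where "g = (\<lambda>b::real^'n. f (axis_index b))"
  have pr: "(\<Prod>i\<in>UNIV. f i ((\<Sum>b\<in>?B. w b *\<^sub>R b) $ i)) = (\<Prod>b\<in>?B. g b (w b))" for w
  proof -
    have "(\<Sum>b\<in>?B. w b *\<^sub>R b) $ i = w (axis i 1)" for i
    proof -
      have "(\<Sum>b\<in>?B. w b *\<^sub>R b) \<bullet> axis i 1 = w (axis i 1)"
        by (rule inner_sum_left_Basis) (auto simp: B)
      then show ?thesis by (simp add: inner_axis)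
    qed
    then show ?thesis unfolding B by (subst prod.reindex[OF inj]) (simp add: g_def axis_index_axis)
  qed
  have gi: "integrable lborel (g b)" for b unfolding g_def by (rule f)
  show "integrable lborel (\<lambda>x::real^'n. \<Prod>i\<in>UNIV. f i (x $ i))"
    unfolding lborel_eq[where 'a = "real^'n"]
    by (subst integrable_distr_eq) (auto simp: pr simp del: sum_component intro!: product_integrable_prod gi)
  have "(LINT x|lborel. (\<Prod>i\<in>UNIV. f i ((x::real^'n) $ i))) = (\<Prod>b\<in>?B. (LINT z|lborel. g b z))"
    unfolding lborel_eq[where 'a = "real^'n"]
    by (subst integral_distr) (auto simp: pr simp del: sum_component intro!: product_integral_prod gi)
  also have "\<dots> = (\<Prod>i\<in>UNIV. (LINT z|lborel. f i z))"
    unfolding B by (subst prod.reindex[OF inj]) (simp add: g_def axis_index_axis)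
  finally show "(LINT x|lborel. (\<Prod>i\<in>UNIV. f i ((x::real^'n) $ i))) = (\<Prod>i\<in>UNIV. (LINT z|lborel. f i z))" .
qed

lemma gaussian_monomial:
  fixes x :: "real^'n"
  shows "integrable lborel (\<lambda>z. gaussian z * monomial \<alpha> (x + s *\<^sub>R z))"
    and "(LINT z|lborel. gaussian z * monomial \<alpha> (x + s *\<^sub>R z)) = (\<Prod>i\<in>UNIV. heat_monomial (\<alpha> i) (x $ i) s)"
proof -
  have eq: "gaussian z * monomial \<alpha> (x + s *\<^sub>R z) = (\<Prod>i\<in>UNIV. std_normal_density (z $ i) * (x $ i + s * z $ i) ^ \<alpha> i)" for z
    by (simp add: gaussian_def monomial_def prod.distrib)
  show "integrable lborel (\<lambda>z. gaussian z * monomial \<alpha> (x + s *\<^sub>R z))"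
    unfolding eq
    by (rule lborel_integral_prod(1)[of "\<lambda>i z. std_normal_density z * (x $ i + s * z) ^ \<alpha> i"]) (rule integrable_heat_monomial)
  show "(LINT z|lborel. gaussian z * monomial \<alpha> (x + s *\<^sub>R z)) = (\<Prod>i\<in>UNIV. heat_monomial (\<alpha> i) (x $ i) s)"
    unfolding eq heat_monomial_def
    by (rule lborel_integral_prod(2)[of "\<lambda>i z. std_normal_density z * (x $ i + s * z) ^ \<alpha> i"]) (rule integrable_heat_monomial)
qed

lemma monomial_remove: "monomial (\<alpha>(i := k)) x = x $ i ^ k * (\<Prod>j\<in>UNIV - {i}. x $ j ^ \<alpha> j)"
  unfolding monomial_def by (subst prod.remove[of _ i]) (auto intro!: arg_cong2[where f = "(*)"] prod.cong)

lemma monomial_has_derivative: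
  "(monomial \<alpha> has_derivative (\<lambda>h. \<Sum>i\<in>UNIV. h $ i * (real (\<alpha> i) * monomial (\<alpha>(i := \<alpha> i - 1)) x))) (at x)"
proof -
  have "((\<lambda>x. x $ i ^ \<alpha> i) has_derivative (\<lambda>h. real (\<alpha> i) * h $ i * x $ i ^ (\<alpha> i - 1))) (at x)" for i
    by (auto intro!: derivative_eq_intros bounded_linear_imp_has_derivative bounded_linear_vec_nth simp: ac_simps)
  from has_derivative_prod[of UNIV "\<lambda>i x. x $ i ^ \<alpha> i", OF this]
  moreover have "(\<lambda>x. \<Prod>i\<in>UNIV. x $ i ^ \<alpha> i) = monomial \<alpha>"
    by (simp add: monomial_def fun_eq_iff)
  ultimately show ?thesis by (simp add: monomial_remove ac_simps)
qed

lemma partial_derivative_sum_monomial: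
  assumes "finite A"
  shows "partial_derivative i (\<lambda>x. \<Sum>a\<in>A. C a * of_real (monomial (E a) x)) =
     (\<lambda>x. \<Sum>a\<in>A. (C a * of_nat (E a i)) * of_real (monomial ((E a)(i := E a i - 1)) x))"
proof
  fix x
  have "((\<lambda>x. \<Sum>a\<in>A. C a * of_real (monomial (E a) x)) has_derivative
     (\<lambda>h. \<Sum>a\<in>A. C a * of_real (\<Sum>i\<in>UNIV. h $ i * (real (E a i) * monomial ((E a)(i := E a i - 1)) x)))) (at x)"
    by (intro has_derivative_sum has_derivative_mult_right has_derivative_of_real monomial_has_derivative)
  from frechet_derivative_at[OF this, symmetric]
  show "partial_derivative i (\<lambda>x. \<Sum>a\<in>A. C a * of_real (monomial (E a) x)) x =
     (\<Sum>a\<in>A. (C a * of_nat (E a i)) * of_real (monomial ((E a)(i := E a i - 1)) x))"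
    unfolding partial_derivative_def
    by (simp add: axis_def if_distrib[of "\<lambda>u. u * _"] if_distrib[of of_real] sum.delta mult.assoc cong: if_cong)
qed

lemma laplacian_sum_monomial:
  assumes "finite A"
  shows "laplacian (\<lambda>x. \<Sum>a\<in>A. C a * of_real (monomial (E a) x)) x =
     (\<Sum>a\<in>A. C a * of_real (\<Sum>i\<in>UNIV. real (E a i) * real (E a i - 1) * monomial ((E a)(i := E a i - 2)) x))"
proof -
  have "laplacian (\<lambda>x. \<Sum>a\<in>A. C a * of_real (monomial (E a) x)) x =
    (\<Sum>i\<in>UNIV. \<Sum>a\<in>A. C a * of_real (real (E a i) * real (E a i - 1) * monomial ((E a)(i := E a i - 2)) x))"
    unfolding laplacian_def partial_derivative_sum_monomial[OF assms]
    by (intro sum.cong refl) (simp add: numeral_2_eq_2)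
  then show ?thesis by (subst (asm) sum.swap) (simp add: sum_distrib_left)
qed

lemma finite_multi_indices: "finite {\<alpha> :: 'n::finite \<Rightarrow> nat. (\<Sum>i\<in>UNIV. \<alpha> i) = l}"
proof (rule finite_subset)
  show "{\<alpha> :: 'n \<Rightarrow> nat. (\<Sum>i\<in>UNIV. \<alpha> i) = l} \<subseteq> PiE UNIV (\<lambda>_. {..l})"
    by (auto simp: member_le_sum)
qed (auto intro: finite_PiE)

lemma homogeneous_polynomial_iff:
  "homogeneous_polynomial l p \<longleftrightarrow> (\<exists>c. p = (\<lambda>x. \<Sum>\<alpha> | (\<Sum>i\<in>UNIV. \<alpha> i) = l. c \<alpha> * of_real (monomial \<alpha> x)))"
  unfolding homogeneous_polynomial_def monomial_def fun_eq_iff ..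

text \<open>For phi s = E p(x + s G) the heat equation in each coordinate gives phi' s = s E
  (laplacian p)(x + s G) = 0, hence phi 1 = phi 0 = p x. The derivative is taken on the explicit
  polynomials \<open>heat_monomial\<close> in s, never under the integral.\<close>

lemma harmonic_gaussian_mean:
  fixes p :: "real^'n \<Rightarrow> complex"
  assumes p: "p \<in> harmonic_polynomials l"
  shows "integrable lborel (\<lambda>z. of_real (gaussian z) * p (x + z))"
    and "(LINT z|lborel. of_real (gaussian z) * p (x + z)) = p x"
proof -
  define A where "A = {\<alpha> :: 'n \<Rightarrow> nat. (\<Sum>i\<in>UNIV. \<alpha> i) = l}"
  have A: "finite A" unfolding A_def by (rule finite_multi_indices)
  obtain c where c: "p = (\<lambda>x. \<Sum>\<alpha>\<in>A. c \<alpha> * of_real (monomial \<alpha> x))"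
    using p unfolding harmonic_polynomials_def homogeneous_polynomial_iff A_def by auto
  define hp where "hp = (\<lambda>\<alpha> s. \<Prod>i\<in>UNIV. heat_monomial (\<alpha> i) (x $ i) s)"
  define lap where "lap = (\<lambda>\<alpha> s. \<Sum>i\<in>UNIV. real (\<alpha> i) * real (\<alpha> i - 1) * hp (\<alpha>(i := \<alpha> i - 2)) s)"
  have hb: "has_bochner_integral lborel (\<lambda>z. of_real (gaussian z * monomial \<alpha> (x + s *\<^sub>R z)) :: complex) (of_real (hp \<alpha> s))" for \<alpha> s
    unfolding hp_def using gaussian_monomial[of \<alpha> x s]
    by (intro has_bochner_integral_of_real) (simp add: has_bochner_integral_iff)
  have phi: "has_bochner_integral lborel (\<lambda>z. of_real (gaussian z) * p (x + s *\<^sub>R z)) (\<Sum>\<alpha>\<in>A. c \<alpha> * of_real (hp \<alpha> s))" for s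
  proof -
    have "has_bochner_integral lborel (\<lambda>z. \<Sum>\<alpha>\<in>A. c \<alpha> * of_real (gaussian z * monomial \<alpha> (x + s *\<^sub>R z))) (\<Sum>\<alpha>\<in>A. c \<alpha> * of_real (hp \<alpha> s))"
      by (intro has_bochner_integral_sum has_bochner_integral_mult_right hb)
    then show ?thesis by (simp add: c sum_distrib_left ac_simps)
  qed
  have hp_deriv: "(hp \<alpha> has_real_derivative s * lap \<alpha> s) (at s)" for \<alpha> s
  proof -
    have "(hp \<alpha> has_derivative (\<lambda>h. \<Sum>i\<in>UNIV. (h * (real (\<alpha> i) * real (\<alpha> i - 1) * s * heat_monomial (\<alpha> i - 2) (x $ i) s)) *
        (\<Prod>j\<in>UNIV - {i}. heat_monomial (\<alpha> j) (x $ j) s))) (at s)"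
      unfolding hp_def
      by (rule has_derivative_prod)
         (use heat_monomial_deriv in \<open>simp add: has_field_derivative_def mult_commute_abs\<close>)
    moreover have "hp (\<alpha>(i := k)) s = heat_monomial k (x $ i) s * (\<Prod>j\<in>UNIV - {i}. heat_monomial (\<alpha> j) (x $ j) s)" for i k
      unfolding hp_def by (subst prod.remove[of _ i]) (auto intro!: arg_cong2[where f = "(*)"] prod.cong)
    ultimately have "(hp \<alpha> has_derivative (\<lambda>h. \<Sum>i\<in>UNIV. h * (real (\<alpha> i) * real (\<alpha> i - 1) * s * hp (\<alpha>(i := \<alpha> i - 2)) s))) (at s)"
      by (simp add: ac_simps)
    moreover have "(\<Sum>i\<in>UNIV. h * (real (\<alpha> i) * real (\<alpha> i - 1) * s * hp (\<alpha>(i := \<alpha> i - 2)) s)) = s * lap \<alpha> s * h" for h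
      by (simp add: lap_def sum_distrib_left sum_distrib_right ac_simps)
    ultimately show ?thesis
      by (simp add: has_field_derivative_def)
  qed
  \<comment> \<open>This sum is the Gaussian mean of the Laplacian of p at x + s z, computed
    monomial by monomial.\<close>
  have lap0: "(\<Sum>\<alpha>\<in>A. c \<alpha> * of_real (lap \<alpha> s)) = 0" for s
  proof -
    have "has_bochner_integral lborel
       (\<lambda>z. \<Sum>\<alpha>\<in>A. c \<alpha> * (\<Sum>i\<in>UNIV. of_real (real (\<alpha> i) * real (\<alpha> i - 1)) * of_real (gaussian z * monomial (\<alpha>(i := \<alpha> i - 2)) (x + s *\<^sub>R z))))
       (\<Sum>\<alpha>\<in>A. c \<alpha> * (\<Sum>i\<in>UNIV. of_real (real (\<alpha> i) * real (\<alpha> i - 1)) * of_real (hp (\<alpha>(i := \<alpha> i - 2)) s)))"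
      by (intro has_bochner_integral_sum has_bochner_integral_mult_right hb)
    moreover have "(\<Sum>\<alpha>\<in>A. c \<alpha> * (\<Sum>i\<in>UNIV. of_real (real (\<alpha> i) * real (\<alpha> i - 1)) * of_real (gaussian z * monomial (\<alpha>(i := \<alpha> i - 2)) (x + s *\<^sub>R z)))) = 0" for z
    proof -
      have "laplacian p (x + s *\<^sub>R z) = 0" using p by (simp add: harmonic_polynomials_def)
      then have "of_real (gaussian z) * laplacian p (x + s *\<^sub>R z) = 0" by simp
      then show ?thesis
        unfolding c laplacian_sum_monomial[OF A]
        by (simp add: sum_distrib_left ac_simps)
    qed
    ultimately have "has_bochner_integral lborel (\<lambda>z::real^'n. 0)
       (\<Sum>\<alpha>\<in>A. c \<alpha> * (\<Sum>i\<in>UNIV. of_real (real (\<alpha> i) * real (\<alpha> i - 1)) * of_real (hp (\<alpha>(i := \<alpha> i - 2)) s)))"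
      by simp
    from has_bochner_integral_integral_eq[OF this] show ?thesis by (simp add: lap_def)
  qed
  have const: "(\<Sum>\<alpha>\<in>A. c \<alpha> * of_real (hp \<alpha> s)) = (\<Sum>\<alpha>\<in>A. c \<alpha> * of_real (hp \<alpha> 0))" for s
  proof (rule has_derivative_zero_unique[of UNIV "\<lambda>s. \<Sum>\<alpha>\<in>A. c \<alpha> * of_real (hp \<alpha> s)"])
    fix s :: real
    have "((\<lambda>s. \<Sum>\<alpha>\<in>A. c \<alpha> * of_real (hp \<alpha> s)) has_derivative (\<lambda>h. \<Sum>\<alpha>\<in>A. c \<alpha> * of_real (s * lap \<alpha> s * h))) (at s)"
      using hp_deriv unfolding has_field_derivative_def
      by (intro has_derivative_sum has_derivative_mult_right has_derivative_of_real) auto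
    moreover have "(\<Sum>\<alpha>\<in>A. c \<alpha> * of_real (s * lap \<alpha> s * h)) = of_real (s * h) * (\<Sum>\<alpha>\<in>A. c \<alpha> * of_real (lap \<alpha> s))" for h
      by (simp add: sum_distrib_left ac_simps)
    ultimately show "((\<lambda>s. \<Sum>\<alpha>\<in>A. c \<alpha> * of_real (hp \<alpha> s)) has_derivative (\<lambda>h. 0)) (at s within UNIV)"
      by (simp only: lap0 mult_zero_right)
  qed auto
  have "(\<Sum>\<alpha>\<in>A. c \<alpha> * of_real (hp \<alpha> 0)) = p x"
    by (simp add: c hp_def heat_monomial_0 monomial_def)
  then have "has_bochner_integral lborel (\<lambda>z. of_real (gaussian z) * p (x + z)) (p x)"
    using phi[of 1] const[of 1] by simp
  then show "integrable lborel (\<lambda>z. of_real (gaussian z) * p (x + z))"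
    "(LINT z|lborel. of_real (gaussian z) * p (x + z)) = p x"
    by (simp_all add: has_bochner_integral_iff)
qed

section \<open>Spherical moments of harmonic polynomials\<close>

text \<open>Termwise integration by dominated convergence: the partial sums are dominated by the sum
  of the norms. The exchanges of series and integral below rest on this form.\<close>

lemma dominated_sums:
  fixes f :: "nat \<Rightarrow> 'a \<Rightarrow> 'b::{banach, second_countable_topology}"
  assumes f [measurable]: "\<And>i. f i \<in> borel_measurable M"
    and h: "integrable M h"
    and s: "AE x in M. summable (\<lambda>i. norm (f i x)) \<and> (\<Sum>i. norm (f i x)) \<le> h x"
  shows "\<And>i. integrable M (f i)"
    and "integrable M (\<lambda>x. \<Sum>i. f i x)"
    and "(\<lambda>i. integral\<^sup>L M (f i)) sums (LINT x|M. (\<Sum>i. f i x))"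
proof -
  have [measurable]: "h \<in> borel_measurable M" using h by (rule borel_measurable_integrable)
  have part: "AE x in M. norm (\<Sum>i<n. f i x) \<le> h x" for n
    using s
  proof eventually_elim
    case (elim x)
    have "norm (\<Sum>i<n. f i x) \<le> (\<Sum>i<n. norm (f i x))" by (rule norm_sum)
    also have "\<dots> \<le> (\<Sum>i. norm (f i x))" using elim by (intro sum_le_suminf) auto
    finally show ?case using elim by simp
  qed
  show int: "integrable M (f i)" for i
  proof (rule Bochner_Integration.integrable_bound[OF h f])
    show "AE x in M. norm (f i x) \<le> norm (h x)"
      using s
    proof eventually_elim
      case (elim x)
      have "norm (f i x) = (\<Sum>j\<in>{i}. norm (f j x))" by simp
      also have "\<dots> \<le> (\<Sum>i. norm (f i x))" using elim by (intro sum_le_suminf) auto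
      also have "\<dots> \<le> norm (h x)" using elim by auto
      finally show ?case .
    qed
  qed
  have lim: "AE x in M. (\<lambda>n. \<Sum>i<n. f i x) \<longlonglongrightarrow> (\<Sum>i. f i x)"
    using s by eventually_elim (auto intro: summable_LIMSEQ summable_norm_cancel)
  have m1: "(\<lambda>x. \<Sum>i. f i x) \<in> borel_measurable M" by measurable
  have m2: "(\<lambda>x. \<Sum>i<n. f i x) \<in> borel_measurable M" for n by measurable
  show "integrable M (\<lambda>x. \<Sum>i. f i x)"
    by (rule integrable_dominated_convergence[OF m1 m2 h lim part])
  have "(\<lambda>n. LINT x|M. (\<Sum>i<n. f i x)) \<longlonglongrightarrow> (LINT x|M. (\<Sum>i. f i x))"
    by (rule integral_dominated_convergence[OF m1 m2 h lim part])
  then show "(\<lambda>i. integral\<^sup>L M (f i)) sums (LINT x|M. (\<Sum>i. f i x))"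
    by (simp add: sums_def int)
qed

text \<open>Once the lower coefficients vanish, u^n is divided out and u tends to 0 along 1 / (k +
  1). Real values of u are enough for this limit.\<close>

lemma powser_unique_zero:
  fixes c :: "nat \<Rightarrow> complex"
  assumes z: "\<And>u::real. (\<lambda>j. c j * of_real u ^ j) sums 0"
  shows "c n = 0"
proof (induction n rule: less_induct)
  case (less n)
  define g where "g = (\<lambda>w. \<Sum>j. c (j + n) * w ^ j)"
  have shift: "(\<lambda>j. c (j + n) * of_real u ^ j) sums 0" if "u \<noteq> 0" for u :: real
  proof -
    have "(\<lambda>j. c (j + n) * of_real u ^ (j + n)) sums (0 - (\<Sum>j<n. c j * of_real u ^ j))"
      using sums_split_initial_segment[OF z[of u], of n] by simp
    then have "(\<lambda>j. c (j + n) * of_real u ^ (j + n)) sums 0" using less by simp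
    then have "(\<lambda>j. (c (j + n) * of_real u ^ (j + n)) / of_real u ^ n) sums (0 / of_real u ^ n)"
      by (rule sums_divide)
    then show ?thesis using that by (simp add: power_add)
  qed
  have "summable (\<lambda>j. c (j + n) * (1::complex) ^ j)"
    using shift[of 1] by (simp add: sums_iff)
  then have "isCont g 0" unfolding g_def by (rule isCont_powser) simp
  then have "(\<lambda>k. g (of_real (inverse (real (Suc k))))) \<longlonglongrightarrow> g 0"
    by (rule isCont_tendsto_compose)
       (use tendsto_of_real[OF LIMSEQ_inverse_real_of_nat, where 'a = complex] in simp)
  moreover have "g (of_real (inverse (real (Suc k)))) = 0" for k
    using shift[of "inverse (real (Suc k))"] by (simp add: g_def sums_iff)
  ultimately have "g 0 = 0" by (simp add: LIMSEQ_const_iff)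
  then show ?case by (simp add: g_def powser_zero)
qed

lemma has_bochner_integral_Gamma:
  fixes \<mu> t :: real
  assumes mu: "\<mu> > 0" and t: "t > 0"
  shows "has_bochner_integral lborel (\<lambda>v. indicator {0<..} v * (v powr (\<mu> - 1) * exp (- (t * v)))) (Gamma \<mu> / t powr \<mu>)"
proof -
  define f where "f = (\<lambda>v::real. indicator {0<..} v * (v powr (\<mu> - 1) * exp (- v)))"
  have "has_bochner_integral lborel f (Gamma \<mu>)"
  proof (rule has_bochner_integral_nn_integral)
    have "integral\<^sup>N lborel f = (\<integral>\<^sup>+v. ennreal (indicator {0..} v * v powr (\<mu> - 1) / exp v) \<partial>lborel)"
      by (intro nn_integral_cong) (auto simp: f_def indicator_def exp_minus field_simps)
    then show "integral\<^sup>N lborel f = ennreal (Gamma \<mu>)"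
      using Gamma_conv_nn_integral_real[OF mu] by simp
  qed (use mu in \<open>auto simp: f_def less_imp_le\<close>)
  then have "has_bochner_integral lborel (\<lambda>v. f (0 + t * v)) (Gamma \<mu> /\<^sub>R \<bar>t\<bar>)"
    using t by (subst (asm) lborel_has_bochner_integral_real_affine_iff[of t _ _ 0]) auto
  then have "has_bochner_integral lborel (\<lambda>v. f (t * v) / t powr (\<mu> - 1)) ((Gamma \<mu> /\<^sub>R \<bar>t\<bar>) / t powr (\<mu> - 1))"
    by (intro has_bochner_integral_divide) simp_all
  moreover have "f (t * v) / t powr (\<mu> - 1) = indicator {0<..} v * (v powr (\<mu> - 1) * exp (- (t * v)))" for v
    using t by (auto simp: f_def indicator_def powr_mult zero_less_mult_iff)
  moreover have "(Gamma \<mu> /\<^sub>R \<bar>t\<bar>) / t powr (\<mu> - 1) = Gamma \<mu> / t powr \<mu>"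
    using t by (simp add: powr_diff field_simps)
  ultimately show ?thesis by simp
qed

lemma gaussian_eq: "gaussian (z::real^'n) = (1 / sqrt (2 * pi)) ^ CARD('n) * exp (- ((norm z)\<^sup>2 / 2))"
proof -
  have "gaussian z = (\<Prod>i\<in>UNIV. (1 / sqrt (2 * pi)) * exp (- ((z $ i)\<^sup>2 / 2)))"
    by (simp add: gaussian_def std_normal_density_def)
  also have "\<dots> = (1 / sqrt (2 * pi)) ^ CARD('n) * exp (\<Sum>i\<in>UNIV. - ((z $ i)\<^sup>2 / 2))"
    by (simp only: prod.distrib prod_constant exp_sum[OF finite])
  also have "(\<Sum>i\<in>UNIV. - ((z $ i)\<^sup>2 / 2)) = - ((norm z)\<^sup>2 / 2)"
    by (simp add: sum_negf norm_vec_def L2_set_def sum_nonneg flip: sum_divide_distrib)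
  finally show ?thesis .
qed

lemma gaussian_pos: "gaussian z > 0"
  by (simp add: gaussian_eq)

lemma gaussian_measurable [measurable]: "gaussian \<in> borel_measurable borel"
  unfolding gaussian_eq[abs_def] by measurable

lemma homogeneous_polynomial_scale:
  assumes "homogeneous_polynomial l p"
  shows "p (c *\<^sub>R x) = of_real c ^ l * p x"
proof -
  obtain d where d: "p = (\<lambda>x. \<Sum>\<alpha> | (\<Sum>i\<in>UNIV. \<alpha> i) = l. d \<alpha> * of_real (monomial \<alpha> x))"
    using assms unfolding homogeneous_polynomial_iff by auto
  show ?thesis unfolding d sum_distrib_left
  proof (rule sum.cong[OF refl])
    fix \<alpha> :: "'a \<Rightarrow> nat" assume "\<alpha> \<in> {\<alpha>. (\<Sum>i\<in>UNIV. \<alpha> i) = l}"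
    then have "monomial \<alpha> (c *\<^sub>R x) = c ^ l * monomial \<alpha> x"
      by (simp add: monomial_def power_mult_distrib prod.distrib flip: power_sum)
    then show "d \<alpha> * of_real (monomial \<alpha> (c *\<^sub>R x)) = of_real c ^ l * (d \<alpha> * of_real (monomial \<alpha> x))"
      by simp
  qed
qed

lemma homogeneous_polynomial_continuous:
  assumes "homogeneous_polynomial l p"
  shows "continuous_on A p"
proof -
  obtain d where d: "p = (\<lambda>x. \<Sum>\<alpha> | (\<Sum>i\<in>UNIV. \<alpha> i) = l. d \<alpha> * of_real (monomial \<alpha> x))"
    using assms unfolding homogeneous_polynomial_iff by auto
  show ?thesis unfolding d monomial_def by (intro continuous_intros)
qed

lemma homogeneous_bound:
  fixes q :: "real^'n \<Rightarrow> complex"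
  assumes c: "continuous_on UNIV q" and h: "\<And>c x. q (c *\<^sub>R x) = of_real c ^ n * q x"
  obtains C where "C \<ge> 0" "\<And>x. norm (q x) \<le> C * norm x ^ n"
proof -
  have "compact (q ` cball 0 1)"
    by (intro compact_continuous_image continuous_on_subset[OF c]) auto
  then obtain C where C: "\<And>y. y \<in> q ` cball 0 1 \<Longrightarrow> norm y \<le> C"
    by (meson compact_imp_bounded bounded_iff)
  have "norm (q x) \<le> C * norm x ^ n" for x
  proof -
    have "q x = of_real (norm x) ^ n * q (sgn x)"
      using h[of "norm x" "sgn x"] by (cases "x = 0") (simp_all add: sgn_div_norm)
    then have "norm (q x) = norm (q (sgn x)) * norm x ^ n" by (simp add: norm_mult norm_power)
    also have "\<dots> \<le> C * norm x ^ n"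
      by (intro mult_right_mono C) (auto simp: norm_sgn)
    finally show ?thesis .
  qed
  moreover have "C \<ge> 0" using C[of "q 0"] order_trans[OF norm_ge_zero] by auto
  ultimately show ?thesis using that by blast
qed

text \<open>Polar coordinates with a = 2: the weight |z|^(a - 2) is 1 and the Gaussian density is a
  constant times exp (- v), so the radial integral is a Gamma value. The power of 2 depending on n
  comes from |z| = sqrt (2 v).\<close>

lemma gaussian_homogeneous_integral:
  fixes q :: "real^'n \<Rightarrow> complex"
  assumes c: "continuous_on UNIV q" and h: "\<And>c x. q (c *\<^sub>R x) = of_real c ^ n * q x"
  shows "(LINT z|lborel. of_real (gaussian z) * q z) =
    of_real ((1 / sqrt (2 * pi)) ^ CARD('n) * (real CARD('n) * 2 powr (real CARD('n) / 2 - 1)) * 2 powr (real n / 2) * Gamma ((real CARD('n) + real n) / 2)) *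
      (LINT \<eta>|sphere_measure. q \<eta>)"
proof -
  define G where "G = (1 / sqrt (2 * pi)) ^ CARD('n)"
  have G: "G > 0" by (simp add: G_def)
  define d where "d = (real DIM(real^'n) - 2) / 2"
  define I where "I = (LINT \<eta>|sphere_measure. q \<eta>)"
  let ?Q = "\<lambda>v. LINT \<eta>|sphere_measure. of_real (gaussian ((2 * v) powr (1 / 2) *\<^sub>R \<eta>)) * q ((2 * v) powr (1 / 2) *\<^sub>R \<eta>)"
  obtain C where C: "C \<ge> 0" "\<And>x. norm (q x) \<le> C * norm x ^ n" using homogeneous_bound[OF c h] by blast
  have [measurable]: "q \<in> borel_measurable borel" using c by (rule borel_measurable_continuous_onI)
  define g where "g = (\<lambda>v::real. G * C * 2 powr (real n / 2) * (v powr (real n / 2) * exp (- (1 * v))))"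
  have pw: "norm x ^ n = 2 powr (real n / 2) * (norm x powr 2 / 2) powr (real n / 2)" if "x \<noteq> 0" for x :: "real^'n"
    using that by (simp add: powr_divide powr_powr powr_realpow del: powr_numeral)
  have mu: "(real CARD('n) + real n) / 2 > 0" by (simp add: add_pos_nonneg)
  have dn: "(real CARD('n) + real n) / 2 - 1 = d + real n / 2" by (simp add: d_def field_simps)
  have Gi: "has_bochner_integral lborel (\<lambda>v. indicator {0<..} v * (v powr (d + real n / 2) * exp (- (1 * v)))) (Gamma ((real CARD('n) + real n) / 2))"
    using has_bochner_integral_Gamma[OF mu, of 1] by (simp add: dn)
  have eqg: "(LINT x|lborel. of_real (gaussian x) * q x / of_real (norm x powr (2 - 2))) =
      of_real (real DIM(real^'n) * 2 powr d) *
        (LINT v|lborel. indicator {0<..} v *\<^sub>R (v powr d *\<^sub>R ?Q v))"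
    unfolding d_def
  proof (rule polar_integral(2)[where g = g])
    fix x :: "real^'n"
    assume x: "x \<noteq> 0"
    have "norm (of_real (gaussian x) * q x) \<le> gaussian x * (C * norm x ^ n)"
      using C(2)[of x] gaussian_pos[of x] by (simp add: norm_mult)
    also have "\<dots> = g (norm x powr 2 / 2)" using x
      by (simp add: g_def gaussian_eq G_def pw)
    finally show "norm (of_real (gaussian x) * q x) \<le> g (norm x powr 2 / 2)" .
  next
    show "integrable lborel (\<lambda>v. indicator {0<..} v * (v powr ((real DIM(real^'n) - 2) / 2) * g v))"
    proof -
      have "integrable lborel (\<lambda>v. (G * C * 2 powr (real n / 2)) * (indicator {0<..} v * (v powr (d + real n / 2) * exp (- (1 * v)))))"
        using Gi by (intro integrable_mult_right) (simp add: has_bochner_integral_iff)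
      then show ?thesis unfolding d_def[symmetric] g_def
        by (simp add: powr_add ac_simps)
    qed
  qed auto
  have inner: "?Q v =
      of_real (G * 2 powr (real n / 2) * (v powr (real n / 2) * exp (- (1 * v)))) * I" if v: "v > 0" for v
  proof -
    have "?Q v =
      (LINT \<eta>|sphere_measure. of_real (G * 2 powr (real n / 2) * (v powr (real n / 2) * exp (- (1 * v)))) * q \<eta>)"
    proof (rule integral_cong_AE)
      show "AE \<eta> in sphere_measure. of_real (gaussian ((2 * v) powr (1 / 2) *\<^sub>R \<eta>)) * q ((2 * v) powr (1 / 2) *\<^sub>R \<eta>) =
         of_real (G * 2 powr (real n / 2) * (v powr (real n / 2) * exp (- (1 * v)))) * q \<eta>"
        using AE_sphere_measure
      proof eventually_elim
        case (elim \<eta>)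
        have "gaussian ((2 * v) powr (1 / 2) *\<^sub>R \<eta>) = G * exp (- v)"
          using v elim by (simp add: gaussian_eq G_def power_mult_distrib powr_powr flip: powr_numeral)
        moreover have "((2 * v) powr (1 / 2)) ^ n = 2 powr (real n / 2) * v powr (real n / 2)"
          using v by (simp add: powr_powr powr_mult flip: powr_realpow)
        ultimately show ?case by (simp add: h flip: of_real_power)
      qed
    qed auto
    then show ?thesis by (simp add: I_def)
  qed
  \<comment> \<open>The two integrands may differ at the origin, where
    \<open>0 powr 0 = 0\<close>.\<close>
  have eq1: "(LINT z|lborel. of_real (gaussian z) * q z) = (LINT x|lborel. of_real (gaussian x) * q x / of_real (norm x powr (2 - 2)))"
  proof (rule integral_cong_AE)
    show "AE x in lborel. of_real (gaussian x) * q x = of_real (gaussian x) * q x / of_real (norm x powr (2 - 2))"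
      by (rule eventually_mono[OF AE_lborel_singleton[of 0]]) simp
  qed auto
  have "(LINT v|lborel. indicator {0<..} v *\<^sub>R (v powr d *\<^sub>R ?Q v))
     = (LINT v|lborel. of_real (indicator {0<..} v * (v powr (d + real n / 2) * exp (- (1 * v)))) * (of_real (G * 2 powr (real n / 2)) * I))"
    by (rule Bochner_Integration.integral_cong)
       (auto simp: indicator_def inner powr_add scaleR_conv_of_real[where 'a = complex])
  also have "\<dots> = of_real (Gamma ((real CARD('n) + real n) / 2)) * (of_real (G * 2 powr (real n / 2)) * I)"
    using Gi by (simp only: integral_mult_left_zero integral_of_real has_bochner_integral_iff)
  finally have eq2: "(LINT v|lborel. indicator {0<..} v *\<^sub>R (v powr d *\<^sub>R ?Q v))
     = of_real (Gamma ((real CARD('n) + real n) / 2)) * (of_real (G * 2 powr (real n / 2)) * I)" .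
  have "real CARD('n) / 2 - 1 = d" "DIM(real^'n) = CARD('n)" by (simp_all add: d_def field_simps)
  then show ?thesis
    unfolding eq1 eqg eq2 I_def [symmetric] G_def [symmetric] by (simp add: mult_ac)
qed

lemma gaussian_exp_harmonic:
  fixes p :: "real^'n \<Rightarrow> complex"
  assumes p: "p \<in> harmonic_polynomials l"
  shows "has_bochner_integral lborel (\<lambda>z. of_real (gaussian z * exp (u * (x \<bullet> z))) * p z)
    (of_real (exp (u\<^sup>2 * (norm x)\<^sup>2 / 2)) * (of_real u ^ l * p x))"
proof -
  have hp: "homogeneous_polynomial l p" using p by (simp add: harmonic_polynomials_def)
  have [measurable]: "p \<in> borel_measurable borel"
    by (rule borel_measurable_continuous_onI[OF homogeneous_polynomial_continuous[OF hp]])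
  define E where "E = exp (u\<^sup>2 * (norm x)\<^sup>2 / 2)"
  \<comment> \<open>Completing the square: u <x,z> - |z|^2/2 = u^2 |x|^2/2 - |z - u x|^2/2.\<close>
  have shift: "gaussian (u *\<^sub>R x + z) * exp (u * (x \<bullet> (u *\<^sub>R x + z))) = E * gaussian z" for z
  proof -
    have "- ((norm (u *\<^sub>R x + z))\<^sup>2 / 2) + u * (x \<bullet> (u *\<^sub>R x + z)) = u\<^sup>2 * (norm x)\<^sup>2 / 2 + - ((norm z)\<^sup>2 / 2)"
      unfolding power2_norm_eq_inner
      by (simp add: inner_add_left inner_add_right inner_commute power2_eq_square field_simps)
    then have "exp (- ((norm (u *\<^sub>R x + z))\<^sup>2 / 2)) * exp (u * (x \<bullet> (u *\<^sub>R x + z))) = E * exp (- ((norm z)\<^sup>2 / 2))"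
      unfolding E_def exp_add [symmetric] by simp
    then show ?thesis by (simp add: gaussian_eq)
  qed
  have "has_bochner_integral lborel (\<lambda>z. of_real (gaussian z) * p (u *\<^sub>R x + z)) (p (u *\<^sub>R x))"
    using harmonic_gaussian_mean[OF p, of "u *\<^sub>R x"] by (simp add: has_bochner_integral_iff)
  then have "has_bochner_integral lborel (\<lambda>z. of_real E * (of_real (gaussian z) * p (u *\<^sub>R x + z))) (of_real E * p (u *\<^sub>R x))"
    by (rule has_bochner_integral_mult_right)
  then have "has_bochner_integral lborel (\<lambda>z. of_real (gaussian (u *\<^sub>R x + z) * exp (u * (x \<bullet> (u *\<^sub>R x + z)))) * p (u *\<^sub>R x + z)) (of_real E * p (u *\<^sub>R x))"
    unfolding shift by (simp add: mult.assoc)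
  then have "has_bochner_integral (distr lborel borel ((+) (u *\<^sub>R x))) (\<lambda>z. of_real (gaussian z * exp (u * (x \<bullet> z))) * p z) (of_real E * p (u *\<^sub>R x))"
    by (intro has_bochner_integral_distr) auto
  then show ?thesis
    by (simp add: lborel_distr_plus E_def homogeneous_polynomial_scale[OF hp])
qed

lemma gaussian_harmonic_moment_series:
  fixes p :: "real^'n \<Rightarrow> complex"
  assumes p: "p \<in> harmonic_polynomials l"
  shows "(\<lambda>j. (LINT z|lborel. of_real (gaussian z) * (of_real ((x \<bullet> z) ^ j) * p z)) / fact j * of_real u ^ j) sums
    (of_real (exp (u\<^sup>2 * (norm x)\<^sup>2 / 2)) * (of_real u ^ l * p x))"
proof -
  have hp: "homogeneous_polynomial l p" using p by (simp add: harmonic_polynomials_def)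
  have [measurable]: "p \<in> borel_measurable borel"
    by (rule borel_measurable_continuous_onI[OF homogeneous_polynomial_continuous[OF hp]])
  define f where "f = (\<lambda>j z. of_real (gaussian z) * p z * of_real ((u * (x \<bullet> z)) ^ j /\<^sub>R fact j))"
  \<comment> \<open>Since exp |w| <= exp w + exp (- w), the series of norms is dominated by the
    integrands of \<open>gaussian_exp_harmonic\<close> for u and - u.\<close>
  define h where "h = (\<lambda>z. norm (of_real (gaussian z * exp (u * (x \<bullet> z))) * p z) + norm (of_real (gaussian z * exp (- u * (x \<bullet> z))) * p z))"
  have h: "integrable lborel h"
    unfolding h_def using gaussian_exp_harmonic[OF p, of _ x]
    by (intro Bochner_Integration.integrable_add integrable_norm) (auto simp only: has_bochner_integral_iff)
  have nf: "norm (f j z) = norm (of_real (gaussian z) * p z) * (\<bar>u * (x \<bullet> z)\<bar> ^ j /\<^sub>R fact j)" for j z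
    by (simp add: f_def norm_mult norm_power abs_mult power_abs norm_inverse)
  have fs: "f j z = (of_real (gaussian z) * (of_real ((x \<bullet> z) ^ j) * p z)) / fact j * of_real u ^ j" for j z
    by (simp add: f_def power_mult_distrib field_simps)
  have "(\<lambda>j. integral\<^sup>L lborel (f j)) sums (LINT z|lborel. (\<Sum>j. f j z))"
  proof (rule dominated_sums(3)[OF _ h])
    show "f j \<in> borel_measurable lborel" for j unfolding f_def by measurable
    show "AE z in lborel. summable (\<lambda>j. norm (f j z)) \<and> (\<Sum>j. norm (f j z)) \<le> h z"
    proof (rule AE_I2)
      fix z :: "real^'n"
      have s: "(\<lambda>j. norm (f j z)) sums (norm (of_real (gaussian z) * p z) * exp \<bar>u * (x \<bullet> z)\<bar>)"
        unfolding nf by (intro sums_mult exp_converges)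
      have "exp \<bar>w\<bar> \<le> exp w + exp (- w)" for w :: real by (cases "w \<ge> 0") (auto simp: abs_if)
      then have "norm (of_real (gaussian z) * p z) * exp \<bar>u * (x \<bullet> z)\<bar> \<le> norm (of_real (gaussian z) * p z) * (exp (u * (x \<bullet> z)) + exp (- (u * (x \<bullet> z))))"
        by (intro mult_left_mono) auto
      also have "\<dots> = h z" by (simp add: h_def norm_mult algebra_simps)
      finally show "summable (\<lambda>j. norm (f j z)) \<and> (\<Sum>j. norm (f j z)) \<le> h z"
        using s by (simp add: sums_iff)
    qed
  qed
  moreover have "(\<Sum>j. f j z) = of_real (gaussian z * exp (u * (x \<bullet> z))) * p z" for z
  proof -
    have "(\<lambda>j. f j z) sums (of_real (gaussian z) * p z * of_real (exp (u * (x \<bullet> z))))"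
      unfolding f_def by (intro sums_mult sums_of_real exp_converges)
    then show ?thesis by (simp add: sums_iff mult_ac)
  qed
  moreover have "integral\<^sup>L lborel (f j) = (LINT z|lborel. of_real (gaussian z) * (of_real ((x \<bullet> z) ^ j) * p z)) / fact j * of_real u ^ j" for j
    unfolding fs by (simp only: integral_mult_left_zero integral_divide_zero)
  ultimately show ?thesis
    using gaussian_exp_harmonic[OF p, of u x] by (simp only: has_bochner_integral_integral_eq)
qed

lemma gaussian_total: "(LINT z|lborel. gaussian (z::real^'n)) = 1"
proof -
  have "(LINT z::real^'n|lborel. gaussian z * monomial (\<lambda>_. 0) (0 + 1 *\<^sub>R z)) = 1"
    unfolding gaussian_monomial(2) by (simp add: heat_monomial_eq)
  then show ?thesis by (simp add: monomial_def)
qed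

text \<open>Comparison of coefficients of u^j. The function exp (u^2 |x|^2/2) u^l has only the
  powers u^(l + 2i), which explains the vanishing for j < l and for the wrong parity.\<close>

lemma gaussian_harmonic_moment:
  fixes p :: "real^'n \<Rightarrow> complex"
  assumes p: "p \<in> harmonic_polynomials l"
  shows "(LINT z|lborel. of_real (gaussian z) * (of_real ((x \<bullet> z) ^ j) * p z)) =
     (if l \<le> j \<and> even (j - l) then of_real (fact j * ((norm x)\<^sup>2 / 2) ^ ((j - l) div 2) / fact ((j - l) div 2)) * p x else 0)"
proof -
  define I where "I = (\<lambda>j. LINT z|lborel. of_real (gaussian z) * (of_real ((x \<bullet> z) ^ j) * p z))"
  define b where "b = (\<lambda>j. if l \<le> j \<and> even (j - l) then of_real (((norm x)\<^sup>2 / 2) ^ ((j - l) div 2) / fact ((j - l) div 2)) * p x else 0)"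
  have "(\<lambda>j. (I j / fact j - b j) * of_real u ^ j) sums 0" for u :: real
  proof -
    have "(\<lambda>i. of_real ((u\<^sup>2 * (norm x)\<^sup>2 / 2) ^ i /\<^sub>R fact i) * (of_real u ^ l * p x)) sums
       (of_real (exp (u\<^sup>2 * (norm x)\<^sup>2 / 2)) * (of_real u ^ l * p x))"
      by (intro sums_mult2 sums_of_real exp_converges)
    moreover have "of_real ((u\<^sup>2 * (norm x)\<^sup>2 / 2) ^ i /\<^sub>R fact i) * (of_real u ^ l * p x) = b (l + 2 * i) * of_real u ^ (l + 2 * i)" for i
    proof -
      have "of_real ((u\<^sup>2 * (norm x)\<^sup>2 / 2) ^ i /\<^sub>R fact i) = (of_real (((norm x)\<^sup>2 / 2) ^ i / fact i) * of_real ((u\<^sup>2) ^ i) :: complex)"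
        unfolding of_real_mult [symmetric] by (simp add: power_mult_distrib power_divide field_simps)
      also have "(u\<^sup>2) ^ i = u ^ (2 * i)" by (simp only: power_mult)
      finally show ?thesis by (simp add: b_def power_add)
    qed
    ultimately have "(\<lambda>i. b (l + 2 * i) * of_real u ^ (l + 2 * i)) sums
       (of_real (exp (u\<^sup>2 * (norm x)\<^sup>2 / 2)) * (of_real u ^ l * p x))" by simp
    then have "(\<lambda>j. b j * of_real u ^ j) sums (of_real (exp (u\<^sup>2 * (norm x)\<^sup>2 / 2)) * (of_real u ^ l * p x))"
    proof (subst (asm) sums_mono_reindex[of "\<lambda>i. l + 2 * i"])
      show "strict_mono (\<lambda>i. l + 2 * i)" by (auto simp: strict_mono_def)
      fix j assume j: "j \<notin> range (\<lambda>i. l + 2 * i)"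
      have "\<not> (l \<le> j \<and> even (j - l))"
      proof
        assume lj: "l \<le> j \<and> even (j - l)"
        then obtain i where "j - l = 2 * i" unfolding dvd_def by blast
        with lj have "j = l + 2 * i" by simp
        with j show False by blast
      qed
      then show "b j * of_real u ^ j = 0" unfolding b_def by (simp only: if_not_P if_False mult_zero_left)
    qed
    with gaussian_harmonic_moment_series[OF p, of x u]
    have "(\<lambda>j. I j / fact j * of_real u ^ j - b j * of_real u ^ j) sums 0"
      unfolding I_def using sums_diff by fastforce
    then show ?thesis by (simp add: left_diff_distrib)
  qed
  then have "I j / fact j - b j = 0" by (rule powser_unique_zero)
  then have "I j = fact j * b j" by (simp add: field_simps)
  then show ?thesis
    by (cases "l \<le> j \<and> even (j - l)") (simp_all only: I_def b_def if_P if_not_P of_real_mult of_real_divide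
      of_real_fact mult.assoc times_divide_eq_right times_divide_eq_left mult_zero_right simp_thms if_True if_False)
qed

text \<open>
  The constant in \<open>gaussian_homogeneous_integral\<close> is eliminated by comparing with the case \<open>q = 1\<close>,
  which avoids evaluating the volume of the ball.
\<close>

lemma sphere_moment:
  fixes p :: "real^'n \<Rightarrow> complex"
  assumes p: "p \<in> harmonic_polynomials l"
  shows "(LINT \<eta>|sphere_measure. of_real ((x \<bullet> \<eta>) ^ j) * p \<eta>) =
     (if l \<le> j \<and> even (j - l) then of_real (sphere_mass TYPE(real^'n) * fact j * norm x ^ (j - l) /
        (2 ^ j * fact ((j - l) div 2) * pochhammer (real CARD('n) / 2) ((j + l) div 2))) * p x else 0)"
proof -
  have hp: "homogeneous_polynomial l p" using p by (simp add: harmonic_polynomials_def)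
  define K where "K = (1 / sqrt (2 * pi)) ^ CARD('n) * (real CARD('n) * 2 powr (real CARD('n) / 2 - 1))"
  define s where "s = real CARD('n) / 2"
  define S where "S = sphere_mass TYPE(real^'n)"
  have s: "s > 0" by (simp add: s_def)
  have "(LINT z|lborel. of_real (gaussian (z::real^'n)) * (1::complex)) = of_real (K * 2 powr (real 0 / 2) * Gamma ((real CARD('n) + real 0) / 2)) * (LINT \<eta>|(sphere_measure :: (real^'n) measure). 1)"
    unfolding K_def by (rule gaussian_homogeneous_integral) auto
  then have "of_real (K * Gamma s * S) = (1::complex)"
    using gaussian_total[where 'n = 'n] by (simp add: s_def S_def scaleR_conv_of_real mult_ac)
  then have K: "K * Gamma s * S = 1" by (metis of_real_eq_1_iff)
  define M where "M = (LINT \<eta>|sphere_measure. of_real ((x \<bullet> \<eta>) ^ j) * p \<eta>)"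
  have main: "(LINT z|lborel. of_real (gaussian z) * (of_real ((x \<bullet> z) ^ j) * p z)) =
     of_real (K * 2 powr (real (j + l) / 2) * Gamma ((real CARD('n) + real (j + l)) / 2)) * M"
    unfolding K_def M_def
    by (rule gaussian_homogeneous_integral)
       (auto intro!: continuous_intros homogeneous_polynomial_continuous[OF hp]
         simp: homogeneous_polynomial_scale[OF hp] power_mult_distrib power_add)
  have G: "Gamma ((real CARD('n) + real (j + l)) / 2) > 0" by (simp add: add_pos_nonneg)
  have K0: "K \<noteq> 0" "S \<noteq> 0" using K by auto
  show ?thesis
  proof (cases "l \<le> j \<and> even (j - l)")
    case False
    then have "of_real (K * 2 powr (real (j + l) / 2) * Gamma ((real CARD('n) + real (j + l)) / 2)) * M = 0"
      using main unfolding gaussian_harmonic_moment[OF p] if_not_P[OF False] by simp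
    then have "M = 0" using G K0 by simp
    then show ?thesis unfolding M_def if_not_P[OF False] .
  next
    case True
    then obtain i where "j - l = 2 * i" unfolding dvd_def by blast
    with True have i: "j = l + 2 * i" by simp
    have e1: "(real CARD('n) + real (j + l)) / 2 = s + real (l + i)" by (simp add: s_def i field_simps)
    have e2: "Gamma (s + real (l + i)) = pochhammer s (l + i) * Gamma s"
    proof -
      have "s \<notin> \<int>\<^sub>\<le>\<^sub>0" using s by (auto elim!: nonpos_Ints_cases)
      then show ?thesis using Gamma_real_pos[OF s] by (simp add: pochhammer_Gamma)
    qed
    have e3: "(2::real) powr (real (j + l) / 2) = 2 ^ (l + i)"
    proof -
      have "real (j + l) / 2 = real (l + i)" by (simp add: i)
      then show ?thesis by (simp only: powr_realpow zero_less_numeral)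
    qed
    have p0: "pochhammer s (l + i) \<noteq> 0" using s by (simp add: pochhammer_pos less_imp_neq[symmetric])
    have "of_real (K * Gamma s * (2 ^ (l + i) * pochhammer s (l + i))) * M = of_real (fact j * ((norm x)\<^sup>2 / 2) ^ i / fact i) * p x"
      using main gaussian_harmonic_moment[OF p, of x j] unfolding e1 e2 e3 by (simp add: i mult_ac)
    \<comment> \<open>Multiplication by S makes the product \<open>K * Gamma s * S = 1\<close>
      appear.\<close>
    then have "of_real S * (of_real (K * Gamma s * (2 ^ (l + i) * pochhammer s (l + i))) * M) = of_real S * (of_real (fact j * ((norm x)\<^sup>2 / 2) ^ i / fact i) * p x)"
      by simp
    then have "of_real ((K * Gamma s * S) * (2 ^ (l + i) * pochhammer s (l + i))) * M = of_real (S * (fact j * ((norm x)\<^sup>2 / 2) ^ i / fact i)) * p x"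
      by (simp add: mult_ac)
    then have "of_real (2 ^ (l + i) * pochhammer s (l + i)) * M = of_real (S * (fact j * ((norm x)\<^sup>2 / 2) ^ i / fact i)) * p x"
      unfolding K by simp
    then have "M = of_real (S * (fact j * ((norm x)\<^sup>2 / 2) ^ i / fact i) / (2 ^ (l + i) * pochhammer s (l + i))) * p x"
      using p0 by (simp add: field_simps)
    also have "S * (fact j * ((norm x)\<^sup>2 / 2) ^ i / fact i) / (2 ^ (l + i) * pochhammer s (l + i)) =
        S * fact j * norm x ^ (j - l) / (2 ^ j * fact ((j - l) div 2) * pochhammer s ((j + l) div 2))"
    proof -
      have n: "norm x ^ (j - l) = ((norm x)\<^sup>2) ^ i" unfolding i by (simp only: power_mult diff_add_inverse)
      have "l + 2 * i = (l + i) + i" by simp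
      then have t: "(2::real) ^ j = 2 ^ (l + i) * 2 ^ i" unfolding i by (simp only: power_add)
      have "(j - l) div 2 = i" "(j + l) div 2 = l + i" by (simp_all add: i)
      then show ?thesis unfolding n t by (simp add: power_divide ac_simps)
    qed
    finally show ?thesis unfolding if_P[OF True] M_def S_def s_def .
  qed
qed

section \<open>The reproducing property of zonal polynomials\<close>

text \<open>The n-th finite difference annihilates polynomials of degree m < n. Pascal's rule
  rewrites the sum through first differences, and the difference of a rising factorial is a multiple
  of one of degree one less; this drives the induction.\<close>

lemma alternating_pochhammer_sum:
  "m < n \<Longrightarrow> (\<Sum>j\<le>n. (- 1) ^ j * real (n choose j) * pochhammer (c - real j) m) = 0"
proof (induction n arbitrary: m c)
  case (Suc n)
  show ?case
  proof (cases m)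
    case 0
    then show ?thesis using choose_alternating_sum[of "Suc n", where 'a = real] by simp
  next
    case (Suc m')
    have diff: "pochhammer c (Suc m') - pochhammer (c - 1) (Suc m') = (real m' + 1) * pochhammer c m'" for c :: real
      by (subst pochhammer_Suc, subst pochhammer_rec) (simp add: algebra_simps)
    \<comment> \<open>The sign is part of f, so a first difference takes the form f j + f (Suc
      j).\<close>
    define f where "f = (\<lambda>j. (- 1) ^ j * pochhammer (c - real j) m)"
    have "(\<Sum>j\<le>Suc n. (- 1) ^ j * real (Suc n choose j) * pochhammer (c - real j) m) = (\<Sum>j\<le>Suc n. real (Suc n choose j) * f j)"
      by (simp add: f_def mult_ac)
    also have "\<dots> = f 0 + (\<Sum>j\<le>n. real (Suc n choose Suc j) * f (Suc j))"
      by (subst sum.atMost_Suc_shift) simp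
    also have "\<dots> = (f 0 + (\<Sum>j\<le>n. real (n choose Suc j) * f (Suc j))) + (\<Sum>j\<le>n. real (n choose j) * f (Suc j))"
      by (simp add: algebra_simps sum.distrib)
    also have "f 0 + (\<Sum>j\<le>n. real (n choose Suc j) * f (Suc j)) = (\<Sum>j\<le>Suc n. real (n choose j) * f j)"
      by (subst sum.atMost_Suc_shift) simp
    also have "\<dots> = (\<Sum>j\<le>n. real (n choose j) * f j)" by (simp add: binomial_eq_0)
    finally have "(\<Sum>j\<le>Suc n. (- 1) ^ j * real (Suc n choose j) * pochhammer (c - real j) m) =
        (\<Sum>j\<le>n. real (n choose j) * (f j + f (Suc j)))"
      by (simp only: sum.distrib distrib_left)
    also have "\<dots> = (\<Sum>j\<le>n. (real m' + 1) * ((- 1) ^ j * real (n choose j) * pochhammer (c - real j) m'))"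
    proof (rule sum.cong[OF refl])
      fix j
      have "f j + f (Suc j) = (- 1) ^ j * (pochhammer (c - real j) (Suc m') - pochhammer (c - real j - 1) (Suc m'))"
        by (simp add: f_def Suc algebra_simps)
      then show "real (n choose j) * (f j + f (Suc j)) = (real m' + 1) * ((- 1) ^ j * real (n choose j) * pochhammer (c - real j) m')"
        unfolding diff by simp
    qed
    also have "\<dots> = 0" using Suc.IH[of m' c] Suc.prems Suc unfolding sum_distrib_left [symmetric] by simp
    finally show ?thesis .
  qed
qed simp

text \<open>
  For \<open>n > 0\<close> the sum is a multiple of the \<open>n\<close>-th difference of a polynomial of degree \<open>n - 1\<close>.
\<close>

lemma zonal_moment_coeff_sum:
  assumes s: "s > 0"
  shows "(\<Sum>j\<le>n. zonal_coeff s (l + 2 * n) j * fact (l + 2 * n - 2 * j) /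
     (2 ^ (l + 2 * n - 2 * j) * fact (n - j) * pochhammer s (l + n - j))) = (if n = 0 then 1 else 0)"
proof (cases "n = 0")
  case True
  show ?thesis
  proof (cases l)
    case (Suc l')
    then show ?thesis using True s pochhammer_pos[OF s, of l']
      by (simp add: zonal_coeff_def pochhammer_Suc)
  qed (use True in \<open>simp add: zonal_coeff_def\<close>)
next
  case n: False
  define k where "k = l + 2 * n"
  have "(\<Sum>j\<le>n. zonal_coeff s k j * fact (k - 2 * j) / (2 ^ (k - 2 * j) * fact (n - j) * pochhammer s (l + n - j))) =
     (\<Sum>j\<le>n. ((s + real k - 1) / fact n) * ((- 1) ^ j * real (n choose j) * pochhammer (s + real (l + n) - real j) (n - 1)))"
  proof (rule sum.cong[OF refl])
    fix j assume "j \<in> {..n}"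
    then have j: "j \<le> n" by simp
    have k0: "k \<noteq> 0" using n by (simp add: k_def)
    \<comment> \<open>The rising factorial is split at l + n - j: the first part cancels the
      Pochhammer symbol of the spherical moment, and the second is a polynomial in j of degree n -
      1.\<close>
    have "pochhammer s (k - j - 1) = pochhammer s (l + n - j) * pochhammer (s + real (l + n - j)) (k - j - 1 - (l + n - j))"
      using n j by (intro pochhammer_product) (auto simp: k_def)
    also have "k - j - 1 - (l + n - j) = n - 1" using n j by (auto simp: k_def)
    also have "s + real (l + n - j) = s + real (l + n) - real j" using j by simp
    finally have p: "pochhammer s (k - j - 1) = pochhammer s (l + n - j) * pochhammer (s + real (l + n) - real j) (n - 1)" .
    have p0: "pochhammer s (l + n - j) \<noteq> 0" using pochhammer_pos[OF s, of "l + n - j"] by simp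
    have b: "real (n choose j) = fact n / (fact j * fact (n - j))" using j by (rule binomial_fact)
    show "zonal_coeff s k j * fact (k - 2 * j) / (2 ^ (k - 2 * j) * fact (n - j) * pochhammer s (l + n - j)) =
      ((s + real k - 1) / fact n) * ((- 1) ^ j * real (n choose j) * pochhammer (s + real (l + n) - real j) (n - 1))"
      unfolding zonal_coeff_def b p using k0 p0 by simp
  qed
  also have "\<dots> = 0"
    unfolding sum_distrib_left [symmetric] using n by (subst alternating_pochhammer_sum) auto
  finally show ?thesis using n by (simp add: k_def)
qed

text \<open>On the sphere <\<eta>,\<eta>> = 1, so the integral is a combination of moments of order
  k - 2j. These vanish unless k = l + 2n and j <= n; the remaining ones all lead to the factor
  |x|^(2n) p x, and \<open>zonal_moment_coeff_sum\<close> adds up the coefficients.\<close>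

lemma zonal_reproducing:
  fixes p :: "real^'n \<Rightarrow> complex"
  assumes p: "p \<in> harmonic_polynomials l"
  shows "(LINT \<eta>|sphere_measure. of_real (zonal k x \<eta>) * p \<eta>) =
     (if k = l then of_real (sphere_mass TYPE(real^'n)) * p x else 0)"
proof -
  have hp: "homogeneous_polynomial l p" using p by (simp add: harmonic_polynomials_def)
  have [measurable]: "p \<in> borel_measurable borel"
    by (rule borel_measurable_continuous_onI[OF homogeneous_polynomial_continuous[OF hp]])
  define s where "s = real CARD('n) / 2"
  have s: "s > 0" by (simp add: s_def)
  define S where "S = sphere_mass TYPE(real^'n)"
  define M where "M = (\<lambda>j. LINT \<eta>|sphere_measure. of_real ((x \<bullet> \<eta>) ^ j) * p \<eta>)"
  define d where "d = (\<lambda>j. zonal_coeff s k j)"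
  obtain C where C: "\<And>x. norm (p x) \<le> C * norm x ^ l"
    using homogeneous_bound[OF homogeneous_polynomial_continuous[OF hp] homogeneous_polynomial_scale[OF hp]] by blast
  have int: "integrable sphere_measure (\<lambda>\<eta>. of_real ((x \<bullet> \<eta>) ^ j) * p \<eta>)" for j
  proof (rule sphere.integrable_const_bound[where B = "norm x ^ j * C"])
    show "AE \<eta> in sphere_measure. norm (of_real ((x \<bullet> \<eta>) ^ j) * p \<eta>) \<le> norm x ^ j * C"
      using AE_sphere_measure
    proof eventually_elim
      case (elim \<eta>)
      have "\<bar>x \<bullet> \<eta>\<bar> ^ j \<le> norm x ^ j" using Cauchy_Schwarz_ineq2[of x \<eta>] elim by (intro power_mono) auto
      then show ?case using C[of \<eta>] elim by (auto simp: norm_mult norm_power power_abs intro!: mult_mono)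
    qed
  qed measurable
  have "(LINT \<eta>|sphere_measure. of_real (zonal k x \<eta>) * p \<eta>) =
     (LINT \<eta>|sphere_measure. (\<Sum>j\<le>k div 2. of_real (d j * (norm x ^ (2 * j))) * (of_real ((x \<bullet> \<eta>) ^ (k - 2 * j)) * p \<eta>)))"
  proof (rule integral_cong_AE)
    show "AE \<eta> in sphere_measure. of_real (zonal k x \<eta>) * p \<eta> =
       (\<Sum>j\<le>k div 2. of_real (d j * (norm x ^ (2 * j))) * (of_real ((x \<bullet> \<eta>) ^ (k - 2 * j)) * p \<eta>))"
      using AE_sphere_measure
    proof eventually_elim
      case (elim \<eta>)
      then have "\<eta> \<bullet> \<eta> = 1" by (simp add: norm_eq_1)
      moreover have "norm x ^ (2 * j) = (x \<bullet> x) ^ j" for j by (simp only: power_mult power2_norm_eq_inner)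
      ultimately show ?case
        by (simp only: zonal_def d_def s_def sum_distrib_right power_one mult_1_right of_real_sum of_real_mult mult.assoc)
    qed
  qed (auto simp: zonal_def)
  also have "\<dots> = (\<Sum>j\<le>k div 2. of_real (d j * norm x ^ (2 * j)) * M (k - 2 * j))"
    unfolding M_def by (subst Bochner_Integration.integral_sum) (auto intro!: integrable_mult_right int simp del: of_real_mult of_real_power)
  also have "\<dots> = (if k = l then of_real S * p x else 0)"
  proof (cases "l \<le> k \<and> even (k - l)")
    case False
    have "M (k - 2 * j) = 0" if j: "j \<le> k div 2" for j
    proof -
      have "\<not> (l \<le> k - 2 * j \<and> even (k - 2 * j - l))"
      proof
        assume a: "l \<le> k - 2 * j \<and> even (k - 2 * j - l)"
        then obtain i where "k - 2 * j - l = 2 * i" unfolding dvd_def by blast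
        then have "k - l = 2 * (i + j)" "l \<le> k" using a j by auto
        with False show False by simp
      qed
      then show ?thesis unfolding M_def sphere_moment[OF p] by (simp only: if_not_P if_False)
    qed
    moreover have "k \<noteq> l" using False by auto
    ultimately show ?thesis by simp
  next
    case True
    then obtain n where "k - l = 2 * n" unfolding dvd_def by blast
    with True have k: "k = l + 2 * n" by simp
    have "(\<Sum>j\<le>k div 2. of_real (d j * norm x ^ (2 * j)) * M (k - 2 * j)) = (\<Sum>j\<le>n. of_real (d j * norm x ^ (2 * j)) * M (k - 2 * j))"
    proof (rule sum.mono_neutral_right)
      show "\<forall>j\<in>{..k div 2} - {..n}. of_real (d j * norm x ^ (2 * j)) * M (k - 2 * j) = 0"
      proof
        fix j assume "j \<in> {..k div 2} - {..n}"
        then have "\<not> (l \<le> k - 2 * j \<and> even (k - 2 * j - l))" by (auto simp: k)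
        then show "of_real (d j * norm x ^ (2 * j)) * M (k - 2 * j) = 0"
          unfolding M_def sphere_moment[OF p] by (simp only: if_not_P if_False mult_zero_right)
      qed
    qed (auto simp: k)
    also have "\<dots> = (\<Sum>j\<le>n. of_real (S * norm x ^ (2 * n)) * p x * of_real (d j * fact (k - 2 * j) / (2 ^ (k - 2 * j) * fact (n - j) * pochhammer s (l + n - j))))"
    proof (rule sum.cong[OF refl])
      fix j assume "j \<in> {..n}"
      then have j: "j \<le> n" by simp
      have c: "l \<le> k - 2 * j \<and> even (k - 2 * j - l)" using j by (auto simp: k)
      have e: "(k - 2 * j - l) div 2 = n - j" "(k - 2 * j + l) div 2 = l + n - j" using j by (auto simp: k)
      have "norm x ^ (2 * j) * norm x ^ (k - 2 * j - l) = norm x ^ (2 * n)"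
        using j by (simp add: k flip: power_add)
      then have "of_real (norm x ^ (2 * j)) * of_real (norm x ^ (k - 2 * j - l)) = (of_real (norm x ^ (2 * n)) :: complex)"
        by (metis of_real_mult)
      moreover have "M (k - 2 * j) = of_real (S * fact (k - 2 * j) * norm x ^ (k - 2 * j - l) / (2 ^ (k - 2 * j) * fact (n - j) * pochhammer s (l + n - j))) * p x"
        unfolding M_def sphere_moment[OF p] if_P[OF c] e S_def s_def ..
      ultimately show "of_real (d j * norm x ^ (2 * j)) * M (k - 2 * j) = of_real (S * norm x ^ (2 * n)) * p x * of_real (d j * fact (k - 2 * j) / (2 ^ (k - 2 * j) * fact (n - j) * pochhammer s (l + n - j)))"
        by (simp only: of_real_mult of_real_divide times_divide_eq_right times_divide_eq_left mult_ac)
    qed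
    also have "\<dots> = of_real (S * norm x ^ (2 * n)) * p x * of_real (if n = 0 then 1 else 0)"
      unfolding sum_distrib_left [symmetric] of_real_sum [symmetric]
      unfolding d_def k by (subst zonal_moment_coeff_sum[OF s]) rule
    also have "\<dots> = (if k = l then of_real S * p x else 0)" by (simp add: k)
    finally show ?thesis .
  qed
  finally show ?thesis unfolding S_def .
qed

section \<open>Zonal polynomials are homogeneous and harmonic\<close>

lemma homogeneous_polynomial_cmult:
  "homogeneous_polynomial l p \<Longrightarrow> homogeneous_polynomial l (\<lambda>x. c * p x)"
  unfolding homogeneous_polynomial_def
  by (elim exE, rule_tac x = "\<lambda>\<alpha>. c * ca \<alpha>" in exI) (simp add: sum_distrib_left mult.assoc)

lemma homogeneous_polynomial_add:
  "homogeneous_polynomial l p \<Longrightarrow> homogeneous_polynomial l q \<Longrightarrow> homogeneous_polynomial l (\<lambda>x. p x + q x)"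
  unfolding homogeneous_polynomial_def
  by (elim exE, rule_tac x = "\<lambda>\<alpha>. c \<alpha> + ca \<alpha>" in exI) (simp add: sum.distrib distrib_right)

lemma homogeneous_polynomial_zero: "homogeneous_polynomial l (\<lambda>x. 0)"
  unfolding homogeneous_polynomial_def by (rule exI[of _ "\<lambda>_. 0"]) simp

lemma homogeneous_polynomial_sum:
  "(\<And>a. a \<in> A \<Longrightarrow> homogeneous_polynomial l (p a)) \<Longrightarrow> homogeneous_polynomial l (\<lambda>x. \<Sum>a\<in>A. p a x)"
  by (induction A rule: infinite_finite_induct) (auto intro: homogeneous_polynomial_zero homogeneous_polynomial_add)

lemma homogeneous_polynomial_const: "homogeneous_polynomial 0 (\<lambda>x. c)"
proof -
  have "{\<alpha> :: 'a \<Rightarrow> nat. (\<Sum>i\<in>UNIV. \<alpha> i) = 0} = {\<lambda>_. 0}" by auto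
  then show ?thesis unfolding homogeneous_polynomial_def by (intro exI[of _ "\<lambda>_. c"]) simp
qed

lemma homogeneous_polynomial_coord: "homogeneous_polynomial 1 (\<lambda>x. of_real (x $ i))"
proof -
  define e where "e = (\<lambda>j. if j = i then 1 else 0 :: nat)"
  have "complex_of_real (x $ i) = (\<Sum>\<alpha> | (\<Sum>i\<in>UNIV. \<alpha> i) = 1. (if \<alpha> = e then 1 else 0) * of_real (\<Prod>i\<in>UNIV. x $ i ^ \<alpha> i))" for x
  proof -
    have "(\<Sum>\<alpha> | (\<Sum>i\<in>UNIV. \<alpha> i) = 1. (if \<alpha> = e then 1 else 0) * of_real (\<Prod>i\<in>UNIV. x $ i ^ \<alpha> i))
       = (\<Sum>\<alpha> | (\<Sum>i\<in>UNIV. \<alpha> i) = 1. if \<alpha> = e then of_real (\<Prod>i\<in>UNIV. x $ i ^ e i) else 0 :: complex)"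
      by (rule sum.cong) auto
    also have "\<dots> = of_real (\<Prod>j\<in>UNIV. x $ j ^ e j)"
      by (subst sum.delta) (auto simp: finite_multi_indices e_def)
    also have "(\<Prod>j\<in>UNIV. x $ j ^ e j) = (\<Prod>j\<in>UNIV. if j = i then x $ i else 1)"
      by (rule prod.cong) (auto simp: e_def)
    finally show ?thesis by simp
  qed
  then show ?thesis unfolding homogeneous_polynomial_def by (intro exI[of _ "\<lambda>\<alpha>. if \<alpha> = e then 1 else 0"] allI)
qed

lemma homogeneous_polynomial_mult:
  fixes p q :: "real^'n \<Rightarrow> complex"
  assumes "homogeneous_polynomial l p" "homogeneous_polynomial m q"
  shows "homogeneous_polynomial (l + m) (\<lambda>x. p x * q x)"
proof -
  let ?A = "\<lambda>l. {\<alpha> :: 'n \<Rightarrow> nat. (\<Sum>i\<in>UNIV. \<alpha> i) = l}"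
  obtain c d where c: "p = (\<lambda>x. \<Sum>\<alpha>\<in>?A l. c \<alpha> * of_real (monomial \<alpha> x))"
    and d: "q = (\<lambda>x. \<Sum>\<beta>\<in>?A m. d \<beta> * of_real (monomial \<beta> x))"
    using assms unfolding homogeneous_polynomial_iff by auto
  have mon: "homogeneous_polynomial k (\<lambda>x. of_real (monomial \<gamma> x))" if "\<gamma> \<in> ?A k" for \<gamma> k
    unfolding homogeneous_polynomial_iff
  proof (rule exI[of _ "\<lambda>\<alpha>. if \<alpha> = \<gamma> then 1 else 0"], rule ext)
    fix x
    have "(\<Sum>\<alpha>\<in>?A k. (if \<alpha> = \<gamma> then 1 else 0) * of_real (monomial \<alpha> x)) = (\<Sum>\<alpha>\<in>?A k. if \<alpha> = \<gamma> then of_real (monomial \<gamma> x) else (0::complex))"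
      by (rule sum.cong) auto
    also have "\<dots> = of_real (monomial \<gamma> x)"
      using that by (subst sum.delta) (auto simp: finite_multi_indices)
    finally show "of_real (monomial \<gamma> x) = (\<Sum>\<alpha>\<in>?A k. (if \<alpha> = \<gamma> then 1 else 0) * complex_of_real (monomial \<alpha> x))" ..
  qed
  have "(\<lambda>x. p x * q x) = (\<lambda>x. \<Sum>\<alpha>\<in>?A l. \<Sum>\<beta>\<in>?A m. (c \<alpha> * d \<beta>) * of_real (monomial (\<lambda>i. \<alpha> i + \<beta> i) x))"
    unfolding c d sum_product by (simp add: monomial_def power_add prod.distrib mult_ac)
  moreover have "homogeneous_polynomial (l + m) (\<lambda>x. \<Sum>\<alpha>\<in>?A l. \<Sum>\<beta>\<in>?A m. (c \<alpha> * d \<beta>) * of_real (monomial (\<lambda>i. \<alpha> i + \<beta> i) x))"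
    by (intro homogeneous_polynomial_sum homogeneous_polynomial_cmult mon) (auto simp: sum.distrib)
  ultimately show ?thesis by simp
qed

lemma homogeneous_polynomial_power:
  "homogeneous_polynomial l p \<Longrightarrow> homogeneous_polynomial (n * l) (\<lambda>x. p x ^ n)"
  by (induction n) (auto intro: homogeneous_polynomial_const homogeneous_polynomial_mult)

lemma homogeneous_polynomial_zonal:
  "homogeneous_polynomial k (\<lambda>y. of_real (zonal k x y))"
proof -
  have 1: "homogeneous_polynomial 1 (\<lambda>y. of_real (x \<bullet> y))" for x :: "real^'n"
    unfolding inner_vec_def
    by (simp, intro homogeneous_polynomial_sum homogeneous_polynomial_cmult) (use homogeneous_polynomial_coord in simp)
  have "homogeneous_polynomial (1 + 1) (\<lambda>y. \<Sum>i\<in>UNIV. of_real (y $ i) * of_real (y $ i))"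
    by (intro homogeneous_polynomial_sum homogeneous_polynomial_mult homogeneous_polynomial_coord)
  then have 2: "homogeneous_polynomial 2 (\<lambda>y::real^'n. of_real (y \<bullet> y))"
    by (simp add: inner_vec_def numeral_2_eq_2)
  have "homogeneous_polynomial k (\<lambda>y. of_real (zonal_coeff (real CARD('n) / 2) k j * (x \<bullet> x) ^ j) * (of_real (y \<bullet> y) ^ j * of_real (x \<bullet> y) ^ (k - 2 * j)))"
    if j: "j \<le> k div 2" for j
  proof -
    have "homogeneous_polynomial (j * 2 + (k - 2 * j) * 1) (\<lambda>y. of_real (y \<bullet> y) ^ j * of_real (x \<bullet> y) ^ (k - 2 * j))"
      by (intro homogeneous_polynomial_mult homogeneous_polynomial_power 1 2)
    moreover have "j * 2 + (k - 2 * j) * 1 = k" using j by simp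
    ultimately show ?thesis by (intro homogeneous_polynomial_cmult) simp
  qed
  then have "homogeneous_polynomial k (\<lambda>y. \<Sum>j\<le>k div 2. of_real (zonal_coeff (real CARD('n) / 2) k j * (x \<bullet> x) ^ j) * (of_real (y \<bullet> y) ^ j * of_real (x \<bullet> y) ^ (k - 2 * j)))"
    by (intro homogeneous_polynomial_sum) simp
  then show ?thesis by (simp add: zonal_def mult_ac)
qed

lemma partial_derivative_of_real:
  assumes "\<And>y. (g has_derivative g' y) (at y)"
  shows "partial_derivative i (\<lambda>y. of_real (g y)) = (\<lambda>y. of_real (g' y (axis i 1)))"
proof
  fix y
  have "((\<lambda>y. complex_of_real (g y)) has_derivative (\<lambda>h. of_real (g' y h))) (at y)"
    by (rule has_derivative_of_real) (rule assms)
  from frechet_derivative_at[OF this, symmetric]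
  show "partial_derivative i (\<lambda>y. of_real (g y)) y = of_real (g' y (axis i 1))"
    unfolding partial_derivative_def by simp
qed

text \<open>This relation between neighbouring coefficients is what makes the Laplacians of
  consecutive summands of \<open>zonal\<close> cancel.\<close>

lemma zonal_coeff_rec:
  assumes "2 * j + 2 \<le> k"
  shows "zonal_coeff s k (Suc j) * (4 * (real j + 1) * (s + real k - real j - 2)) = - zonal_coeff s k j * (real (k - 2 * j) * real (k - 2 * j - 1))"
proof -
  define n where "n = k - 2 * j - 2"
  have k: "k = n + 2 * j + 2" using assms by (simp add: n_def)
  have e: "k - 2 * Suc j = n" "k - 2 * j = Suc (Suc n)" "k - 2 * j - 1 = Suc n" "k - j - 1 = Suc (n + j)" "k - Suc j - 1 = n + j"
    by (auto simp: k)
  have s: "s + real k - real j - 2 = s + real (n + j)" by (simp add: k)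
  have k0: "k \<noteq> 0" by (simp add: k)
  show ?thesis
    unfolding zonal_coeff_def e s using k0
    by (simp add: pochhammer_Suc divide_simps del: of_nat_add of_nat_Suc) (simp add: algebra_simps)
qed

text \<open>The Laplacian of |y|^(2j) <x,y>^m is 4j (s + j - 1 + m) |y|^(2j - 2) <x,y>^m + m (m - 1)
  |x|^2 |y|^(2j) <x,y>^(m - 2). With m = k - 2j, the first part for j + 1 and the second part for j
  are multiples of the same function.\<close>

lemma laplacian_zonal:
  fixes x y :: "real^'n"
  shows "laplacian (\<lambda>y. of_real (zonal k x y)) y = 0"
proof -
  define s where "s = real CARD('n) / 2"
  define f where "f = (\<lambda>j n y. (y \<bullet> y) ^ j * (x \<bullet> y) ^ n)"
  define c where "c = (\<lambda>j. zonal_coeff s k j * (x \<bullet> x) ^ j)"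
  define n where "n = (\<lambda>j. k - 2 * j)"
  have zon: "zonal k x y = (\<Sum>j\<le>k div 2. c j * f j (n j) y)" for y
    by (simp add: zonal_def c_def f_def s_def n_def mult_ac)
  have fd: "(f j m has_derivative (\<lambda>h. 2 * real j * (y \<bullet> h) * f (j - 1) m y + real m * (x \<bullet> h) * f j (m - 1) y)) (at y)" for j m y
    unfolding f_def by (auto intro!: derivative_eq_intros simp: inner_commute algebra_simps)
  define D where "D = (\<lambda>i y. \<Sum>j\<le>k div 2. c j * (2 * real j * (y \<bullet> axis i 1) * f (j - 1) (n j) y + real (n j) * (x \<bullet> axis i 1) * f j (n j - 1) y))"
  have P1: "partial_derivative i (\<lambda>y. of_real (zonal k x y)) = (\<lambda>y. of_real (D i y))" for i
    unfolding D_def zon by (rule partial_derivative_of_real) (intro has_derivative_sum has_derivative_mult_right fd)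
  define D2 where "D2 = (\<lambda>i j m y. 2 * real j * (f (j - 1) m y +
      (y \<bullet> axis i 1) * (2 * real (j - 1) * (y \<bullet> axis i 1) * f (j - 2) m y + real m * (x \<bullet> axis i 1) * f (j - 1) (m - 1) y)) +
      real m * (x \<bullet> axis i 1) * (2 * real j * (y \<bullet> axis i 1) * f (j - 1) (m - 1) y + real (m - 1) * (x \<bullet> axis i 1) * f j (m - 2) y))"
  have P2: "partial_derivative i (\<lambda>y. of_real (D i y)) = (\<lambda>y. of_real (\<Sum>j\<le>k div 2. c j * D2 i j (n j) y))" for i
  proof -
    have "(D i has_derivative (\<lambda>h. \<Sum>j\<le>k div 2. c j * (2 * real j * ((h \<bullet> axis i 1) * f (j - 1) (n j) y +
      (y \<bullet> axis i 1) * (2 * real (j - 1) * (y \<bullet> h) * f (j - 1 - 1) (n j) y + real (n j) * (x \<bullet> h) * f (j - 1) (n j - 1) y)) +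
      real (n j) * (x \<bullet> axis i 1) * (2 * real j * (y \<bullet> h) * f (j - 1) (n j - 1) y + real (n j - 1) * (x \<bullet> h) * f j (n j - 1 - 1) y)))) (at y)" for y
      unfolding D_def
      by (rule has_derivative_sum, rule has_derivative_mult_right)
         (rule derivative_eq_intros fd refl | simp add: algebra_simps)+
    from partial_derivative_of_real[OF this, of i] show ?thesis by (simp add: D2_def numeral_2_eq_2)
  qed
  have sumD2: "(\<Sum>i\<in>UNIV. D2 i j m y) = 4 * real j * (s + real j - 1 + real m) * f (j - 1) m y + real m * real (m - 1) * (x \<bullet> x) * f j (m - 2) y" for j m
  proof -
    have yy: "(\<Sum>i\<in>UNIV. (y \<bullet> axis i 1) * (y \<bullet> axis i 1)) = y \<bullet> y"
      and xy: "(\<Sum>i\<in>UNIV. (x \<bullet> axis i 1) * (y \<bullet> axis i 1)) = x \<bullet> y"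
      and xx: "(\<Sum>i\<in>UNIV. (x \<bullet> axis i 1) * (x \<bullet> axis i 1)) = x \<bullet> x"
      unfolding inner_axis by (simp_all add: inner_vec_def)
    have "(\<Sum>i\<in>UNIV. D2 i j m y) = (\<Sum>i\<in>UNIV. 2 * real j * f (j - 1) m y
        + (y \<bullet> axis i 1) * (y \<bullet> axis i 1) * (4 * real j * real (j - 1) * f (j - 2) m y)
        + (x \<bullet> axis i 1) * (y \<bullet> axis i 1) * (4 * real j * real m * f (j - 1) (m - 1) y)
        + (x \<bullet> axis i 1) * (x \<bullet> axis i 1) * (real m * real (m - 1) * f j (m - 2) y))"
      by (rule sum.cong[OF refl]) (simp add: D2_def algebra_simps)
    also have "\<dots> = real CARD('n) * (2 * real j * f (j - 1) m y) + (y \<bullet> y) * (4 * real j * real (j - 1) * f (j - 2) m y)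
        + (x \<bullet> y) * (4 * real j * real m * f (j - 1) (m - 1) y) + (x \<bullet> x) * (real m * real (m - 1) * f j (m - 2) y)"
      by (simp only: sum.distrib sum_distrib_right [symmetric] yy xy xx sum_constant)
    also have "(y \<bullet> y) * (4 * real j * real (j - 1) * f (j - 2) m y) = 4 * real j * (real j - 1) * f (j - 1) m y"
    proof -
      consider "j = 0" | "j = 1" | i where "j = Suc (Suc i)" by (metis One_nat_def not0_implies_Suc)
      then show ?thesis by cases (simp_all add: f_def algebra_simps)
    qed
    also have "(x \<bullet> y) * (4 * real j * real m * f (j - 1) (m - 1) y) = 4 * real j * real m * f (j - 1) m y"
      by (cases m) (simp_all add: f_def)
    finally show ?thesis by (simp add: s_def algebra_simps)
  qed
  have "laplacian (\<lambda>y. of_real (zonal k x y)) y = of_real (\<Sum>i\<in>UNIV. \<Sum>j\<le>k div 2. c j * D2 i j (n j) y)"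
    unfolding laplacian_def P1 P2 by simp
  also have "(\<Sum>i\<in>UNIV. \<Sum>j\<le>k div 2. c j * D2 i j (n j) y) = (\<Sum>j\<le>k div 2. c j * (\<Sum>i\<in>UNIV. D2 i j (n j) y))"
    by (subst sum.swap) (simp add: sum_distrib_left)
  also have "\<dots> = (\<Sum>j\<le>k div 2. c j * (4 * real j * (s + real j - 1 + real (n j)) * f (j - 1) (n j) y))
      + (\<Sum>j\<le>k div 2. c j * (real (n j) * real (n j - 1) * (x \<bullet> x) * f j (n j - 2) y))"
    unfolding sumD2 by (simp only: distrib_left sum.distrib)
  also have "(\<Sum>j\<le>k div 2. c j * (4 * real j * (s + real j - 1 + real (n j)) * f (j - 1) (n j) y)) =
      (\<Sum>j<k div 2. c (Suc j) * (4 * (real j + 1) * (s + real j + real (n (Suc j))) * f j (n (Suc j)) y))"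
    by (subst sum.atMost_shift) (simp add: add.commute)
  also have "(\<Sum>j\<le>k div 2. c j * (real (n j) * real (n j - 1) * (x \<bullet> x) * f j (n j - 2) y)) =
      (\<Sum>j<k div 2. c j * (real (n j) * real (n j - 1) * (x \<bullet> x) * f j (n j - 2) y))"
  proof -
    \<comment> \<open>The top summand has no second part, since at most one factor <x,y> is left in
      it.\<close>
    have "n (k div 2) = 0 \<or> n (k div 2) = 1" by (auto simp: n_def)
    then show ?thesis by (auto simp flip: lessThan_Suc_atMost)
  qed
  also have "(\<Sum>j<k div 2. c (Suc j) * (4 * (real j + 1) * (s + real j + real (n (Suc j))) * f j (n (Suc j)) y)) + \<dots> = 0"
    unfolding sum.distrib [symmetric]
  proof (rule sum.neutral, rule ballI)
    fix j assume "j \<in> {..<k div 2}"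
    then have j: "2 * j + 2 \<le> k" by auto
    have 1: "s + real j + real (n (Suc j)) = s + real k - real j - 2" using j by (simp add: n_def of_nat_diff)
    have 2: "n (Suc j) = n j - 2" by (simp add: n_def)
    have "c (Suc j) * (4 * (real j + 1) * (s + real k - real j - 2) * f j (n j - 2) y) =
       (zonal_coeff s k (Suc j) * (4 * (real j + 1) * (s + real k - real j - 2))) * (x \<bullet> x) ^ Suc j * f j (n j - 2) y"
      by (simp add: c_def mult_ac)
    also have "\<dots> = - (c j * (real (n j) * real (n j - 1) * (x \<bullet> x) * f j (n j - 2) y))"
      unfolding zonal_coeff_rec[OF j] by (simp add: c_def n_def mult_ac)
    finally show "c (Suc j) * (4 * (real j + 1) * (s + real j + real (n (Suc j))) * f j (n (Suc j)) y) +
       c j * (real (n j) * real (n j - 1) * (x \<bullet> x) * f j (n j - 2) y) = 0"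
      unfolding 1 unfolding 2 by simp
  qed
  finally show ?thesis by simp
qed

text \<open>A zonal polynomial may thus stand for p in the reproducing property, which is what
  \<open>sphere_zonal_product\<close> exploits.\<close>

lemma zonal_harmonic: "(\<lambda>y. of_real (zonal k x y)) \<in> harmonic_polynomials k"
  by (simp add: harmonic_polynomials_def homogeneous_polynomial_zonal laplacian_zonal)

section \<open>Radial integrals\<close>

text \<open>In terms of the normalized Bessel function, \<open>bessel_clifford lam (z\<^sup>2/4)\<close> is \<open>normalized_bessel_I lam z\<close>.\<close>

definition bessel_clifford :: "real \<Rightarrow> real \<Rightarrow> real" where
  "bessel_clifford lam z = (\<Sum>j. z ^ j * rGamma (lam + real j + 1) / fact j)"

text \<open>This is \<open>n! L\<^sub>n(-z)\<close> for the Laguerre polynomial \<open>L\<^sub>n\<close> with parameter \<open>lam\<close>.\<close>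

definition laguerre_sum :: "nat \<Rightarrow> real \<Rightarrow> real \<Rightarrow> real" where
  "laguerre_sum n lam z = (\<Sum>i\<le>n. real (n choose i) * pochhammer (lam + real i + 1) (n - i) * z ^ i)"

lemma rGamma_shift: "rGamma (z + real n) * pochhammer z n = rGamma z" for z :: real
  using pochhammer_rGamma[of z n] by (simp add: mult.commute)

lemma rGamma_real_nonneg: "x > 0 \<Longrightarrow> rGamma (x::real) \<ge> 0"
  by (simp add: rGamma_inverse_Gamma less_imp_le)

text \<open>Supplies a second factorial in the denominators of the Bessel series. The parameter
  \<delta> admits x close to 0; from the second factor on, x + j >= (j + 1) / 2 because j >=
  1.\<close>

lemma pochhammer_ge:
  assumes "0 < \<delta>" "\<delta> \<le> 1" "\<delta> \<le> (x::real)"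
  shows "pochhammer x j \<ge> \<delta> * fact j / 2 ^ j"
proof (induction j)
  case (Suc j)
  show ?case
  proof (cases "j = 0")
    case False
    then have j: "real j \<ge> 1" by simp
    have "\<delta> * fact (Suc j) / 2 ^ Suc j = (\<delta> * fact j / 2 ^ j) * ((real j + 1) / 2)"
      by (simp add: field_simps)
    also have "\<dots> \<le> pochhammer x j * (x + real j)"
      using Suc assms j by (intro mult_mono) (auto intro!: pochhammer_nonneg)
    finally show ?thesis by (simp add: pochhammer_Suc)
  qed (use assms in auto)
qed (use assms in auto)

lemma power_over_fact_le_exp: "w \<ge> 0 \<Longrightarrow> w ^ j / fact j \<le> exp (w::real)"
  using sum_le_suminf[OF summable_exp_generic[of w], of "{j}"] by (simp add: exp_def divide_inverse mult.commute)

text \<open>With w = sqrt (2 q) the j-th term is at most a constant times (w^j / j!)^2; one factor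
  is bounded by exp w and the other sums to exp w. The radial weight can absorb this growth in sqrt
  q, \<delta> allows one choice for a whole range of lam, and \<open>rGamma (lam + 1)\<close> stays
  explicit because \<open>bessel_series_bound\<close> needs its decay.\<close>

lemma bessel_clifford_bound:
  assumes d: "0 < \<delta>" "\<delta> \<le> 1" "\<delta> \<le> lam + 1" and q: "q \<ge> 0"
  shows "summable (\<lambda>j. q ^ j * rGamma (lam + real j + 1) / fact j)"
    and "0 \<le> bessel_clifford lam q"
    and "bessel_clifford lam q \<le> rGamma (lam + 1) / \<delta> * exp (2 * sqrt (2 * q))"
proof -
  define w where "w = sqrt (2 * q)"
  have w: "w \<ge> 0" "w ^ 2 = 2 * q" using q by (auto simp: w_def)
  have r: "rGamma (lam + 1) \<ge> 0" using d by (intro rGamma_real_nonneg) auto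
  have nn: "0 \<le> q ^ j * rGamma (lam + real j + 1) / fact j" for j
    using d q by (intro divide_nonneg_pos mult_nonneg_nonneg rGamma_real_nonneg) auto
  have le: "q ^ j * rGamma (lam + real j + 1) / fact j \<le> (rGamma (lam + 1) / \<delta> * exp w) * (w ^ j /\<^sub>R fact j)" for j
  proof -
    have p: "pochhammer (lam + 1) j \<ge> \<delta> * fact j / 2 ^ j" by (rule pochhammer_ge) (use d in auto)
    have p0: "\<delta> * fact j / 2 ^ j > 0" using d by simp
    have "rGamma (lam + real j + 1) * pochhammer (lam + 1) j = rGamma (lam + 1)"
      using rGamma_shift[of "lam + 1" j] by (simp add: ac_simps)
    moreover have "pochhammer (lam + 1) j > 0" using p p0 by linarith
    ultimately have "rGamma (lam + real j + 1) = rGamma (lam + 1) / pochhammer (lam + 1) j"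
      by (simp add: eq_divide_eq)
    also have "\<dots> \<le> rGamma (lam + 1) / (\<delta> * fact j / 2 ^ j)"
      using p p0 r by (intro divide_left_mono mult_pos_pos) linarith+
    finally have "q ^ j * rGamma (lam + real j + 1) / fact j \<le> q ^ j * (rGamma (lam + 1) / (\<delta> * fact j / 2 ^ j)) / fact j"
      using q by (intro divide_right_mono mult_left_mono) auto
    also have "\<dots> = rGamma (lam + 1) / \<delta> * (w ^ j / fact j) * (w ^ j / fact j)"
    proof -
      have "w ^ j * w ^ j = (2 * q) ^ j" by (metis w(2) power2_eq_square power_mult_distrib)
      then show ?thesis using d by (simp add: power_mult_distrib field_simps)
    qed
    also have "\<dots> \<le> rGamma (lam + 1) / \<delta> * exp w * (w ^ j / fact j)"
      using r d w by (intro mult_right_mono mult_left_mono power_over_fact_le_exp) auto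
    finally show ?thesis by (simp add: divide_inverse mult_ac)
  qed
  have s: "(\<lambda>j. (rGamma (lam + 1) / \<delta> * exp w) * (w ^ j /\<^sub>R fact j)) sums ((rGamma (lam + 1) / \<delta> * exp w) * exp w)"
    by (intro sums_mult exp_converges)
  show sm: "summable (\<lambda>j. q ^ j * rGamma (lam + real j + 1) / fact j)"
    by (rule summable_comparison_test'[OF sums_summable[OF s], of 0]) (simp only: real_norm_def abs_of_nonneg[OF nn] le)
  show "0 \<le> bessel_clifford lam q" unfolding bessel_clifford_def by (rule suminf_nonneg[OF sm nn])
  have "bessel_clifford lam q \<le> (rGamma (lam + 1) / \<delta> * exp w) * exp w"
    unfolding bessel_clifford_def using s by (metis (no_types, lifting) le sm suminf_le sums_iff)
  then show "bessel_clifford lam q \<le> rGamma (lam + 1) / \<delta> * exp (2 * sqrt (2 * q))"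
    by (simp add: w_def mult.assoc flip: exp_add)
qed

text \<open>For lam > - 1 the coefficients are nonnegative, so the series of norms is the series at
  |z|.\<close>

lemma bessel_clifford_sums:
  assumes "lam > - 1"
  shows "summable (\<lambda>j. norm (z ^ j * rGamma (lam + real j + 1) / fact j))"
    and "(\<lambda>j. norm (z ^ j * rGamma (lam + real j + 1) / fact j)) sums bessel_clifford lam \<bar>z\<bar>"
    and "(\<lambda>j. z ^ j * rGamma (lam + real j + 1) / fact j) sums bessel_clifford lam z"
    and "\<bar>bessel_clifford lam z\<bar> \<le> bessel_clifford lam \<bar>z\<bar>"
proof -
  have e: "norm (z ^ j * rGamma (lam + real j + 1) / fact j) = \<bar>z\<bar> ^ j * rGamma (lam + real j + 1) / fact j" for j
    using rGamma_real_nonneg[of "lam + real j + 1"] assms by (simp add: abs_mult power_abs)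
  show 1: "summable (\<lambda>j. norm (z ^ j * rGamma (lam + real j + 1) / fact j))"
    unfolding e by (rule bessel_clifford_bound(1)[of "min 1 (lam + 1)"]) (use assms in auto)
  then show 2: "(\<lambda>j. norm (z ^ j * rGamma (lam + real j + 1) / fact j)) sums bessel_clifford lam \<bar>z\<bar>"
    unfolding e bessel_clifford_def by (rule summable_sums)
  show "(\<lambda>j. z ^ j * rGamma (lam + real j + 1) / fact j) sums bessel_clifford lam z"
    unfolding bessel_clifford_def using summable_norm_cancel[OF 1] by (rule summable_sums)
  show "\<bar>bessel_clifford lam z\<bar> \<le> bessel_clifford lam \<bar>z\<bar>"
    using summable_norm[OF 1] 2 unfolding bessel_clifford_def real_norm_def sums_iff by simp
qed

lemma bessel_clifford_measurable [measurable]: "bessel_clifford lam \<in> borel_measurable borel"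
  unfolding bessel_clifford_def[abs_def] by measurable

lemma bessel_clifford_exp_bound:
  assumes "lam > - 1"
  obtains C where "C \<ge> 0" "\<And>z. \<bar>bessel_clifford lam z\<bar> \<le> C * exp (2 * sqrt (2 * \<bar>z\<bar>))"
proof
  define \<delta> where "\<delta> = min 1 (lam + 1)"
  have d: "0 < \<delta>" "\<delta> \<le> 1" "\<delta> \<le> lam + 1" using assms by (auto simp: \<delta>_def)
  show "rGamma (lam + 1) / \<delta> \<ge> 0" using d assms by (intro divide_nonneg_pos rGamma_real_nonneg) auto
  show "\<bar>bessel_clifford lam z\<bar> \<le> rGamma (lam + 1) / \<delta> * exp (2 * sqrt (2 * \<bar>z\<bar>))" for z
    using bessel_clifford_sums(4)[OF assms, of z] bessel_clifford_bound(3)[OF d, of "\<bar>z\<bar>"] by simp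
qed

text \<open>From (D - t sqrt v)^2 >= 0 follows D sqrt v <= D^2 / (2t) + t v / 2. Half of the decay
  is spent on the square-root exponential, and the other half leaves a Gamma integral.\<close>

lemma integrable_powr_exp_sqrt:
  fixes \<beta> t D :: real
  assumes b: "\<beta> > - 1" and t: "t > 0"
  shows "integrable lborel (\<lambda>v. indicator {0<..} v * (v powr \<beta> * (exp (- (t * v)) * exp (D * sqrt v))))"
proof (rule Bochner_Integration.integrable_bound)
  show "integrable lborel (\<lambda>v. exp (D\<^sup>2 / (2 * t)) * (indicator {0<..} v * (v powr (\<beta> + 1 - 1) * exp (- (t / 2 * v)))))"
    using has_bochner_integral_Gamma[of "\<beta> + 1" "t / 2"] b t
    by (intro integrable_mult_right) (simp only: has_bochner_integral_iff; simp)
  show "AE v in lborel. norm (indicator {0<..} v * (v powr \<beta> * (exp (- (t * v)) * exp (D * sqrt v))))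
      \<le> norm (exp (D\<^sup>2 / (2 * t)) * (indicator {0<..} v * (v powr (\<beta> + 1 - 1) * exp (- (t / 2 * v)))))"
  proof (rule AE_I2)
    fix v :: real
    show "norm (indicator {0<..} v * (v powr \<beta> * (exp (- (t * v)) * exp (D * sqrt v))))
      \<le> norm (exp (D\<^sup>2 / (2 * t)) * (indicator {0<..} v * (v powr (\<beta> + 1 - 1) * exp (- (t / 2 * v)))))"
    proof (cases "v > 0")
      case True
      have "0 \<le> (D - t * sqrt v)\<^sup>2" by simp
      also have "\<dots> = D\<^sup>2 - 2 * t * (D * sqrt v) + t\<^sup>2 * v"
        using True by (simp add: power2_diff power_mult_distrib algebra_simps)
      finally have "2 * t * (D * sqrt v) \<le> 2 * t * (D\<^sup>2 / (2 * t) + t / 2 * v)"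
        using t by (simp add: algebra_simps power2_eq_square)
      then have "D * sqrt v \<le> D\<^sup>2 / (2 * t) + t / 2 * v" by (rule mult_left_le_imp_le) (use t in simp)
      then have "exp (- (t * v)) * exp (D * sqrt v) \<le> exp (D\<^sup>2 / (2 * t)) * exp (- (t / 2 * v))"
        unfolding exp_add [symmetric] exp_le_cancel_iff by (simp add: algebra_simps)
      then have "v powr \<beta> * (exp (- (t * v)) * exp (D * sqrt v)) \<le> v powr \<beta> * (exp (D\<^sup>2 / (2 * t)) * exp (- (t / 2 * v)))"
        by (rule mult_left_mono) simp
      then show ?thesis using True by (simp add: mult_ac)
    qed simp
  qed
qed measurable

text \<open>Vandermonde's convolution for i + (lam + n) over n. It expands in the falling factorials
  i! / (i - k)!, whose numerators cancel the i! of an exponential series.\<close>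

lemma pochhammer_vandermonde:
  fixes lam :: real
  shows "pochhammer (lam + real i + 1) n =
    (\<Sum>k\<le>n. real (n choose k) * pochhammer (lam + real k + 1) (n - k) * (if k \<le> i then fact i / fact (i - k) else 0))"
proof -
  have "pochhammer (lam + real i + 1) n = fact n * ((real i + (lam + real n)) gchoose n)"
    by (simp add: gbinomial_pochhammer' algebra_simps)
  also have "\<dots> = (\<Sum>k\<le>n. fact n * ((real i gchoose k) * ((lam + real n) gchoose (n - k))))"
    by (simp only: gbinomial_Vandermonde [of "real i" "lam + real n" n, symmetric] sum_distrib_left atLeast0AtMost)
  also have "\<dots> = (\<Sum>k\<le>n. real (n choose k) * pochhammer (lam + real k + 1) (n - k) * (if k \<le> i then fact i / fact (i - k) else 0))"
  proof (rule sum.cong[OF refl])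
    fix k assume "k \<in> {..n}"
    then have k: "k \<le> n" by simp
    have a: "lam + real n - real (n - k) + 1 = lam + real k + 1" using k by simp
    have g: "(lam + real n) gchoose (n - k) = pochhammer (lam + real k + 1) (n - k) / fact (n - k)"
      unfolding gbinomial_pochhammer' a ..
    have b: "real (n choose k) = fact n / (fact k * fact (n - k))" using k by (rule binomial_fact)
    have c: "real i gchoose k = (if k \<le> i then fact i / (fact k * fact (i - k)) else 0)"
      by (simp add: binomial_fact binomial_eq_0 flip: binomial_gbinomial)
    show "fact n * ((real i gchoose k) * ((lam + real n) gchoose (n - k))) =
       real (n choose k) * pochhammer (lam + real k + 1) (n - k) * (if k \<le> i then fact i / fact (i - k) else 0)"
      unfolding g b c by (simp add: mult_ac)
  qed
  finally show ?thesis .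
qed

text \<open>After expansion by \<open>pochhammer_vandermonde\<close>, the k-th falling factorial
  turns the exponential series into z^k exp z.\<close>

lemma laguerre_sum_sums:
  "(\<lambda>i. z ^ i / fact i * pochhammer (lam + real i + 1) n) sums (exp z * laguerre_sum n lam z)"
proof -
  have "(\<lambda>i. if k \<le> i then z ^ i / fact (i - k) else 0) sums (z ^ k * exp z)" for k
  proof -
    have "(\<lambda>i. z ^ k * (z ^ i /\<^sub>R fact i)) sums (z ^ k * exp z)" by (intro sums_mult exp_converges)
    moreover have "z ^ k * (z ^ i /\<^sub>R fact i) = (if k \<le> i + k then z ^ (i + k) / fact (i + k - k) else 0)" for i
      by (simp add: power_add field_simps)
    ultimately have "(\<lambda>i. if k \<le> i + k then z ^ (i + k) / fact (i + k - k) else 0) sums (z ^ k * exp z)" by simp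
    then show ?thesis by (subst (asm) sums_iff_shift) simp
  qed
  then have "(\<lambda>i. \<Sum>k\<le>n. real (n choose k) * pochhammer (lam + real k + 1) (n - k) * (if k \<le> i then z ^ i / fact (i - k) else 0)) sums
     (\<Sum>k\<le>n. real (n choose k) * pochhammer (lam + real k + 1) (n - k) * (z ^ k * exp z))"
    by (intro sums_sum sums_mult)
  moreover have "(\<Sum>k\<le>n. real (n choose k) * pochhammer (lam + real k + 1) (n - k) * (if k \<le> i then z ^ i / fact (i - k) else 0))
     = z ^ i / fact i * pochhammer (lam + real i + 1) n" for i
    unfolding pochhammer_vandermonde[of lam i n] sum_distrib_left by (rule sum.cong) auto
  moreover have "(\<Sum>k\<le>n. real (n choose k) * pochhammer (lam + real k + 1) (n - k) * (z ^ k * exp z)) = exp z * laguerre_sum n lam z"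
    by (simp add: laguerre_sum_def sum_distrib_left mult_ac)
  ultimately show ?thesis by simp
qed

text \<open>Integrated termwise, v^(lam + n + i) yields Gamma (lam + n + i + 1); divided by the
  Gamma (lam + i + 1) of the Bessel series this is \<open>pochhammer (lam + i + 1) n\<close>, and
  \<open>laguerre_sum_sums\<close> at X / t sums the rest.\<close>

lemma laguerre_integral:
  assumes lam: "lam > - 1" and t: "t > 0"
  shows "has_bochner_integral lborel (\<lambda>v. indicator {0<..} v * (v powr (lam + real n) * exp (- (t * v)) * bessel_clifford lam (X * v)))
     (t powr (- (lam + real n + 1)) * (exp (X / t) * laguerre_sum n lam (X / t)))"
proof -
  define f where "f = (\<lambda>i v. (indicator {0<..} v * (v powr (lam + real n) * exp (- (t * v)))) * ((X * v) ^ i * rGamma (lam + real i + 1) / fact i))"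
  obtain C where C: "C \<ge> 0" "\<And>z. \<bar>bessel_clifford lam z\<bar> \<le> C * exp (2 * sqrt (2 * \<bar>z\<bar>))"
    using bessel_clifford_exp_bound[OF lam] by blast
  define h where "h = (\<lambda>v. C * (indicator {0<..} v * (v powr (lam + real n) * (exp (- (t * v)) * exp ((2 * sqrt (2 * \<bar>X\<bar>)) * sqrt v)))))"
  have h: "integrable lborel h" unfolding h_def using lam t
    by (intro integrable_mult_right integrable_powr_exp_sqrt) auto
  have fm: "f i \<in> borel_measurable lborel" for i unfolding f_def by measurable
  have ae: "AE v in lborel. summable (\<lambda>i. norm (f i v)) \<and> (\<Sum>i. norm (f i v)) \<le> h v"
  proof (rule AE_I2)
    fix v :: real
    have "(\<lambda>i. norm (f i v)) sums (norm (indicator {0<..} v * (v powr (lam + real n) * exp (- (t * v)))) * bessel_clifford lam \<bar>X * v\<bar>)"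
      unfolding f_def norm_mult[of "indicator {0<..} v * (v powr (lam + real n) * exp (- (t * v)))"]
      by (intro sums_mult bessel_clifford_sums(2) lam)
    moreover have "norm (indicator {0<..} v * (v powr (lam + real n) * exp (- (t * v)))) * bessel_clifford lam \<bar>X * v\<bar> \<le> h v"
    proof (cases "v > 0")
      case True
      have "bessel_clifford lam \<bar>X * v\<bar> \<le> C * exp (2 * sqrt (2 * \<bar>X * v\<bar>))" using C(2)[of "\<bar>X * v\<bar>"] by simp
      also have "2 * sqrt (2 * \<bar>X * v\<bar>) = (2 * sqrt (2 * \<bar>X\<bar>)) * sqrt v" using True by (simp add: abs_mult real_sqrt_mult)
      finally have "(v powr (lam + real n) * exp (- (t * v))) * bessel_clifford lam \<bar>X * v\<bar> \<le> (v powr (lam + real n) * exp (- (t * v))) * (C * exp ((2 * sqrt (2 * \<bar>X\<bar>)) * sqrt v))"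
        by (rule mult_left_mono) simp
      then show ?thesis using True by (simp add: h_def mult_ac)
    qed (simp add: h_def)
    ultimately show "summable (\<lambda>i. norm (f i v)) \<and> (\<Sum>i. norm (f i v)) \<le> h v" by (simp add: sums_iff)
  qed
  note ds = dominated_sums[OF fm h ae]
  have sf: "(\<Sum>i. f i v) = indicator {0<..} v * (v powr (lam + real n) * exp (- (t * v)) * bessel_clifford lam (X * v))" for v
  proof -
    have "(\<lambda>i. f i v) sums ((indicator {0<..} v * (v powr (lam + real n) * exp (- (t * v)))) * bessel_clifford lam (X * v))"
      unfolding f_def by (intro sums_mult bessel_clifford_sums(3) lam)
    then show ?thesis by (simp add: sums_iff mult_ac)
  qed
  have fi: "integral\<^sup>L lborel (f i) = t powr (- (lam + real n + 1)) * ((X / t) ^ i / fact i * pochhammer (lam + real i + 1) n)" for i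
  proof -
    have p: "lam + real n + real i + 1 > 0" using lam by linarith
    have "f i v = (X ^ i * rGamma (lam + real i + 1) / fact i) * (indicator {0<..} v * (v powr (lam + real n + real i + 1 - 1) * exp (- (t * v))))" for v
      by (cases "v > 0") (simp_all add: f_def powr_add powr_realpow power_mult_distrib)
    then have "f i = (\<lambda>v. (X ^ i * rGamma (lam + real i + 1) / fact i) * (indicator {0<..} v * (v powr (lam + real n + real i + 1 - 1) * exp (- (t * v)))))" by (rule ext)
    then have "integral\<^sup>L lborel (f i) = (X ^ i * rGamma (lam + real i + 1) / fact i) * (Gamma (lam + real n + real i + 1) / t powr (lam + real n + real i + 1))"
      using has_bochner_integral_Gamma[OF p t] by (simp only: integral_mult_right_zero has_bochner_integral_iff)
    also have "Gamma (lam + real n + real i + 1) = pochhammer (lam + real i + 1) n * Gamma (lam + real i + 1)"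
    proof -
      have "lam + real i + 1 > 0" using lam by linarith
      then have "lam + real i + 1 \<notin> \<int>\<^sub>\<le>\<^sub>0" "Gamma (lam + real i + 1) \<noteq> 0"
        by (auto elim!: nonpos_Ints_cases dest: Gamma_real_pos)
      then show ?thesis using pochhammer_Gamma[of "lam + real i + 1" n] by (simp add: ac_simps)
    qed
    also have "t powr (lam + real n + real i + 1) = t ^ i / t powr (- (lam + real n + 1))"
    proof -
      have "lam + real n + real i + 1 = real i + (lam + real n + 1)" by simp
      then show ?thesis using t by (simp only: powr_add powr_realpow powr_minus) (simp add: field_simps)
    qed
    also have "rGamma (lam + real i + 1) = inverse (Gamma (lam + real i + 1))" by (simp add: rGamma_inverse_Gamma)
    finally show ?thesis
    proof -
      assume *: "integral\<^sup>L lborel (f i) = (X ^ i * inverse (Gamma (lam + real i + 1)) / fact i) * (pochhammer (lam + real i + 1) n * Gamma (lam + real i + 1) / (t ^ i / t powr (- (lam + real n + 1))))"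
      have "lam + real i + 1 > 0" using lam by linarith
      then have g: "Gamma (lam + real i + 1) \<noteq> 0" using Gamma_real_pos[of "lam + real i + 1"] by linarith
      have "X ^ i * inverse g / fact i * (p * g / (t ^ i / w)) = w * ((X / t) ^ i / fact i * p)" if "g \<noteq> 0" for g p w :: real
        using that t by (simp add: power_divide field_simps)
      from this[OF g] show ?thesis unfolding * .
    qed
  qed
  have "(\<lambda>i. integral\<^sup>L lborel (f i)) sums (t powr (- (lam + real n + 1)) * (exp (X / t) * laguerre_sum n lam (X / t)))"
    unfolding fi by (intro sums_mult laguerre_sum_sums)
  then show ?thesis
    using ds(2,3) unfolding has_bochner_integral_iff sf by (simp add: sums_iff)
qed

text \<open>Weber's second exponential integral. Only the second Bessel factor is expanded, so each
  term is a Laguerre integral; the Laguerre sums obtained form the Cauchy product of a Bessel series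
  with an exponential series.\<close>

lemma weber_integral:
  assumes lam: "lam > - 1" and t: "t > 0" and X: "X \<ge> 0" and Y: "Y \<ge> 0"
  shows "has_bochner_integral lborel (\<lambda>v. indicator {0<..} v * (v powr lam * exp (- (t * v)) * (bessel_clifford lam (- (X * v)) * bessel_clifford lam (- (Y * v)))))
     (t powr (- (lam + 1)) * (exp (- ((X + Y) / t)) * bessel_clifford lam (X * Y / t\<^sup>2)))"
proof -
  define f where "f = (\<lambda>i v. (indicator {0<..} v * (v powr lam * exp (- (t * v)) * bessel_clifford lam (- (X * v)))) * ((- (Y * v)) ^ i * rGamma (lam + real i + 1) / fact i))"
  obtain C where C: "C \<ge> 0" "\<And>z. \<bar>bessel_clifford lam z\<bar> \<le> C * exp (2 * sqrt (2 * \<bar>z\<bar>))"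
    using bessel_clifford_exp_bound[OF lam] by blast
  define h where "h = (\<lambda>v. C * C * (indicator {0<..} v * (v powr lam * (exp (- (t * v)) * exp ((2 * sqrt (2 * X) + 2 * sqrt (2 * Y)) * sqrt v)))))"
  have h: "integrable lborel h" unfolding h_def using lam t
    by (intro integrable_mult_right integrable_powr_exp_sqrt) auto
  have fm: "f i \<in> borel_measurable lborel" for i unfolding f_def by measurable
  have ae: "AE v in lborel. summable (\<lambda>i. norm (f i v)) \<and> (\<Sum>i. norm (f i v)) \<le> h v"
  proof (rule AE_I2)
    fix v :: real
    let ?g = "indicator {0<..} v * (v powr lam * exp (- (t * v)) * bessel_clifford lam (- (X * v)))"
    have "(\<lambda>i. norm (f i v)) sums (norm ?g * bessel_clifford lam \<bar>- (Y * v)\<bar>)"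
      unfolding f_def norm_mult[of ?g] by (intro sums_mult bessel_clifford_sums(2) lam)
    moreover have "norm ?g * bessel_clifford lam \<bar>- (Y * v)\<bar> \<le> h v"
    proof (cases "v > 0")
      case True
      have "\<bar>bessel_clifford lam (- (X * v))\<bar> * bessel_clifford lam \<bar>- (Y * v)\<bar> \<le>
         (C * exp (2 * sqrt (2 * \<bar>- (X * v)\<bar>))) * (C * exp (2 * sqrt (2 * \<bar>- (Y * v)\<bar>)))"
        using C(2)[of "- (X * v)"] C(2)[of "\<bar>- (Y * v)\<bar>"] C(1)
        by (intro mult_mono) (auto intro: order_trans[OF abs_ge_zero bessel_clifford_sums(4)[OF lam]])
      also have "\<dots> = C * C * exp ((2 * sqrt (2 * X) + 2 * sqrt (2 * Y)) * sqrt v)"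
        using True X Y by (simp add: abs_mult real_sqrt_mult distrib_right exp_add mult.assoc)
      finally have "(v powr lam * exp (- (t * v))) * (\<bar>bessel_clifford lam (- (X * v))\<bar> * bessel_clifford lam \<bar>- (Y * v)\<bar>)
         \<le> (v powr lam * exp (- (t * v))) * (C * C * exp ((2 * sqrt (2 * X) + 2 * sqrt (2 * Y)) * sqrt v))"
        by (rule mult_left_mono) simp
      then show ?thesis using True by (simp add: h_def abs_mult mult_ac)
    qed (simp add: h_def)
    ultimately show "summable (\<lambda>i. norm (f i v)) \<and> (\<Sum>i. norm (f i v)) \<le> h v" by (simp add: sums_iff)
  qed
  note ds = dominated_sums[OF fm h ae]
  have sf: "(\<Sum>i. f i v) = indicator {0<..} v * (v powr lam * exp (- (t * v)) * (bessel_clifford lam (- (X * v)) * bessel_clifford lam (- (Y * v))))" for v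
  proof -
    have "(\<lambda>i. f i v) sums ((indicator {0<..} v * (v powr lam * exp (- (t * v)) * bessel_clifford lam (- (X * v)))) * bessel_clifford lam (- (Y * v)))"
      unfolding f_def by (intro sums_mult bessel_clifford_sums(3) lam)
    then show ?thesis by (simp add: sums_iff mult_ac)
  qed
  \<comment> \<open>A holds the terms of the Bessel series on the right-hand side and B those of exp
    (- Y / t); the integral of f j is their j-th convolution up to a prefactor.\<close>
  define A where "A = (\<lambda>i. (X * Y / t\<^sup>2) ^ i * rGamma (lam + real i + 1) / fact i)"
  define B where "B = (\<lambda>i. (- (Y / t)) ^ i /\<^sub>R fact i)"
  have fi: "integral\<^sup>L lborel (f j) = (t powr (- (lam + 1)) * exp (- (X / t))) * (\<Sum>i\<le>j. A i * B (j - i))" for j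
  proof -
    have "f j v = ((- Y) ^ j * rGamma (lam + real j + 1) / fact j) * (indicator {0<..} v * (v powr (lam + real j) * exp (- (t * v)) * bessel_clifford lam ((- X) * v)))" for v
    proof (cases "v > 0")
      case True
      have "(- (Y * v)) ^ j = (- Y) ^ j * v ^ j" by (simp flip: power_mult_distrib)
      then show ?thesis using True by (simp add: f_def powr_add powr_realpow)
    qed (simp add: f_def)
    then have "f j = (\<lambda>v. ((- Y) ^ j * rGamma (lam + real j + 1) / fact j) * (indicator {0<..} v * (v powr (lam + real j) * exp (- (t * v)) * bessel_clifford lam ((- X) * v))))" by (rule ext)
    then have "integral\<^sup>L lborel (f j) = ((- Y) ^ j * rGamma (lam + real j + 1) / fact j) * (t powr (- (lam + real j + 1)) * (exp ((- X) / t) * laguerre_sum j lam ((- X) / t)))"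
      using laguerre_integral[OF lam t, of j "- X"] by (simp only: integral_mult_right_zero has_bochner_integral_iff)
    also have "t powr (- (lam + real j + 1)) = t powr (- (lam + 1)) / t ^ j"
    proof -
      have "- (lam + real j + 1) = - (lam + 1) - real j" by simp
      then show ?thesis using t by (simp only: powr_diff powr_realpow)
    qed
    also have "((- Y) ^ j * rGamma (lam + real j + 1) / fact j) * (t powr (- (lam + 1)) / t ^ j * (exp ((- X) / t) * laguerre_sum j lam ((- X) / t)))
      = (t powr (- (lam + 1)) * exp (- (X / t))) * (((- Y / t) ^ j * rGamma (lam + real j + 1) / fact j) * laguerre_sum j lam (- (X / t)))"
      by (simp only: power_divide times_divide_eq_right times_divide_eq_left divide_divide_eq_left mult_ac minus_divide_left)
    also have "((- Y / t) ^ j * rGamma (lam + real j + 1) / fact j) * laguerre_sum j lam (- (X / t)) = (\<Sum>i\<le>j. A i * B (j - i))"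
      unfolding laguerre_sum_def sum_distrib_left
    proof (rule sum.cong[OF refl])
      fix i assume "i \<in> {..j}"
      then have i: "i \<le> j" by simp
      have b: "real (j choose i) = fact j / (fact i * fact (j - i))" using i by (rule binomial_fact)
      have r: "rGamma (lam + real j + 1) * pochhammer (lam + real i + 1) (j - i) = rGamma (lam + real i + 1)"
        using rGamma_shift[of "lam + real i + 1" "j - i"] i by (simp add: of_nat_diff algebra_simps)
      have "(- Y / t) ^ j = (- (Y / t)) ^ (j - i) * (- (Y / t)) ^ i"
        using i by (simp flip: power_add)
      moreover have "(- (Y / t)) ^ i * (- (X / t)) ^ i = (X * Y / t\<^sup>2) ^ i"
        by (simp add: power2_eq_square mult.commute flip: power_mult_distrib)
      ultimately have PQ: "(- Y / t) ^ j * (- (X / t)) ^ i = (- (Y / t)) ^ (j - i) * (X * Y / t\<^sup>2) ^ i"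
        by (simp only: mult.assoc)
      have "(- Y / t) ^ j * rGamma (lam + real j + 1) / fact j * (real (j choose i) * pochhammer (lam + real i + 1) (j - i) * (- (X / t)) ^ i)
         = ((- (Y / t)) ^ (j - i) * (X * Y / t\<^sup>2) ^ i) * (rGamma (lam + real j + 1) * pochhammer (lam + real i + 1) (j - i)) / (fact i * fact (j - i))"
      proof -
        have "P * c / fact j * (fact j / (fact i * fact (j - i)) * p * Q) = (P * Q) * (c * p) / (fact i * fact (j - i))" for P Q c p :: real
          by (simp add: field_simps)
        then show ?thesis unfolding b by (simp only: PQ)
      qed
      then show "(- Y / t) ^ j * rGamma (lam + real j + 1) / fact j * (real (j choose i) * pochhammer (lam + real i + 1) (j - i) * (- (X / t)) ^ i) = A i * B (j - i)"
        unfolding r A_def B_def by (simp add: field_simps)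
    qed
    finally show ?thesis .
  qed
  have "(\<lambda>j. \<Sum>i\<le>j. A i * B (j - i)) sums ((\<Sum>i. A i) * (\<Sum>i. B i))"
    unfolding A_def B_def
    by (intro Cauchy_product_sums bessel_clifford_sums(1) lam) (rule summable_norm_exp)
  moreover have "(\<Sum>i. A i) = bessel_clifford lam (X * Y / t\<^sup>2)" by (simp add: A_def bessel_clifford_def)
  moreover have "(\<Sum>i. B i) = exp (- (Y / t))" unfolding B_def by (simp add: exp_def)
  ultimately have "(\<lambda>j. integral\<^sup>L lborel (f j)) sums ((t powr (- (lam + 1)) * exp (- (X / t))) * (bessel_clifford lam (X * Y / t\<^sup>2) * exp (- (Y / t))))"
    unfolding fi by (intro sums_mult) simp
  also have "(t powr (- (lam + 1)) * exp (- (X / t))) * (bessel_clifford lam (X * Y / t\<^sup>2) * exp (- (Y / t))) =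
     t powr (- (lam + 1)) * (exp (- ((X + Y) / t)) * bessel_clifford lam (X * Y / t\<^sup>2))"
    by (simp add: add_divide_distrib exp_add exp_diff exp_minus field_simps)
  finally show ?thesis
    using ds(2,3) unfolding has_bochner_integral_iff sf by (simp add: sums_iff)
qed

text \<open>A substitute for Stirling's formula: \<open>y powr \<beta> * exp (- y)\<close> is the
  integral of \<open>y powr \<beta> * exp (- u)\<close> over u > y, where y powr \<beta> <= u powr
  \<beta>.\<close>

lemma powr_le_Gamma_exp:
  fixes \<beta> y :: real
  assumes b: "\<beta> > 0" and y: "y \<ge> 0"
  shows "y powr \<beta> \<le> Gamma (\<beta> + 1) * exp y"
proof -
  define f where "f = (\<lambda>u. indicator {0<..} u * (u powr (\<beta> + 1 - 1) * exp (- (1 * u))) :: real)"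
  have f: "has_bochner_integral lborel f (Gamma (\<beta> + 1))"
    unfolding f_def using has_bochner_integral_Gamma[of "\<beta> + 1" 1] b by simp
  have f': "has_bochner_integral lborel (\<lambda>v. f (y + 1 * v)) (Gamma (\<beta> + 1))"
    using lborel_has_bochner_integral_real_affine_iff[of 1 f "Gamma (\<beta> + 1)" y] f by simp
  have g: "has_bochner_integral lborel (\<lambda>v. (y powr \<beta> * exp (- y)) * (indicator {0<..} v * (v powr (1 - 1) * exp (- (1 * v))))) ((y powr \<beta> * exp (- y)) * (Gamma 1 / 1 powr 1))"
    by (intro has_bochner_integral_mult_right has_bochner_integral_Gamma) auto
  have "(y powr \<beta> * exp (- y)) * (Gamma 1 / 1 powr 1) \<le> Gamma (\<beta> + 1)"
  proof -
    let ?G = "\<lambda>v. (y powr \<beta> * exp (- y)) * (indicator {0<..} v * (v powr (1 - 1) * exp (- (1 * v))))"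
    have "integral\<^sup>L lborel ?G \<le> (LINT v|lborel. f (y + 1 * v))"
    proof (rule integral_mono)
      show "integrable lborel ?G" using g by (rule integrable.intros)
      show "integrable lborel (\<lambda>v. f (y + 1 * v))" using f' by (rule integrable.intros)
      fix v :: real
      show "(y powr \<beta> * exp (- y)) * (indicator {0<..} v * (v powr (1 - 1) * exp (- (1 * v)))) \<le> f (y + 1 * v)"
      proof (cases "v > 0")
        case True
        have "y powr \<beta> \<le> (y + v) powr \<beta>" using True y b by (intro powr_mono2) auto
        then have "y powr \<beta> * exp (- (y + v)) \<le> (y + v) powr \<beta> * exp (- (y + v))" by (rule mult_right_mono) simp
        then show ?thesis using True y by (simp add: f_def exp_add exp_diff exp_minus field_simps)
      qed (use y in \<open>simp add: f_def\<close>)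
    qed
    then show ?thesis
      by (simp only: has_bochner_integral_integral_eq[OF g] has_bochner_integral_integral_eq[OF f'])
  qed
  then show ?thesis by (simp add: exp_minus field_simps)
qed

text \<open>A geometric factor A^k, however large, is beaten by 1 / Gamma (lam + 1), as lam grows
  linearly in k. The left-hand prefactor is written as (1/4)^k times y powr (2k/a) with y a multiple
  of rho powr (a/2); 1/Gamma absorbs this power at the cost of exp y.\<close>

lemma bessel_series_bound:
  fixes a A \<nu> :: real
  assumes a: "a > 0" and A: "A > 0" and nu: "\<nu> / a > - 1"
  obtains C D where "C \<ge> 0" "D \<ge> 0"
    "\<And>k \<rho>. \<rho> \<ge> 0 \<Longrightarrow> A ^ k * (a powr (- 2 * real k / a) * \<rho> ^ k * bessel_clifford ((2 * real k + \<nu>) / a) (\<rho> powr a / a\<^sup>2))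
        \<le> C * (1 / 2) ^ k * exp (D * \<rho> powr (a / 2))"
proof
  define l0 where "l0 = \<nu> / a"
  define \<delta> where "\<delta> = min 1 (l0 + 1)"
  \<comment> \<open>Chosen so that \<open>D1 powr (2 * real k / a)\<close> is (4 A)^k. Of the 4^k
    gained, one 2^k pays for the growth of lam + 1 and the other becomes the decay (1/2)^k.\<close>
  define D1 where "D1 = (4 * A) powr (a / 2)"
  define D where "D = (D1 + 2 * sqrt 2) / a"
  define C where "C = (l0 + 1 + 2 / a) * exp 1 / \<delta>"
  have d: "0 < \<delta>" "\<delta> \<le> 1" "\<delta> \<le> l0 + 1" using nu by (auto simp: \<delta>_def l0_def)
  have l0: "l0 + 1 > 0" using nu by (simp add: l0_def)
  have D1: "D1 \<ge> 0" by (simp add: D1_def)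
  show "C \<ge> 0" using d l0 a by (auto simp: C_def intro!: divide_nonneg_pos mult_nonneg_nonneg add_nonneg_nonneg)
  show "D \<ge> 0" using D1 a by (simp add: D_def)
  fix k :: nat and \<rho> :: real assume r: "\<rho> \<ge> 0"
  define lam where "lam = (2 * real k + \<nu>) / a"
  have lam: "lam = l0 + 2 * real k / a" by (simp add: lam_def l0_def add_divide_distrib)
  have lam1: "lam + 1 > 0" 
  proof -
    have "2 * real k / a \<ge> 0" using a by simp
    then show ?thesis using l0 unfolding lam by linarith
  qed
  have lk: "lam \<ge> l0" using a by (simp add: lam)
  define z where "z = \<rho> powr (a / 2) / a"
  have z: "z \<ge> 0" using a by (simp add: z_def)
  have zq: "\<rho> powr a / a\<^sup>2 = z\<^sup>2"
    by (simp add: z_def power_divide power2_eq_square [of "_ powr _"] flip: powr_add)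
  define y where "y = D1 * z"
  have y: "y \<ge> 0" using D1 z by (simp add: y_def)
  have bc: "bessel_clifford lam (z\<^sup>2) \<le> rGamma (lam + 1) / \<delta> * exp (2 * sqrt 2 * z)"
    using bessel_clifford_bound(3)[of \<delta> lam "z\<^sup>2"] d lk z by (simp add: real_sqrt_mult mult.assoc)
  \<comment> \<open>The maximum with 1 permits raising the exponent from 2k/a to lam + 1, which is
    the one that 1/Gamma controls.\<close>
  have u: "A ^ k * (a powr (- 2 * real k / a) * \<rho> ^ k) \<le> (1 / 4) ^ k * max 1 y powr (lam + 1)"
  proof (cases "\<rho> = 0")
    case True
    then show ?thesis
    proof (cases "k = 0")
      case k: True
      have "1 powr (lam + 1) \<le> max 1 y powr (lam + 1)" using lam1 by (intro powr_mono2) auto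
      then show ?thesis using k a by simp
    next
      case k: False
      then have "\<rho> ^ k = 0" using True by simp
      then show ?thesis by (simp only: mult_zero_right) simp
    qed
  next
    case False
    then have r0: "\<rho> > 0" using r by simp
    have "y powr (2 * real k / a) = (4 * A) ^ k * (\<rho> ^ k * a powr (- 2 * real k / a))"
    proof -
      have "y powr (2 * real k / a) = D1 powr (2 * real k / a) * ((\<rho> powr (a / 2)) powr (2 * real k / a) / a powr (2 * real k / a))"
      proof -
        have "(D1 * (w / a)) powr b = D1 powr b * (w powr b / a powr b)" if "w \<ge> 0" for w b
          using that a D1 by (simp add: powr_mult powr_divide)
        then show ?thesis unfolding y_def z_def by simp
      qed
      also have "D1 powr (2 * real k / a) = (4 * A) ^ k" using a A by (simp add: D1_def powr_powr powr_realpow)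
      also have "(\<rho> powr (a / 2)) powr (2 * real k / a) = \<rho> ^ k" using a r0 by (simp add: powr_powr powr_realpow)
      also have "\<rho> ^ k / a powr (2 * real k / a) = \<rho> ^ k * a powr (- 2 * real k / a)"
        by (simp add: powr_minus divide_inverse)
      finally show ?thesis .
    qed
    then have "A ^ k * (a powr (- 2 * real k / a) * \<rho> ^ k) = (1 / 4) ^ k * y powr (2 * real k / a)"
      by (simp add: power_mult_distrib field_simps)
    also have "\<dots> \<le> (1 / 4) ^ k * max 1 y powr (lam + 1)"
    proof (rule mult_left_mono)
      have "y powr (2 * real k / a) \<le> max 1 y powr (2 * real k / a)" using y a by (intro powr_mono2) auto
      also have "\<dots> \<le> max 1 y powr (lam + 1)" using l0 by (intro powr_mono) (auto simp: lam)
      finally show "y powr (2 * real k / a) \<le> max 1 y powr (lam + 1)" .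
    qed simp
    finally show ?thesis .
  qed
  \<comment> \<open>\<open>powr_le_Gamma_exp\<close> yields 1 / Gamma (lam + 2). Going back to lam +
    1 costs the factor lam + 1, which is bounded in \<open>lk2\<close>.\<close>
  have G: "max 1 y powr (lam + 1) * rGamma (lam + 1) \<le> (lam + 1) * exp (1 + y)"
  proof -
    have Gp: "Gamma (lam + 1 + 1) > 0" using lam1 by (intro Gamma_real_pos) auto
    have "max 1 y powr (lam + 1) * rGamma (lam + 1 + 1) \<le> exp (max 1 y)"
      using powr_le_Gamma_exp[OF lam1, of "max 1 y"] Gp by (simp add: rGamma_inverse_Gamma field_simps)
    also have "\<dots> \<le> exp (1 + y)" using y by simp
    finally have "(lam + 1) * (max 1 y powr (lam + 1) * rGamma (lam + 1 + 1)) \<le> (lam + 1) * exp (1 + y)"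
      using lam1 by (intro mult_left_mono) auto
    then show ?thesis unfolding rGamma_plus1[of "lam + 1", symmetric]
      by (simp only: mult.assoc mult.left_commute mult.commute)
  qed
  have lk2: "lam + 1 \<le> (l0 + 1 + 2 / a) * 2 ^ k"
  proof -
    have k1: "real k \<le> 2 ^ k" using of_nat_less_two_power[of k, where 'a = real] by linarith
    have "lam + 1 = (l0 + 1) * 1 + 2 / a * real k" by (simp add: lam)
    also have "\<dots> \<le> (l0 + 1) * 2 ^ k + 2 / a * 2 ^ k"
      using l0 a k1 by (intro add_mono mult_left_mono) auto
    finally show ?thesis by (simp add: distrib_right)
  qed
  have "A ^ k * (a powr (- 2 * real k / a) * \<rho> ^ k * bessel_clifford lam (\<rho> powr a / a\<^sup>2))
     = (A ^ k * (a powr (- 2 * real k / a) * \<rho> ^ k)) * bessel_clifford lam (z\<^sup>2)" by (simp add: zq)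
  also have "\<dots> \<le> ((1 / 4) ^ k * max 1 y powr (lam + 1)) * (rGamma (lam + 1) / \<delta> * exp (2 * sqrt 2 * z))"
    using A r d lk by (intro mult_mono u bc bessel_clifford_bound(2)[of \<delta>]) auto
  also have "\<dots> = (1 / 4) ^ k * (max 1 y powr (lam + 1) * rGamma (lam + 1)) * (exp (2 * sqrt 2 * z) / \<delta>)" by simp
  also have "\<dots> \<le> (1 / 4) ^ k * (((l0 + 1 + 2 / a) * 2 ^ k) * exp (1 + y)) * (exp (2 * sqrt 2 * z) / \<delta>)"
    using d by (intro mult_right_mono mult_left_mono order_trans[OF G] lk2) auto
  also have "\<dots> = ((1 / 4) ^ k * 2 ^ k) * C * (exp y * exp (2 * sqrt 2 * z))"
    by (simp add: C_def exp_add)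
  also have "(1 / 4 :: real) ^ k * 2 ^ k = (1 / 2) ^ k" by (simp flip: power_mult_distrib)
  also have "exp y * exp (2 * sqrt 2 * z) = exp (D * \<rho> powr (a / 2))"
    using a by (simp add: D_def y_def z_def field_simps flip: exp_add)
  finally show "A ^ k * (a powr (- 2 * real k / a) * \<rho> ^ k * bessel_clifford ((2 * real k + \<nu>) / a) (\<rho> powr a / a\<^sup>2))
        \<le> C * (1 / 2) ^ k * exp (D * \<rho> powr (a / 2))"
    by (simp add: lam_def mult_ac)
qed

section \<open>Expansion of the deformed kernel\<close>

text \<open>The index b (k + nu) of the kernel for b = 2/a and nu = (N - 2)/2. At k = 0 it is also
  the exponent of v in polar coordinates, and at k = l the parameter lambda of the theorem.\<close>

definition bessel_index :: "'n::finite itself \<Rightarrow> real \<Rightarrow> nat \<Rightarrow> real" where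
  "bessel_index _ a k = (2 * real k + (real CARD('n) - 2)) / a"

text \<open>The hypothesis a > 2 - N enters here: it keeps the Gamma arguments positive and the
  powers of v integrable at 0, in dimension 1 as well.\<close>

lemma bessel_index_gt:
  assumes "a > max 0 (2 - real CARD('n::finite))"
  shows "bessel_index TYPE('n) a k > - 1"
proof -
  have a: "a > 0" and "2 * real k + (real CARD('n) - 2) > - a" using assms by auto
  then have "(2 * real k + (real CARD('n) - 2)) / a > - a / a" by (intro divide_strict_right_mono)
  then show ?thesis using a by (simp add: bessel_index_def)
qed

lemma bessel_index_shift: "bessel_index T a k = bessel_index T a 0 + 2 * real k / a"
  by (simp add: bessel_index_def add_divide_distrib diff_divide_distrib)

text \<open>With \<open>w = 2(|x||\<xi>|)\<^bsup>a/2\<^esup>/(ai)\<close> this is the constant in \<open>(w/2)\<^bsup>2k/a\<^esup> = kernel_phase a k (|x||\<xi>|)\<^sup>k\<close>.\<close>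

definition kernel_phase :: "real \<Rightarrow> nat \<Rightarrow> complex" where
  "kernel_phase a k = of_real (a powr (- 2 * real k / a)) * cis (- (pi * real k / a))"

text \<open>The unimodular phases cancel, so the series of the heat kernel has real terms.\<close>

lemma cnj_kernel_phase: "cnj (kernel_phase a k) * kernel_phase a k = of_real ((a powr (- 2 * real k / a))\<^sup>2)"
  by (simp add: kernel_phase_def cis_cnj cis_mult power2_eq_square)

lemma norm_kernel_phase: "norm (kernel_phase a k) = a powr (- 2 * real k / a)"
  by (simp add: kernel_phase_def norm_mult)

text \<open>A positive factor does not change the branch, and the principal logarithm has imaginary
  part - pi/2 at - i.\<close>

lemma powr_minus_ii:
  assumes "z > 0"
  shows "(of_real z * (- \<i>)) powr of_real c = of_real (z powr c) * cis (- (pi * c / 2))"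
proof -
  have "Ln (of_real z * (- \<i>)) = of_real (ln z) + Ln (- \<i>)"
    using assms by (subst Ln_times_of_real) (auto simp: Ln_of_real)
  then have "(of_real z * (- \<i>)) powr of_real c = exp (of_real c * (of_real (ln z) + - (\<i> * pi / 2)))"
    using assms by (simp add: powr_def Ln_minus_ii)
  also have "\<dots> = exp (of_real (c * ln z)) * exp (\<i> * of_real (- (pi * c / 2)))"
    by (simp add: exp_add [symmetric] algebra_simps)
  also have "\<dots> = of_real (z powr c) * cis (- (pi * c / 2))"
    using assms by (simp add: powr_def cis_conv_exp exp_of_real [symmetric])
  finally show ?thesis .
qed

text \<open>As w / 2 is - i times a nonnegative number, its square is real, hence so is the Bessel
  factor; the only complex part is the phase of (w/2)^(2k/a). The modulus of that power supplies the
  (|x| |\<xi>|)^k that \<open>zonal_sgn\<close> needs.\<close>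

lemma deformed_kernel_expansion:
  fixes x \<xi> :: "real^'n"
  assumes a: "a > max 0 (2 - real CARD('n))"
  shows "deformed_kernel a x \<xi> = of_real (Gamma (bessel_index TYPE('n) a 0 + 1)) *
     (\<Sum>k. kernel_phase a k * of_real (zonal k x \<xi> * bessel_clifford (bessel_index TYPE('n) a k) (- ((norm x * norm \<xi>) powr a / a\<^sup>2))))"
proof -
  have a0: "a > 0" using a by simp
  define \<rho> where "\<rho> = norm x * norm \<xi>"
  have r: "\<rho> \<ge> 0" by (simp add: \<rho>_def)
  define w where "w = 2 * of_real (\<rho> powr (a / 2)) / (of_real a * \<i>)"
  have w2: "w / 2 = of_real (\<rho> powr (a / 2) / a) * (- \<i>)" using a0 by (simp add: w_def field_simps)
  have sq: "(w / 2)\<^sup>2 = of_real (- (\<rho> powr a / a\<^sup>2))"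
  proof -
    have "(\<rho> powr (a / 2) / a)\<^sup>2 = \<rho> powr a / a\<^sup>2"
      by (simp add: power_divide power2_eq_square [of "_ powr _"] flip: powr_add)
    then have "(complex_of_real (\<rho> powr (a / 2) / a))\<^sup>2 = of_real (\<rho> powr a / a\<^sup>2)" by (simp only: of_real_power [symmetric])
    then show ?thesis unfolding w2 power_mult_distrib by simp
  qed
  have bes: "normalized_bessel_I (2 / a * (real k + (real CARD('n) - 2) / 2)) w = of_real (bessel_clifford (bessel_index TYPE('n) a k) (- (\<rho> powr a / a\<^sup>2)))" for k
  proof -
    have i: "2 / a * (real k + (real CARD('n) - 2) / 2) = bessel_index TYPE('n) a k"
      by (simp add: bessel_index_def add_divide_distrib diff_divide_distrib distrib_left right_diff_distrib)
    have "(\<lambda>j. of_real ((- (\<rho> powr a / a\<^sup>2)) ^ j * rGamma (bessel_index TYPE('n) a k + real j + 1) / fact j)) sums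
       complex_of_real (bessel_clifford (bessel_index TYPE('n) a k) (- (\<rho> powr a / a\<^sup>2)))"
      by (intro sums_of_real bessel_clifford_sums(3) bessel_index_gt a)
    moreover have "of_real ((- (\<rho> powr a / a\<^sup>2)) ^ j * rGamma (bessel_index TYPE('n) a k + real j + 1) / fact j) =
      (w / 2) ^ (2 * j) * of_real (rGamma (bessel_index TYPE('n) a k + real j + 1)) / fact j" for j
      unfolding power_mult sq by simp
    ultimately have "(\<lambda>j. (w / 2) ^ (2 * j) * of_real (rGamma (bessel_index TYPE('n) a k + real j + 1)) / fact j) sums
       complex_of_real (bessel_clifford (bessel_index TYPE('n) a k) (- (\<rho> powr a / a\<^sup>2)))"
      by (simp only:)
    then show ?thesis unfolding normalized_bessel_I_def i by (rule sums_unique [symmetric])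
  qed
  have summand: "(if k = 0 then 1 else (w / 2) powr of_real (2 / a * real k)) *
      normalized_bessel_I (2 / a * (real k + (real CARD('n) - 2) / 2)) w *
      of_real (normalized_gegenbauer ((real CARD('n) - 2) / 2) k (sgn x \<bullet> sgn \<xi>)) =
     kernel_phase a k * of_real (zonal k x \<xi> * bessel_clifford (bessel_index TYPE('n) a k) (- (\<rho> powr a / a\<^sup>2)))" for k
  proof -
    have "(if k = 0 then 1 else (w / 2) powr of_real (2 / a * real k)) = kernel_phase a k * of_real (\<rho> ^ k)"
    proof (cases "k = 0")
      case True
      then show ?thesis using a0 by (simp add: kernel_phase_def)
    next
      case k: False
      show ?thesis
      proof (cases "\<rho> = 0")
        case True
        \<comment> \<open>Here k > 0, so \<open>0 powr _ = 0\<close> agrees with the vanishing power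
          of rho.\<close>
        then show ?thesis using k a0 by (simp add: w2)
      next
        case False
        then have r0: "\<rho> > 0" using r by simp
        have z: "\<rho> powr (a / 2) / a > 0" using r0 a0 by simp
        have "(\<rho> powr (a / 2) / a) powr (2 / a * real k) = (\<rho> powr (a / 2)) powr (2 / a * real k) / a powr (2 / a * real k)"
          using a0 by (simp add: powr_divide)
        also have "(\<rho> powr (a / 2)) powr (2 / a * real k) = \<rho> ^ k" using a0 r0 by (simp add: powr_powr powr_realpow)
        also have "a powr (2 / a * real k) = inverse (a powr (- 2 * real k / a))" by (simp add: powr_minus)
        finally have e: "(\<rho> powr (a / 2) / a) powr (2 / a * real k) = \<rho> ^ k * a powr (- 2 * real k / a)"
          by (simp only: divide_inverse inverse_inverse_eq)
        have e2: "pi * (2 / a * real k) / 2 = pi * real k / a" by simp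
        show ?thesis unfolding w2 powr_minus_ii[OF z] e e2 using k by (simp add: kernel_phase_def)
      qed
    qed
    then show ?thesis
      unfolding bes zonal_sgn[of x \<xi> k, symmetric] \<rho>_def [symmetric] of_real_mult by (simp only: mult_ac)
  qed
  have i0: "2 / a * ((real CARD('n) - 2) / 2) + 1 = bessel_index TYPE('n) a 0 + 1"
    by (simp add: bessel_index_def diff_divide_distrib right_diff_distrib)
  show ?thesis
    unfolding deformed_kernel_def \<rho>_def [symmetric] w_def [symmetric] deformed_I_def summand i0 ..
qed

lemma zonal_measurable [measurable]: "zonal k x \<in> borel_measurable borel"
  unfolding zonal_def[abs_def] by measurable

lemma deformed_kernel_measurable:
  fixes x :: "real^'n"
  assumes a: "a > max 0 (2 - real CARD('n))"
  shows "deformed_kernel a x \<in> borel_measurable borel"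
  unfolding deformed_kernel_expansion[OF a, abs_def] by measurable

text \<open>Two estimates with common constants. The first has a free scale c: 1 for the kernel
  itself, r on the sphere of radius r, and t powr (- 2/a) for the heat kernel. The second bounds the
  products of Bessel factors that enter Weber's integral.\<close>

lemma zonal_series_bound:
  assumes a: "a > max 0 (2 - real CARD('n))"
  obtains C D where "C \<ge> 0" "D \<ge> 0"
    "\<And>k (x::real^'n) y c z. c \<ge> 0 \<Longrightarrow> \<bar>z\<bar> = (norm x * norm y * c) powr a / a\<^sup>2 \<Longrightarrow>
       a powr (- 2 * real k / a) * (c ^ k * \<bar>zonal k x y\<bar>) * \<bar>bessel_clifford (bessel_index TYPE('n) a k) z\<bar>
         \<le> C * (1 / 2) ^ k * exp (D * (norm x * norm y * c) powr (a / 2))"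
    "\<And>k (x::real^'n) y r. r \<ge> 0 \<Longrightarrow>
       (a powr (- 2 * real k / a) * r ^ k)\<^sup>2 * \<bar>zonal k x y\<bar> *
         (\<bar>bessel_clifford (bessel_index TYPE('n) a k) (- ((norm x * r) powr a / a\<^sup>2))\<bar> * \<bar>bessel_clifford (bessel_index TYPE('n) a k) (- ((norm y * r) powr a / a\<^sup>2))\<bar>)
         \<le> C * (1 / 2) ^ k * exp (D * ((norm x * r) powr (a / 2) + (norm y * r) powr (a / 2)))"
proof -
  define s where "s = real CARD('n) / 2"
  define A where "A = 16 * (s + 1)"
  have s: "s > 0" by (simp add: s_def)
  have A1: "A \<ge> 1" using s by (simp add: A_def)
  have a0: "a > 0" and A0: "A > 0" using a A1 by auto
  have nu: "(real CARD('n) - 2) / a > - 1" using bessel_index_gt[OF a, of 0] by (simp add: bessel_index_def)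
  obtain C D where C: "C \<ge> 0" and D: "D \<ge> 0"
    and b: "\<And>k \<rho>. \<rho> \<ge> 0 \<Longrightarrow> A ^ k * (a powr (- 2 * real k / a) * \<rho> ^ k * bessel_clifford (bessel_index TYPE('n) a k) (\<rho> powr a / a\<^sup>2))
        \<le> C * (1 / 2) ^ k * exp (D * \<rho> powr (a / 2))"
    using bessel_series_bound[OF a0 A0 nu] unfolding bessel_index_def by blast
  have bc: "\<bar>bessel_clifford (bessel_index TYPE('n) a k) z\<bar> \<le> bessel_clifford (bessel_index TYPE('n) a k) \<bar>z\<bar>" for k z
    by (rule bessel_clifford_sums(4)[OF bessel_index_gt[OF a]])
  show ?thesis
  proof (rule that[of "(s + 1) * (C + C\<^sup>2)" D])
    show "(s + 1) * (C + C\<^sup>2) \<ge> 0" "D \<ge> 0" using s C D by auto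
    fix k :: nat and x y :: "real^'n"
    let ?bc = "bessel_clifford (bessel_index TYPE('n) a k)"
    have zb: "\<bar>zonal k x y\<bar> \<le> (s + 1) * A ^ k * (norm x * norm y) ^ k" unfolding s_def A_def by (rule zonal_bound)
    show "a powr (- 2 * real k / a) * (c ^ k * \<bar>zonal k x y\<bar>) * \<bar>?bc z\<bar>
         \<le> (s + 1) * (C + C\<^sup>2) * (1 / 2) ^ k * exp (D * (norm x * norm y * c) powr (a / 2))"
      if c: "c \<ge> 0" and z: "\<bar>z\<bar> = (norm x * norm y * c) powr a / a\<^sup>2" for c z
    proof -
      define \<rho> where "\<rho> = norm x * norm y * c"
      have r: "\<rho> \<ge> 0" using c by (simp add: \<rho>_def)
      have "a powr (- 2 * real k / a) * (c ^ k * \<bar>zonal k x y\<bar>) * \<bar>?bc z\<bar>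
         \<le> a powr (- 2 * real k / a) * (c ^ k * ((s + 1) * A ^ k * (norm x * norm y) ^ k)) * ?bc \<bar>z\<bar>"
        using c s A1 by (intro mult_mono mult_left_mono zb bc) auto
      also have "\<dots> = (s + 1) * (A ^ k * (a powr (- 2 * real k / a) * \<rho> ^ k * ?bc (\<rho> powr a / a\<^sup>2)))"
        by (simp add: z \<rho>_def power_mult_distrib mult_ac)
      also have "\<dots> \<le> (s + 1) * (C * (1 / 2) ^ k * exp (D * \<rho> powr (a / 2)))"
        using s by (intro mult_left_mono b r) auto
      also have "\<dots> \<le> (s + 1) * ((C + C\<^sup>2) * (1 / 2) ^ k * exp (D * \<rho> powr (a / 2)))"
        using s C by (intro mult_left_mono mult_right_mono) auto
      finally show ?thesis by (simp add: \<rho>_def mult.assoc)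
    qed
    show "(a powr (- 2 * real k / a) * r ^ k)\<^sup>2 * \<bar>zonal k x y\<bar> * (\<bar>?bc (- ((norm x * r) powr a / a\<^sup>2))\<bar> * \<bar>?bc (- ((norm y * r) powr a / a\<^sup>2))\<bar>)
         \<le> (s + 1) * (C + C\<^sup>2) * (1 / 2) ^ k * exp (D * ((norm x * r) powr (a / 2) + (norm y * r) powr (a / 2)))"
      if r: "r \<ge> 0" for r
    proof -
      define P where "P = (\<lambda>u. A ^ k * (a powr (- 2 * real k / a) * (u * r) ^ k * ?bc ((u * r) powr a / a\<^sup>2)))"
      have bcn: "\<bar>?bc (- (u powr a / a\<^sup>2))\<bar> \<le> ?bc (u powr a / a\<^sup>2)" "0 \<le> ?bc (u powr a / a\<^sup>2)" for u
        using bc[of k "- (u powr a / a\<^sup>2)"] by auto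
      have Pn: "P u \<ge> 0" if "u \<ge> 0" for u
        unfolding P_def using that r A1 by (intro mult_nonneg_nonneg bcn zero_le_power) auto
      \<comment> \<open>The zonal bound brings one A^k, whereas each of the two Bessel estimates
        consumes one; the second is inserted here.\<close>
      have "(1::real) \<le> A ^ k" using A1 by (rule one_le_power)
      then have "(a powr (- 2 * real k / a) * r ^ k)\<^sup>2 * \<bar>zonal k x y\<bar> * (\<bar>?bc (- ((norm x * r) powr a / a\<^sup>2))\<bar> * \<bar>?bc (- ((norm y * r) powr a / a\<^sup>2))\<bar>)
        \<le> (a powr (- 2 * real k / a) * r ^ k)\<^sup>2 * (((s + 1) * A ^ k * (norm x * norm y) ^ k) * A ^ k) * (?bc ((norm x * r) powr a / a\<^sup>2) * ?bc ((norm y * r) powr a / a\<^sup>2))"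
        using s A1 mult_mono[OF zb \<open>1 \<le> A ^ k\<close>] by (intro mult_mono bcn mult_nonneg_nonneg) auto
      also have "\<dots> = (s + 1) * (P (norm x) * P (norm y))"
        by (simp add: P_def power_mult_distrib power2_eq_square mult_ac)
      also have "\<dots> \<le> (s + 1) * ((C * (1 / 2) ^ k * exp (D * (norm x * r) powr (a / 2))) * (C * (1 / 2) ^ k * exp (D * (norm y * r) powr (a / 2))))"
      proof (intro mult_left_mono mult_mono)
        show "P (norm x) \<le> C * (1 / 2) ^ k * exp (D * (norm x * r) powr (a / 2))"
          "P (norm y) \<le> C * (1 / 2) ^ k * exp (D * (norm y * r) powr (a / 2))"
          unfolding P_def using r by (intro b; simp)+
      qed (use s C Pn in auto)
      also have "\<dots> = (s + 1) * (C\<^sup>2 * ((1 / 2) ^ k * (1 / 2) ^ k) * exp (D * ((norm x * r) powr (a / 2) + (norm y * r) powr (a / 2))))"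
        by (simp add: power2_eq_square distrib_left exp_add mult_ac)
      also have "\<dots> \<le> (s + 1) * ((C + C\<^sup>2) * ((1 / 2) ^ k * 1) * exp (D * ((norm x * r) powr (a / 2) + (norm y * r) powr (a / 2))))"
        using s C by (intro mult_left_mono mult_right_mono mult_mono) (auto simp: power_le_one)
      finally show ?thesis by (simp add: mult.assoc)
    qed
  qed
qed

section \<open>Integration of zonal series over the sphere\<close>

lemma sphere_zonal_series:
  fixes H :: "real^'n \<Rightarrow> complex"
  assumes [measurable]: "H \<in> borel_measurable borel"
    and H: "\<And>\<eta>. norm \<eta> = 1 \<Longrightarrow> norm (H \<eta>) \<le> B"
    and f: "\<And>k \<eta>. norm \<eta> = 1 \<Longrightarrow> norm (f k * of_real (zonal k x \<eta>)) \<le> M * (1 / 2) ^ k"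
  shows "(\<lambda>k. f k * (LINT \<eta>|sphere_measure. of_real (zonal k x \<eta>) * H \<eta>)) sums
     (LINT \<eta>|sphere_measure. (\<Sum>k. f k * of_real (zonal k x \<eta>)) * H \<eta>)"
proof -
  define g where "g = (\<lambda>k \<eta>. f k * (of_real (zonal k x \<eta>) * H \<eta>))"
  have geo: "(\<lambda>k. M * (1 / 2) ^ k) sums (M * 2)"
    using sums_mult[OF geometric_sums[of "1 / 2 :: real"], of M] by simp
  have "(\<lambda>k. integral\<^sup>L sphere_measure (g k)) sums (LINT \<eta>|sphere_measure. (\<Sum>k. g k \<eta>))"
  proof (rule dominated_sums(3))
    show "g k \<in> borel_measurable sphere_measure" for k unfolding g_def by measurable
    show "integrable (sphere_measure :: (real^'n) measure) (\<lambda>_. M * 2 * B)" by simp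
    show "AE \<eta> in sphere_measure. summable (\<lambda>k. norm (g k \<eta>)) \<and> (\<Sum>k. norm (g k \<eta>)) \<le> M * 2 * B"
      using AE_sphere_measure
    proof eventually_elim
      case (elim \<eta>)
      have le: "norm (g k \<eta>) \<le> M * (1 / 2) ^ k * B" for k
      proof -
        have "norm (g k \<eta>) = norm (f k * of_real (zonal k x \<eta>)) * norm (H \<eta>)" by (simp add: g_def norm_mult)
        also have "\<dots> \<le> M * (1 / 2) ^ k * B"
          using f[OF elim, of k] H[OF elim] order_trans[OF norm_ge_zero f[OF elim, of k]] by (intro mult_mono) auto
        finally show ?thesis .
      qed
      have s: "(\<lambda>k. M * (1 / 2) ^ k * B) sums (M * 2 * B)" using geo by (rule sums_mult2)
      have sm: "summable (\<lambda>k. norm (g k \<eta>))"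
        by (rule summable_comparison_test'[OF sums_summable[OF s], of 0]) (simp add: le)
      with suminf_le[OF le sm sums_summable[OF s]] s show ?case by (simp add: sums_iff)
    qed
  qed
  moreover have "(LINT \<eta>|sphere_measure. (\<Sum>k. g k \<eta>)) = (LINT \<eta>|sphere_measure. (\<Sum>k. f k * of_real (zonal k x \<eta>)) * H \<eta>)"
  proof (rule integral_cong_AE)
    show "AE \<eta> in sphere_measure. (\<Sum>k. g k \<eta>) = (\<Sum>k. f k * of_real (zonal k x \<eta>)) * H \<eta>"
      using AE_sphere_measure
    proof eventually_elim
      case (elim \<eta>)
      have "summable (\<lambda>k. f k * of_real (zonal k x \<eta>))"
        by (rule summable_comparison_test'[OF sums_summable[OF geo], of 0]) (simp add: f[OF elim])
      then show ?case unfolding g_def by (simp add: suminf_mult2 mult.assoc)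
    qed
  qed (simp_all add: g_def)
  moreover have "integral\<^sup>L sphere_measure (g k) = f k * (LINT \<eta>|sphere_measure. of_real (zonal k x \<eta>) * H \<eta>)" for k
    unfolding g_def by (rule integral_mult_right_zero)
  ultimately show ?thesis by simp
qed

lemma norm_suminf_geometric:
  fixes f :: "nat \<Rightarrow> complex"
  assumes "\<And>k. norm (f k) \<le> M * (1 / 2) ^ k"
  shows "summable (\<lambda>k. norm (f k))" "(\<Sum>k. norm (f k)) \<le> M * 2" "norm (\<Sum>k. f k) \<le> M * 2"
proof -
  have geo: "(\<lambda>k. M * (1 / 2) ^ k) sums (M * 2)"
    using sums_mult[OF geometric_sums[of "1 / 2 :: real"], of M] by simp
  show s: "summable (\<lambda>k. norm (f k))"
    by (rule summable_comparison_test'[OF sums_summable[OF geo], of 0]) (simp add: assms)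
  show le: "(\<Sum>k. norm (f k)) \<le> M * 2"
    using suminf_le[OF assms s sums_summable[OF geo]] geo by (simp add: sums_iff)
  show "norm (\<Sum>k. f k) \<le> M * 2" using summable_norm[OF s] le by simp
qed

lemma sphere_harmonic_series:
  fixes p :: "real^'n \<Rightarrow> complex"
  assumes p: "p \<in> harmonic_polynomials l"
    and f: "\<And>k \<eta>. norm \<eta> = 1 \<Longrightarrow> norm (f k * of_real (zonal k x \<eta>)) \<le> M * (1 / 2) ^ k"
  shows "(LINT \<eta>|sphere_measure. (\<Sum>k. f k * of_real (zonal k x \<eta>)) * p \<eta>) =
     of_real (sphere_mass TYPE(real^'n)) * (f l * p x)"
proof -
  have hp: "homogeneous_polynomial l p" using p by (simp add: harmonic_polynomials_def)
  have pm: "p \<in> borel_measurable borel"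
    by (rule borel_measurable_continuous_onI[OF homogeneous_polynomial_continuous[OF hp]])
  obtain C where C: "\<And>x. norm (p x) \<le> C * norm x ^ l"
    using homogeneous_bound[OF homogeneous_polynomial_continuous[OF hp] homogeneous_polynomial_scale[OF hp]] by blast
  have B: "norm (p \<eta>) \<le> C" if "norm \<eta> = 1" for \<eta> using C[of \<eta>] that by simp
  have "(\<lambda>k. f k * (if k = l then of_real (sphere_mass TYPE(real^'n)) * p x else 0)) sums
     (LINT \<eta>|sphere_measure. (\<Sum>k. f k * of_real (zonal k x \<eta>)) * p \<eta>)"
    using sphere_zonal_series[OF pm B f] unfolding zonal_reproducing[OF p] .
  moreover have "(\<lambda>k. f k * (if k = l then of_real (sphere_mass TYPE(real^'n)) * p x else 0)) =
    (\<lambda>k. if k = l then f k * (of_real (sphere_mass TYPE(real^'n)) * p x) else 0)" by auto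
  ultimately show ?thesis
    using sums_single[of l "\<lambda>k. f k * (of_real (sphere_mass TYPE(real^'n)) * p x)"]
    by (simp add: sums_iff mult_ac)
qed

text \<open>Only the series in x is integrated termwise. For each k, the series in y is tested
  against the harmonic polynomial \<open>zonal k x\<close>, which selects the k-th coefficient and
  evaluates that polynomial at y; no double series arises.\<close>

lemma sphere_zonal_product:
  fixes x y :: "real^'n" and f g :: "nat \<Rightarrow> complex"
  assumes f: "\<And>k \<eta>. norm \<eta> = 1 \<Longrightarrow> norm (f k * of_real (zonal k x \<eta>)) \<le> M * (1 / 2) ^ k"
    and g: "\<And>k \<eta>. norm \<eta> = 1 \<Longrightarrow> norm (g k * of_real (zonal k y \<eta>)) \<le> L * (1 / 2) ^ k"
  shows "(\<lambda>k. of_real (sphere_mass TYPE(real^'n)) * (f k * g k * of_real (zonal k x y))) sums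
    (LINT \<eta>|sphere_measure. (\<Sum>k. f k * of_real (zonal k x \<eta>)) * (\<Sum>k. g k * of_real (zonal k y \<eta>)))"
proof -
  have "(\<lambda>k. f k * (LINT \<eta>|sphere_measure. of_real (zonal k x \<eta>) * (\<Sum>k. g k * of_real (zonal k y \<eta>)))) sums
    (LINT \<eta>|sphere_measure. (\<Sum>k. f k * of_real (zonal k x \<eta>)) * (\<Sum>k. g k * of_real (zonal k y \<eta>)))"
  proof (rule sphere_zonal_series[OF _ _ f])
    show "(\<lambda>\<eta>. \<Sum>k. g k * of_real (zonal k y \<eta>)) \<in> borel_measurable borel" by measurable
    show "norm (\<Sum>k. g k * of_real (zonal k y \<eta>)) \<le> L * 2" if "norm \<eta> = 1" for \<eta>
      by (rule norm_suminf_geometric(3)) (rule g[OF that])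
  qed
  moreover have "(LINT \<eta>|sphere_measure. of_real (zonal k x \<eta>) * (\<Sum>k. g k * of_real (zonal k y \<eta>))) =
     of_real (sphere_mass TYPE(real^'n)) * (g k * of_real (zonal k x y))" for k
    using sphere_harmonic_series[OF zonal_harmonic[of k x] g] by (simp add: mult.commute)
  ultimately show ?thesis by (simp add: mult_ac)
qed

section \<open>Expansion of the deformed heat kernel\<close>

lemma polar_integral_vec:
  fixes F :: "real^'n \<Rightarrow> complex" and a :: real
  defines "d \<equiv> bessel_index TYPE('n) a 0"
  assumes a: "a > 0" and F: "F \<in> borel_measurable borel"
    and bound: "\<And>x. x \<noteq> 0 \<Longrightarrow> norm (F x) \<le> g (norm x powr a / a)"
    and g: "integrable lborel (\<lambda>v. indicator {0<..} v * (v powr d * g v))"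
    and J: "\<And>v. v > 0 \<Longrightarrow> (LINT \<eta>|sphere_measure. F ((a * v) powr (1 / a) *\<^sub>R \<eta>)) = J v"
  shows "integrable lborel (\<lambda>x. F x / of_real (norm x powr (2 - a)))"
    and "(LINT x|lborel. F x / of_real (norm x powr (2 - a))) =
      of_real (real CARD('n) * a powr d) * (LINT v|lborel. indicator {0<..} v *\<^sub>R (v powr d *\<^sub>R J v))"
proof -
  have d: "(real DIM(real^'n) - 2) / a = d" by (simp add: d_def bessel_index_def)
  have gd: "integrable lborel (\<lambda>v. indicator {0<..} v * (v powr ((real DIM(real^'n) - 2) / a) * g v))"
    unfolding d by (rule g)
  show "integrable lborel (\<lambda>x. F x / of_real (norm x powr (2 - a)))"
    by (rule polar_integral(1)[OF a F bound gd])
  have "(LINT v|lborel. indicator {0<..} v *\<^sub>R (v powr d *\<^sub>R (LINT \<eta>|sphere_measure. F ((a * v) powr (1 / a) *\<^sub>R \<eta>))))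
     = (LINT v|lborel. indicator {0<..} v *\<^sub>R (v powr d *\<^sub>R J v))"
    by (rule Bochner_Integration.integral_cong) (auto simp: indicator_def J)
  then show "(LINT x|lborel. F x / of_real (norm x powr (2 - a))) =
      of_real (real CARD('n) * a powr d) * (LINT v|lborel. indicator {0<..} v *\<^sub>R (v powr d *\<^sub>R J v))"
    using polar_integral(2)[OF a F bound gd] unfolding d by simp
qed

lemma radius_facts:
  fixes a v :: real
  assumes "a > 0" "v > 0"
  shows "(a * v) powr (1 / a) > 0"
    and "\<rho> \<ge> 0 \<Longrightarrow> (\<rho> * (a * v) powr (1 / a)) powr a = \<rho> powr a * (a * v)"
    and "\<rho> \<ge> 0 \<Longrightarrow> (\<rho> * (a * v) powr (1 / a)) powr (a / 2) = \<rho> powr (a / 2) * (sqrt a * sqrt v)"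
    and "((a * v) powr (1 / a)) ^ k = (a * v) powr (real k / a)"
  using assms
  by (simp_all add: powr_mult powr_powr powr_half_sqrt real_sqrt_mult flip: powr_realpow)

text \<open>The constant c_a in polar coordinates. The mass of the sphere stays symbolic, because
  the integrals to be normalized produce the same factor.\<close>

lemma deformed_const_eq:
  assumes a: "a > max 0 (2 - real CARD('n::finite))"
  shows "deformed_const TYPE('n) a * (real CARD('n) * a powr (bessel_index TYPE('n) a 0) *
     sphere_mass TYPE(real^'n) * Gamma (bessel_index TYPE('n) a 0 + 1)) = 1"
proof -
  have a0: "a > 0" using a by simp
  define d where "d = bessel_index TYPE('n) a 0"
  define S where "S = sphere_mass TYPE(real^'n)"
  have S: "S > 0" unfolding S_def by (rule sphere_measure_pos)
  have d: "d + 1 > 0" using bessel_index_gt[OF a, of 0] by (simp add: d_def)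
  note G = has_bochner_integral_Gamma[OF d, of 1, simplified]
  define F :: "real^'n \<Rightarrow> complex" where "F = (\<lambda>x. of_real (exp (- (1 / a) * norm x powr a)))"
  have J: "(LINT \<eta>|sphere_measure. F ((a * v) powr (1 / a) *\<^sub>R \<eta>)) = of_real (exp (- v) * S)" if v: "v > 0" for v
  proof -
    have "(LINT \<eta>|sphere_measure. F ((a * v) powr (1 / a) *\<^sub>R \<eta>)) = (LINT \<eta>|(sphere_measure :: (real^'n) measure). complex_of_real (exp (- v)))"
    proof (rule integral_cong_AE)
      show "AE \<eta> in sphere_measure. F ((a * v) powr (1 / a) *\<^sub>R \<eta>) = complex_of_real (exp (- v))"
        using AE_sphere_measure
      proof eventually_elim
        case (elim \<eta>)
        then have "norm ((a * v) powr (1 / a) *\<^sub>R \<eta>) powr a = a * v" using a0 v by (simp add: powr_powr)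
        then show ?case using a0 by (simp add: F_def)
      qed
    qed (simp_all add: F_def)
    then show ?thesis by (simp add: S_def mult.commute scaleR_conv_of_real)
  qed
  have "(LINT x|lborel. F x / of_real (norm x powr (2 - a))) =
    of_real (real CARD('n) * a powr d) * (LINT v|lborel. indicator {0<..} v *\<^sub>R (v powr d *\<^sub>R of_real (exp (- v) * S)))"
    unfolding d_def
  proof (rule polar_integral_vec(2)[OF a0 _ _ _ J])
    show "F \<in> borel_measurable borel" unfolding F_def by measurable
    show "norm (F x) \<le> exp (- (norm x powr a / a))" for x by (simp add: F_def)
    show "integrable lborel (\<lambda>v. indicator {0<..} v * (v powr bessel_index TYPE('n) a 0 * exp (- v)))"
      using G by (simp add: d_def has_bochner_integral_iff)
  qed
  also have "(LINT v|lborel. indicator {0<..} v *\<^sub>R (v powr d *\<^sub>R of_real (exp (- v) * S))) = (LINT v|lborel. complex_of_real (S * (indicator {0<..} v * (v powr d * exp (- v)))))"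
    by (rule Bochner_Integration.integral_cong) (auto simp: scaleR_conv_of_real)
  also have "\<dots> = of_real (S * Gamma (d + 1))"
    using G by (simp only: integral_complex_of_real integral_mult_right_zero has_bochner_integral_iff)
  finally have "complex_of_real (LINT x|lborel. exp (- (1 / a) * norm (x :: real^'n) powr a) / norm x powr (2 - a)) =
     of_real (real CARD('n) * a powr d * (S * Gamma (d + 1)))"
    by (simp add: F_def flip: integral_complex_of_real of_real_divide)
  then have I: "(LINT x|lborel. exp (- (1 / a) * norm (x :: real^'n) powr a) / norm x powr (2 - a)) = real CARD('n) * a powr d * (S * Gamma (d + 1))"
    by (simp only: of_real_eq_iff)
  have "real CARD('n) * a powr d * (S * Gamma (d + 1)) \<noteq> 0"
    using S a0 Gamma_real_pos[OF d] by simp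
  then show ?thesis
    unfolding deformed_const_def I d_def [symmetric] S_def [symmetric] mult.assoc by (rule left_inverse)
qed

text \<open>A crude majorant of the whole kernel; it justifies polar coordinates in the heat kernel
  integral.\<close>

lemma deformed_kernel_bound:
  assumes a: "a > max 0 (2 - real CARD('n))"
  obtains C D where "C \<ge> 0" "D \<ge> 0"
    "\<And>x y :: real^'n. norm (deformed_kernel a x y) \<le> C * exp (D * (norm x * norm y) powr (a / 2))"
proof -
  define \<Gamma> where "\<Gamma> = Gamma (bessel_index TYPE('n) a 0 + 1)"
  have G: "\<Gamma> \<ge> 0" using bessel_index_gt[OF a, of 0] by (simp add: \<Gamma>_def Gamma_real_nonneg)
  obtain C D where CD: "C \<ge> 0" "D \<ge> 0"
    and b: "\<And>k (x::real^'n) y c z. c \<ge> 0 \<Longrightarrow> \<bar>z\<bar> = (norm x * norm y * c) powr a / a\<^sup>2 \<Longrightarrow>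
       a powr (- 2 * real k / a) * (c ^ k * \<bar>zonal k x y\<bar>) * \<bar>bessel_clifford (bessel_index TYPE('n) a k) z\<bar>
         \<le> C * (1 / 2) ^ k * exp (D * (norm x * norm y * c) powr (a / 2))"
    using zonal_series_bound[OF a] by metis
  show ?thesis
  proof (rule that[of "\<Gamma> * (C * 2)" D])
    fix x y :: "real^'n"
    have "norm (\<Sum>k. kernel_phase a k * of_real (zonal k x y * bessel_clifford (bessel_index TYPE('n) a k) (- ((norm x * norm y) powr a / a\<^sup>2))))
       \<le> (C * exp (D * (norm x * norm y) powr (a / 2))) * 2"
    proof (rule norm_suminf_geometric(3))
      fix k
      show "norm (kernel_phase a k * of_real (zonal k x y * bessel_clifford (bessel_index TYPE('n) a k) (- ((norm x * norm y) powr a / a\<^sup>2))))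
        \<le> (C * exp (D * (norm x * norm y) powr (a / 2))) * (1 / 2) ^ k"
        using b[of 1 "- ((norm x * norm y) powr a / a\<^sup>2)" x y k]
        by (simp add: norm_mult norm_kernel_phase abs_mult mult_ac)
    qed
    from mult_left_mono[OF this G]
    show "norm (deformed_kernel a x y) \<le> \<Gamma> * (C * 2) * exp (D * (norm x * norm y) powr (a / 2))"
      unfolding deformed_kernel_expansion[OF a] \<Gamma>_def [symmetric]
      using G by (simp add: norm_mult mult_ac)
  qed (use G CD in auto)
qed

text \<open>On each sphere |\<xi>| = r the product of the two kernel series collapses to a single
  one by \<open>sphere_zonal_product\<close>, with radial coefficients as in
  \<open>weber_integral\<close>. The Gamma factors of the two kernels give a square, of which c_a
  removes one factor.\<close>

lemma deformed_heat_kernel_expansion: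
  fixes x y :: "real^'n" and a t :: real
  assumes a: "a > max 0 (2 - real CARD('n))" and t: "t > 0"
  defines "X \<equiv> norm x powr a / a" and "Y \<equiv> norm y powr a / a"
  shows "deformed_heat_kernel a x y t = of_real (Gamma (bessel_index TYPE('n) a 0 + 1)) *
    (\<Sum>k. of_real (a powr (- 2 * real k / a) * t powr (- (bessel_index TYPE('n) a k + 1)) *
       (exp (- ((X + Y) / t)) * bessel_clifford (bessel_index TYPE('n) a k) (X * Y / t\<^sup>2))) * of_real (zonal k x y))"
proof -
  have a0: "a > 0" using a by simp
  define lam where "lam = bessel_index TYPE('n) a"
  define \<Gamma> where "\<Gamma> = Gamma (lam 0 + 1)"
  define S where "S = sphere_mass TYPE(real^'n)"
  define bc where "bc = (\<lambda>k. bessel_clifford (lam k))"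
  define q where "q = (\<lambda>k. a powr (- 2 * real k / a))"
  have qk: "a powr (- 2 * real k / a) = q k" for k by (simp only: q_def)
  have l1: "lam k > - 1" for k unfolding lam_def by (rule bessel_index_gt[OF a])
  obtain C D where CD: "C \<ge> 0" "D \<ge> 0"
    and b1: "\<And>k (x::real^'n) y c z. c \<ge> 0 \<Longrightarrow> \<bar>z\<bar> = (norm x * norm y * c) powr a / a\<^sup>2 \<Longrightarrow>
       q k * (c ^ k * \<bar>zonal k x y\<bar>) * \<bar>bc k z\<bar>
         \<le> C * (1 / 2) ^ k * exp (D * (norm x * norm y * c) powr (a / 2))"
    and b2: "\<And>k (x::real^'n) y r. r \<ge> 0 \<Longrightarrow>
       (q k * r ^ k)\<^sup>2 * \<bar>zonal k x y\<bar> * (\<bar>bc k (- ((norm x * r) powr a / a\<^sup>2))\<bar> * \<bar>bc k (- ((norm y * r) powr a / a\<^sup>2))\<bar>)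
         \<le> C * (1 / 2) ^ k * exp (D * ((norm x * r) powr (a / 2) + (norm y * r) powr (a / 2)))"
    using zonal_series_bound[OF a] unfolding bc_def lam_def q_def by metis
  obtain C' D' where CD': "C' \<ge> 0" "D' \<ge> 0"
    and kb: "\<And>x y :: real^'n. norm (deformed_kernel a x y) \<le> C' * exp (D' * (norm x * norm y) powr (a / 2))"
    using deformed_kernel_bound[OF a] by metis
  have km [measurable]: "deformed_kernel a z \<in> borel_measurable borel" for z :: "real^'n"
    by (rule deformed_kernel_measurable[OF a])
  define F where "F = (\<lambda>\<xi>. cnj (deformed_kernel a x \<xi>) * deformed_kernel a y \<xi> * of_real (exp (- (t / a) * norm \<xi> powr a)))"
  have cm [measurable]: "(\<lambda>\<xi>. cnj (deformed_kernel a x \<xi>)) \<in> borel_measurable borel"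
    by (rule borel_measurable_continuous_on[OF _ km]) (intro continuous_intros)
  have Fm [measurable]: "F \<in> borel_measurable borel" unfolding F_def by measurable
  define E where "E = (norm x powr (a / 2) + norm y powr (a / 2)) * sqrt a"
  \<comment> \<open>The k-th term left by the sphere integral, without common factors. The square
    collects the moduli of both phase constants and the r^k from both zonal polynomials.\<close>
  define w where "w = (\<lambda>k v. (q k * ((a * v) powr (1 / a)) ^ k)\<^sup>2 * zonal k x y * (bc k (- (X * v)) * bc k (- (Y * v))))"
  have Xv: "(norm x * (a * v) powr (1 / a)) powr a / a\<^sup>2 = X * v" "(norm y * (a * v) powr (1 / a)) powr a / a\<^sup>2 = Y * v" if "v > 0" for v
    using radius_facts(2)[OF a0 that] a0 by (simp_all add: X_def Y_def power2_eq_square)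
  have wb: "norm (w k v) \<le> C * exp (D * E * sqrt v) * (1 / 2) ^ k" if v: "v > 0" for k v
  proof -
    have "norm (w k v) = (q k * ((a * v) powr (1 / a)) ^ k)\<^sup>2 * \<bar>zonal k x y\<bar> * (\<bar>bc k (- (X * v))\<bar> * \<bar>bc k (- (Y * v))\<bar>)"
      by (simp add: w_def abs_mult)
    also have "\<dots> \<le> C * (1 / 2) ^ k * exp (D * ((norm x * (a * v) powr (1 / a)) powr (a / 2) + (norm y * (a * v) powr (1 / a)) powr (a / 2)))"
      unfolding Xv [OF v, symmetric] by (rule b2) simp
    also have "D * ((norm x * (a * v) powr (1 / a)) powr (a / 2) + (norm y * (a * v) powr (1 / a)) powr (a / 2)) = D * E * sqrt v"
      by (simp add: radius_facts(3)[OF a0 v] E_def algebra_simps)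
    finally show ?thesis by (simp add: mult_ac)
  qed
  have J: "(LINT \<eta>|sphere_measure. F ((a * v) powr (1 / a) *\<^sub>R \<eta>)) = of_real (\<Gamma>\<^sup>2 * S * exp (- (t * v))) * (\<Sum>k. of_real (w k v))" if v: "v > 0" for v
  proof -
    define r where "r = (a * v) powr (1 / a)"
    have r: "r > 0" unfolding r_def by (rule radius_facts(1)[OF a0 v])
    define g where "g = (\<lambda>(u :: real^'n) k. kernel_phase a k * of_real (r ^ k * bc k (- ((norm u * r) powr a / a\<^sup>2))))"
    have gb: "norm (g u k * of_real (zonal k u \<eta>)) \<le> (C * exp (D * (norm u * r) powr (a / 2))) * (1 / 2) ^ k"
      if "norm \<eta> = 1" for u \<eta> :: "real^'n" and k
      using b1[of r "- ((norm u * r) powr a / a\<^sup>2)" u \<eta> k] that r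
      by (simp add: g_def norm_mult norm_kernel_phase q_def abs_mult mult_ac norm_power)
    have gb': "norm (cnj (g u k) * of_real (zonal k u \<eta>)) \<le> (C * exp (D * (norm u * r) powr (a / 2))) * (1 / 2) ^ k"
      if "norm \<eta> = 1" for u \<eta> :: "real^'n" and k
      using gb[OF that, of u k] by (simp add: norm_mult)
    have B: "deformed_kernel a u (r *\<^sub>R \<eta>) = of_real \<Gamma> * (\<Sum>k. g u k * of_real (zonal k u \<eta>))" if "norm \<eta> = 1" for u \<eta>
      using that r unfolding deformed_kernel_expansion[OF a] \<Gamma>_def lam_def g_def bc_def zonal_scale
      by (simp add: mult_ac)
    have cB: "cnj (deformed_kernel a u (r *\<^sub>R \<eta>)) = of_real \<Gamma> * (\<Sum>k. cnj (g u k) * of_real (zonal k u \<eta>))" if e: "norm \<eta> = 1" for u \<eta>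
    proof -
      have "(\<lambda>k. g u k * of_real (zonal k u \<eta>)) sums (\<Sum>k. g u k * of_real (zonal k u \<eta>))"
        by (rule summable_sums, rule summable_norm_cancel, rule norm_suminf_geometric(1), rule gb[OF e])
      then have "(\<lambda>k. cnj (g u k * of_real (zonal k u \<eta>))) sums cnj (\<Sum>k. g u k * of_real (zonal k u \<eta>))"
        by (simp only: sums_cnj)
      then show ?thesis unfolding B[OF e] by (simp add: sums_iff)
    qed
    have "(LINT \<eta>|sphere_measure. F (r *\<^sub>R \<eta>)) = (LINT \<eta>|sphere_measure. of_real (\<Gamma>\<^sup>2 * exp (- (t * v))) *
       ((\<Sum>k. cnj (g x k) * of_real (zonal k x \<eta>)) * (\<Sum>k. g y k * of_real (zonal k y \<eta>))))"
    proof (rule integral_cong_AE)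
      show "AE \<eta> in sphere_measure. F (r *\<^sub>R \<eta>) = of_real (\<Gamma>\<^sup>2 * exp (- (t * v))) *
       ((\<Sum>k. cnj (g x k) * of_real (zonal k x \<eta>)) * (\<Sum>k. g y k * of_real (zonal k y \<eta>)))"
        using AE_sphere_measure
      proof eventually_elim
        case (elim \<eta>)
        have "norm (r *\<^sub>R \<eta>) powr a = a * v" using elim r a0 v by (simp add: r_def powr_powr)
        then show ?case unfolding F_def cB[OF elim] unfolding B[OF elim] using a0
          by (simp add: power2_eq_square mult_ac)
      qed
    qed measurable
    also have "\<dots> = of_real (\<Gamma>\<^sup>2 * exp (- (t * v))) * (\<Sum>k. of_real S * (cnj (g x k) * g y k * of_real (zonal k x y)))"
      unfolding S_def using sphere_zonal_product[OF gb' gb, of x y]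
      by (simp only: integral_mult_right_zero sums_iff)
    also have "(\<lambda>k. of_real S * (cnj (g x k) * g y k * of_real (zonal k x y))) = (\<lambda>k. of_real S * of_real (w k v))"
    proof
      fix k
      have "cnj (g x k) * g y k = (cnj (kernel_phase a k) * kernel_phase a k) * of_real (r ^ k * r ^ k * (bc k (- (X * v)) * bc k (- (Y * v))))"
        unfolding g_def r_def Xv[OF v] by (simp add: mult_ac)
      also have "\<dots> = of_real ((q k * r ^ k)\<^sup>2 * (bc k (- (X * v)) * bc k (- (Y * v))))"
        unfolding cnj_kernel_phase qk of_real_mult [symmetric] by (simp add: power2_eq_square mult_ac)
      finally show "of_real S * (cnj (g x k) * g y k * of_real (zonal k x y)) = of_real S * of_real (w k v)"
        by (simp add: w_def r_def mult_ac)
    qed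
    also have "(\<Sum>k. of_real S * of_real (w k v)) = of_real S * (\<Sum>k. complex_of_real (w k v))"
    proof (rule suminf_mult, rule summable_norm_cancel, rule norm_suminf_geometric(1))
      show "norm (complex_of_real (w k v)) \<le> C * exp (D * E * sqrt v) * (1 / 2) ^ k" for k
        using wb[OF v, of k] by simp
    qed
    finally show ?thesis by (simp add: r_def mult_ac)
  qed
  have P: "(LINT \<xi>|lborel. F \<xi> / of_real (norm \<xi> powr (2 - a))) =
    of_real (real CARD('n) * a powr lam 0) * (LINT v|lborel. indicator {0<..} v *\<^sub>R (v powr lam 0 *\<^sub>R (of_real (\<Gamma>\<^sup>2 * S * exp (- (t * v))) * (\<Sum>k. of_real (w k v)))))"
    unfolding lam_def
  proof (rule polar_integral_vec(2)[OF a0 _ _ _ J])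
    show "F \<in> borel_measurable borel" by (rule Fm)
    \<comment> \<open>Both kernel bounds have an exponent proportional to |\<xi>|^(a/2) = sqrt a *
      sqrt v, so the majorant is of the kind treated in
      \<open>integrable_powr_exp_sqrt\<close>.\<close>
    show "norm (F \<xi>) \<le> C' * C' * (exp (- (t * (norm \<xi> powr a / a))) * exp (D' * E * sqrt (norm \<xi> powr a / a)))" for \<xi>
    proof -
      have e: "(norm u * norm \<xi>) powr (a / 2) = norm u powr (a / 2) * (sqrt a * sqrt (norm \<xi> powr a / a))" for u :: "real^'n"
      proof -
        have "sqrt a * sqrt (norm \<xi> powr a / a) = sqrt (norm \<xi> powr a)" using a0 by (simp flip: real_sqrt_mult)
        also have "\<dots> = norm \<xi> powr (a / 2)"
          by (simp add: powr_half_sqrt [symmetric] powr_powr)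
        finally show ?thesis by (simp add: powr_mult)
      qed
      have "norm (F \<xi>) = norm (deformed_kernel a x \<xi>) * norm (deformed_kernel a y \<xi>) * exp (- (t * (norm \<xi> powr a / a)))"
        by (simp add: F_def norm_mult)
      also have "\<dots> \<le> (C' * exp (D' * (norm x * norm \<xi>) powr (a / 2))) * (C' * exp (D' * (norm y * norm \<xi>) powr (a / 2))) * exp (- (t * (norm \<xi> powr a / a)))"
        using CD' by (intro mult_mono kb) auto
      also have "\<dots> = C' * C' * (exp (- (t * (norm \<xi> powr a / a))) * (exp (D' * (norm x * norm \<xi>) powr (a / 2)) * exp (D' * (norm y * norm \<xi>) powr (a / 2))))"
        by simp
      also have "exp (D' * (norm x * norm \<xi>) powr (a / 2)) * exp (D' * (norm y * norm \<xi>) powr (a / 2)) = exp (D' * E * sqrt (norm \<xi> powr a / a))"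
        unfolding exp_add [symmetric] e by (simp add: E_def algebra_simps)
      finally show ?thesis .
    qed
    have "integrable lborel (\<lambda>v. C' * C' * (indicator {0<..} v * (v powr lam 0 * (exp (- (t * v)) * exp (D' * E * sqrt v)))))"
      by (intro integrable_mult_right integrable_powr_exp_sqrt l1 t)
    then show "integrable lborel (\<lambda>v. indicator {0<..} v * (v powr bessel_index TYPE('n) a 0 * (C' * C' * (exp (- (t * v)) * exp (D' * E * sqrt v)))))"
      by (simp add: lam_def mult_ac)
  qed
  define u where "u = (\<lambda>k v. complex_of_real (indicator {0<..} v * (v powr lam 0 * exp (- (t * v)) * w k v)))"
  have um: "u k \<in> borel_measurable lborel" for k unfolding u_def w_def bc_def by measurable
  define h where "h = (\<lambda>v. C * 2 * (indicator {0<..} v * (v powr lam 0 * (exp (- (t * v)) * exp (D * E * sqrt v)))))"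
  have h: "integrable lborel h" unfolding h_def
    by (intro integrable_mult_right integrable_powr_exp_sqrt l1 t)
  have ub: "AE v in lborel. summable (\<lambda>k. norm (u k v)) \<and> (\<Sum>k. norm (u k v)) \<le> h v"
  proof (rule AE_I2)
    fix v :: real
    have b: "norm (u k v) \<le> (C * (indicator {0<..} v * (v powr lam 0 * (exp (- (t * v)) * exp (D * E * sqrt v))))) * (1 / 2) ^ k" for k
    proof (cases "v > 0")
      case True
      have "norm (u k v) = (v powr lam 0 * exp (- (t * v))) * norm (w k v)" using True by (simp add: u_def norm_mult abs_mult)
      also have "\<dots> \<le> (v powr lam 0 * exp (- (t * v))) * (C * exp (D * E * sqrt v) * (1 / 2) ^ k)"
        by (intro mult_left_mono wb True) simp
      finally show ?thesis using True by (simp add: mult_ac)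
    qed (simp add: u_def)
    show "summable (\<lambda>k. norm (u k v)) \<and> (\<Sum>k. norm (u k v)) \<le> h v"
      using norm_suminf_geometric(1,2)[OF b] by (simp add: h_def mult_ac)
  qed
  have uI: "integral\<^sup>L lborel (u k) = of_real (q k * t powr (- (lam k + 1)) * (exp (- ((X + Y) / t)) * bc k (X * Y / t\<^sup>2))) * of_real (zonal k x y)" for k
  proof -
    have X0: "X \<ge> 0" "Y \<ge> 0" using a0 by (auto simp: X_def Y_def)
    have uk: "u k = (\<lambda>v. complex_of_real ((q k * zonal k x y) * (indicator {0<..} v * (v powr lam k * exp (- (t * v)) * (bc k (- (X * v)) * bc k (- (Y * v)))))))"
    proof
      fix v :: real
      show "u k v = complex_of_real ((q k * zonal k x y) * (indicator {0<..} v * (v powr lam k * exp (- (t * v)) * (bc k (- (X * v)) * bc k (- (Y * v))))))"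
      proof (cases "v > 0")
        case True
        \<comment> \<open>The powers of a reduce to a single q k, and v powr (2k/a) lifts the
          exponent from lam 0 to lam k, as Weber's integral requires.\<close>
        have "(q k * ((a * v) powr (1 / a)) ^ k)\<^sup>2 = q k * q k * (a * v) powr (2 * real k / a)"
          unfolding radius_facts(4)[OF a0 True] by (simp add: power2_eq_square mult_ac flip: powr_add)
        also have "\<dots> = q k * (q k * a powr (2 * real k / a)) * v powr (2 * real k / a)"
          using a0 True by (simp add: powr_mult)
        also have "q k * a powr (2 * real k / a) = 1" using a0 by (simp add: q_def powr_minus)
        finally have "v powr lam 0 * (q k * ((a * v) powr (1 / a)) ^ k)\<^sup>2 = q k * v powr lam k"
          unfolding lam_def bessel_index_shift[of _ _ k] by (simp add: powr_add)
        then have "v powr lam 0 * exp (- (t * v)) * w k v = q k * v powr lam k * (exp (- (t * v)) * zonal k x y * (bc k (- (X * v)) * bc k (- (Y * v))))"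
          unfolding w_def by (simp add: mult_ac)
        then show ?thesis using True unfolding u_def by (simp only: indicator_simps greaterThan_iff mult_1_left mult_ac)
      qed (simp add: u_def)
    qed
    show ?thesis
      using weber_integral[OF l1 t X0, of k] unfolding uk bc_def
      by (simp only: integral_complex_of_real integral_mult_right_zero has_bochner_integral_iff) (simp add: mult_ac)
  qed
  have "(LINT v|lborel. indicator {0<..} v *\<^sub>R (v powr lam 0 *\<^sub>R (of_real (\<Gamma>\<^sup>2 * S * exp (- (t * v))) * (\<Sum>k. of_real (w k v))))) =
     (LINT v|lborel. of_real (\<Gamma>\<^sup>2 * S) * (\<Sum>k. u k v))"
  proof (rule Bochner_Integration.integral_cong[OF refl])
    fix v :: real
    show "indicator {0<..} v *\<^sub>R (v powr lam 0 *\<^sub>R (of_real (\<Gamma>\<^sup>2 * S * exp (- (t * v))) * (\<Sum>k. of_real (w k v)))) = of_real (\<Gamma>\<^sup>2 * S) * (\<Sum>k. u k v)"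
    proof (cases "v > 0")
      case True
      have "summable (\<lambda>k. complex_of_real (w k v))"
        by (rule summable_norm_cancel, rule norm_suminf_geometric(1)[of _ "C * exp (D * E * sqrt v)"]) (use wb[OF True] in simp)
      then have "(\<Sum>k. u k v) = of_real (v powr lam 0 * exp (- (t * v))) * (\<Sum>k. of_real (w k v))"
        using True unfolding u_def by (simp add: suminf_mult)
      then show ?thesis using True by (simp add: scaleR_conv_of_real mult_ac)
    qed (simp add: u_def)
  qed
  also have "\<dots> = of_real (\<Gamma>\<^sup>2 * S) * (\<Sum>k. integral\<^sup>L lborel (u k))"
    using dominated_sums(3)[OF um h ub] by (simp only: integral_mult_right_zero sums_iff)
  finally have "deformed_heat_kernel a x y t = of_real (deformed_const TYPE('n) a) * (of_real (real CARD('n) * a powr lam 0) * (of_real (\<Gamma>\<^sup>2 * S) * (\<Sum>k. integral\<^sup>L lborel (u k))))"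
    unfolding deformed_heat_kernel_def using P by (simp only: F_def)
  also have "\<dots> = of_real ((deformed_const TYPE('n) a * (real CARD('n) * a powr lam 0 * S * \<Gamma>)) * \<Gamma>) * (\<Sum>k. integral\<^sup>L lborel (u k))"
    by (simp add: power2_eq_square mult_ac)
  also have "deformed_const TYPE('n) a * (real CARD('n) * a powr lam 0 * S * \<Gamma>) = 1"
    unfolding lam_def S_def \<Gamma>_def by (rule deformed_const_eq[OF a])
  finally show ?thesis unfolding uI \<Gamma>_def lam_def q_def bc_def by simp
qed

section \<open>Heat evolution of harmonic polynomials\<close>

text \<open>Replacing i by m - i gives the order of summation of the theorem. The part a^(m - i)
  t^(m - i) of the prefactor cancels the denominators of (u / (a t))^(m - i), and the rest stays as
  a^i t^i.\<close>

lemma scaled_laguerre_sum: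
  assumes lam: "lam > - 1" and a: "a > 0" and t: "t > 0"
  shows "a ^ m * t ^ m * laguerre_sum m lam (u / a / t) =
    (\<Sum>i\<le>m. a ^ i * real (m choose i) * (Gamma (lam + real m + 1) / Gamma (lam + real m - real i + 1)) * u ^ (m - i) * t ^ i)"
proof -
  have "a ^ m * t ^ m * laguerre_sum m lam (u / a / t) =
    (\<Sum>i\<le>m. a ^ m * t ^ m * (real (m choose i) * pochhammer (lam + real i + 1) (m - i) * (u / a / t) ^ i))"
    by (simp only: laguerre_sum_def sum_distrib_left)
  also have "\<dots> = (\<Sum>i\<le>m. a ^ m * t ^ m * (real (m choose (m - i)) * pochhammer (lam + real (m - i) + 1) (m - (m - i)) * (u / a / t) ^ (m - i)))"
    by (rule sum.reindex_bij_witness[of _ "\<lambda>i. m - i" "\<lambda>i. m - i"]) auto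
  also have "\<dots> = (\<Sum>i\<le>m. a ^ i * real (m choose i) * (Gamma (lam + real m + 1) / Gamma (lam + real m - real i + 1)) * u ^ (m - i) * t ^ i)"
  proof (rule sum.cong[OF refl])
    fix i assume "i \<in> {..m}"
    then have i: "i \<le> m" by simp
    have e: "lam + real (m - i) + 1 = lam + real m - real i + 1" "m - (m - i) = i" using i by auto
    have pos: "lam + real m - real i + 1 > 0" using lam i by linarith
    then have np: "lam + real m - real i + 1 \<notin> \<int>\<^sub>\<le>\<^sub>0" by (auto elim!: nonpos_Ints_cases)
    have p: "pochhammer (lam + real m - real i + 1) i = Gamma (lam + real m + 1) / Gamma (lam + real m - real i + 1)"
      using pochhammer_Gamma[OF np, of i] by (simp add: algebra_simps)
    have c: "m choose (m - i) = m choose i" using i by (rule binomial_symmetric [symmetric])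
    have W: "a ^ m * t ^ m * (u / a / t) ^ (m - i) = a ^ i * t ^ i * u ^ (m - i)"
    proof -
      have "a ^ m = a ^ i * a ^ (m - i)" "t ^ m = t ^ i * t ^ (m - i)" using i by (simp_all flip: power_add)
      then show ?thesis using a t by (simp add: power_divide power_mult_distrib)
    qed
    have ac: "a ^ m * t ^ m * (C * P * R) = (a ^ m * t ^ m * R) * (C * P)" for C P R by (simp only: mult_ac)
    show "a ^ m * t ^ m * (real (m choose (m - i)) * pochhammer (lam + real (m - i) + 1) (m - (m - i)) * (u / a / t) ^ (m - i)) =
       a ^ i * real (m choose i) * (Gamma (lam + real m + 1) / Gamma (lam + real m - real i + 1)) * u ^ (m - i) * t ^ i"
      unfolding e p c ac W by (simp only: mult_ac)
  qed
  finally show ?thesis .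
qed

text \<open>Integrability is asserted separately because the Bochner integral of a non-integrable
  function is 0 by convention.\<close>

theorem corollary4p28:
  fixes a t lam :: real and l m :: nat and p :: "real^'n \<Rightarrow> complex" and x :: "real^'n"
  assumes "a > max 0 (2 - real CARD('n))"
    and "p \<in> harmonic_polynomials l"
    and "lam = (real CARD('n) + 2 * real l - 2) / a"
    and "t > 0"
  shows "integrable lborel (\<lambda>y. deformed_heat_kernel a x y t * of_real ((norm y powr a) ^ m) * p y
           / of_real (norm y powr (2 - a)))
      \<and> of_real (deformed_const TYPE('n) a) *
         (LINT y|lborel. deformed_heat_kernel a x y t * of_real ((norm y powr a) ^ m) * p y
           / of_real (norm y powr (2 - a)))
       = of_real (\<Sum>i\<le>m. a ^ i * real (m choose i)
             * (Gamma (lam + real m + 1) / Gamma (lam + real m - real i + 1))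
             * (norm x powr a) ^ (m - i) * t ^ i) * p x"
proof -
  note a = assms(1) and p = assms(2) and t = assms(4)
  have a0: "a > 0" using a by simp
  define idx where "idx = bessel_index TYPE('n) a"
  have lam: "lam = idx l" by (simp add: assms(3) idx_def bessel_index_def algebra_simps)
  have l1: "idx k > - 1" for k unfolding idx_def by (rule bessel_index_gt[OF a])
  have idxk: "idx k = idx 0 + 2 * real k / a" for k unfolding idx_def by (rule bessel_index_shift)
  define \<Gamma> where "\<Gamma> = Gamma (idx 0 + 1)"
  have G: "\<Gamma> \<ge> 0" using l1[of 0] by (simp add: \<Gamma>_def Gamma_real_nonneg)
  define S where "S = sphere_mass TYPE(real^'n)"
  define bc where "bc = (\<lambda>k. bessel_clifford (idx k))"
  define q where "q = (\<lambda>k. a powr (- 2 * real k / a))"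
  define X where "X = norm x powr a / a"
  define T where "T = t powr (- (idx 0 + 1))"
  define b where "b = (\<lambda>k v. q k * t powr (- (idx k + 1)) * (exp (- ((X + v) / t)) * bc k (X * v / t\<^sup>2)))"
  have hk: "deformed_heat_kernel a x y t = of_real \<Gamma> * (\<Sum>k. of_real (b k (norm y powr a / a)) * of_real (zonal k x y))" for y
    unfolding deformed_heat_kernel_expansion[OF a t] b_def q_def bc_def idx_def \<Gamma>_def X_def ..
  obtain C D where CD: "C \<ge> 0" "D \<ge> 0"
    and b1: "\<And>k (x::real^'n) y c z. c \<ge> 0 \<Longrightarrow> \<bar>z\<bar> = (norm x * norm y * c) powr a / a\<^sup>2 \<Longrightarrow>
       q k * (c ^ k * \<bar>zonal k x y\<bar>) * \<bar>bc k z\<bar>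
         \<le> C * (1 / 2) ^ k * exp (D * (norm x * norm y * c) powr (a / 2))"
    using zonal_series_bound[OF a] unfolding bc_def idx_def q_def by metis
  define E where "E = D * (norm x powr (a / 2) * sqrt a / t)"
  have term_bound: "norm (complex_of_real (b k (norm y powr a / a)) * of_real (zonal k x y)) \<le>
     (T * C * (exp (- (1 / t * (norm y powr a / a))) * exp (E * sqrt (norm y powr a / a)))) * (1 / 2) ^ k" for k y
  proof -
    define v where "v = norm y powr a / a"
    \<comment> \<open>The scale with c powr a = 1 / t^2, matching the Bessel argument X * v / t^2;
      the powers c^k also account for the dependence of \<open>t powr (- (idx k + 1))\<close> on
      k.\<close>
    define c where "c = t powr (- 2 / a)"
    have v: "v \<ge> 0" using a0 by (simp add: v_def)
    have X: "X \<ge> 0" using a0 by (simp add: X_def)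
    have e2: "- 2 / a * a = - 2" and e1: "- 2 / a * (a / 2) = - 1" using a0 by simp_all
    have ca: "c powr a = 1 / t\<^sup>2"
      unfolding c_def powr_powr e2 using t by (simp add: powr_minus divide_inverse)
    have ca2: "c powr (a / 2) = 1 / t"
      unfolding c_def powr_powr e1 using t by (simp add: powr_minus divide_inverse)
    have ck: "c ^ k = t powr (- 2 * real k / a)" using t by (simp add: c_def powr_powr mult.commute flip: powr_realpow)
    have z: "\<bar>X * v / t\<^sup>2\<bar> = (norm x * norm y * c) powr a / a\<^sup>2"
      using X v a0 by (simp add: X_def v_def powr_mult ca power2_eq_square)
    have sv: "sqrt a * sqrt v = norm y powr (a / 2)"
    proof -
      have "sqrt a * sqrt v = sqrt (norm y powr a)" using a0 by (simp add: v_def flip: real_sqrt_mult)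
      also have "\<dots> = norm y powr (a / 2)" by (simp add: powr_half_sqrt [symmetric] powr_powr)
      finally show ?thesis .
    qed
    have "D * (norm x * norm y * c) powr (a / 2) = D * (norm x powr (a / 2) * (sqrt a * sqrt v) / t)"
      unfolding powr_mult ca2 sv by simp
    then have ex: "D * (norm x * norm y * c) powr (a / 2) = E * sqrt v" by (simp add: E_def)
    have tk: "t powr (- (idx k + 1)) = T * c ^ k"
    proof -
      have "- (idx k + 1) = - (idx 0 + 1) + - 2 * real k / a" unfolding idxk[of k] by simp
      then show ?thesis unfolding T_def ck by (simp only: powr_add)
    qed
    have "norm (complex_of_real (b k v) * of_real (zonal k x y)) = T * exp (- ((X + v) / t)) * (q k * (c ^ k * \<bar>zonal k x y\<bar>) * \<bar>bc k (X * v / t\<^sup>2)\<bar>)"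
      unfolding b_def tk by (simp add: norm_mult norm_power abs_mult q_def T_def c_def mult_ac)
    also have "\<dots> \<le> T * exp (- (1 / t * v)) * (C * (1 / 2) ^ k * exp (E * sqrt v))"
    proof (rule mult_mono)
      show "T * exp (- ((X + v) / t)) \<le> T * exp (- (1 / t * v))"
        using X t by (intro mult_left_mono) (auto simp: T_def divide_right_mono)
      show "q k * (c ^ k * \<bar>zonal k x y\<bar>) * \<bar>bc k (X * v / t\<^sup>2)\<bar> \<le> C * (1 / 2) ^ k * exp (E * sqrt v)"
        unfolding ex [symmetric] by (rule b1[OF _ z]) (simp add: c_def)
    qed (auto simp: T_def q_def c_def)
    finally show ?thesis by (simp add: v_def mult_ac)
  qed
  have hp: "homogeneous_polynomial l p" using p by (simp add: harmonic_polynomials_def)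
  have [measurable]: "p \<in> borel_measurable borel"
    by (rule borel_measurable_continuous_onI[OF homogeneous_polynomial_continuous[OF hp]])
  obtain Cp where Cp: "Cp \<ge> 0" "\<And>y. norm (p y) \<le> Cp * norm y ^ l"
    using homogeneous_bound[OF homogeneous_polynomial_continuous[OF hp] homogeneous_polynomial_scale[OF hp]] by blast
  define F where "F = (\<lambda>y. deformed_heat_kernel a x y t * of_real ((norm y powr a) ^ m) * p y)"
  define K where "K = \<Gamma> * (T * C * 2) * Cp * a powr (real m + real l / a)"
  \<comment> \<open>Only k = l survives. Of the two factors r^l, one comes from scaling p and the
    other from scaling the zonal polynomial.\<close>
  have J: "(LINT \<eta>|sphere_measure. F ((a * v) powr (1 / a) *\<^sub>R \<eta>)) =
     of_real (\<Gamma> * S * a ^ m * v ^ m * b l v * (((a * v) powr (1 / a)) ^ l * ((a * v) powr (1 / a)) ^ l)) * p x" if v: "v > 0" for v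
  proof -
    define r where "r = (a * v) powr (1 / a)"
    have r: "r > 0" unfolding r_def by (rule radius_facts(1)[OF a0 v])
    have nr: "norm (r *\<^sub>R \<eta>) powr a = a * v" if "norm \<eta> = 1" for \<eta> :: "real^'n"
      using that r a0 v by (simp add: r_def powr_powr)
    define f where "f = (\<lambda>k. complex_of_real (b k v * r ^ k))"
    have fb: "norm (f k * of_real (zonal k x \<eta>)) \<le> (T * C * (exp (- (1 / t * v)) * exp (E * sqrt v))) * (1 / 2) ^ k" if "norm \<eta> = 1" for k \<eta>
      using term_bound[of k "r *\<^sub>R \<eta>"] a0 unfolding nr[OF that] zonal_scale f_def by (simp add: mult_ac)
    have "(LINT \<eta>|sphere_measure. F (r *\<^sub>R \<eta>)) = (LINT \<eta>|sphere_measure. of_real (\<Gamma> * (a * v) ^ m * r ^ l) * ((\<Sum>k. f k * of_real (zonal k x \<eta>)) * p \<eta>))"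
    proof (rule integral_cong_AE)
      show "AE \<eta> in sphere_measure. F (r *\<^sub>R \<eta>) = of_real (\<Gamma> * (a * v) ^ m * r ^ l) * ((\<Sum>k. f k * of_real (zonal k x \<eta>)) * p \<eta>)"
        using AE_sphere_measure
      proof eventually_elim
        case (elim \<eta>)
        show ?case unfolding F_def hk nr[OF elim] zonal_scale f_def homogeneous_polynomial_scale[OF hp]
          using a0 by (simp add: mult_ac)
      qed
    next
      show "(\<lambda>\<eta>. F (r *\<^sub>R \<eta>)) \<in> borel_measurable sphere_measure"
        unfolding F_def hk b_def bc_def by measurable
    qed measurable
    also have "\<dots> = of_real (\<Gamma> * (a * v) ^ m * r ^ l) * (of_real S * (f l * p x))"
      unfolding S_def using sphere_harmonic_series[OF p fb] by (simp only: integral_mult_right_zero)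
    finally show ?thesis by (simp add: r_def f_def power_mult_distrib mult_ac)
  qed
  have Fm: "F \<in> borel_measurable borel" unfolding F_def hk b_def bc_def by measurable
  \<comment> \<open>Multiplication by |y|^(ma) p(y) merely adds m + l/a to the exponent of
    v.\<close>
  have Fb: "norm (F y) \<le> K * ((norm y powr a / a) powr (real m + real l / a) *
      (exp (- (1 / t * (norm y powr a / a))) * exp (E * sqrt (norm y powr a / a))))" if y: "y \<noteq> 0" for y
  proof -
    define v where "v = norm y powr a / a"
    have v: "v > 0" using y a0 by (simp add: v_def)
    have nv: "norm y powr a = a * v" using a0 by (simp add: v_def)
    have nl: "norm y ^ l = (a * v) powr (real l / a)" using y a0 by (simp add: powr_powr powr_realpow flip: nv)
    have "norm (deformed_heat_kernel a x y t) \<le> \<Gamma> * ((T * C * (exp (- (1 / t * v)) * exp (E * sqrt v))) * 2)"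
      unfolding hk norm_mult using G norm_suminf_geometric(3)[OF term_bound[of _ y]]
      by (auto simp: v_def intro!: mult_left_mono)
    then have "norm (F y) \<le> (\<Gamma> * ((T * C * (exp (- (1 / t * v)) * exp (E * sqrt v))) * 2)) * (a * v) ^ m * (Cp * (a * v) powr (real l / a))"
      unfolding F_def norm_mult nv using Cp(2)[of y] a0 v CD G
      by (intro mult_mono) (auto simp: nl T_def norm_power norm_mult)
    also have "(a * v) ^ m = (a * v) powr real m" using a0 v by (simp add: powr_realpow)
    also have "(\<Gamma> * ((T * C * (exp (- (1 / t * v)) * exp (E * sqrt v))) * 2)) * (a * v) powr real m * (Cp * (a * v) powr (real l / a))
       = K * (v powr (real m + real l / a) * (exp (- (1 / t * v)) * exp (E * sqrt v)))"
      using a0 v by (simp add: K_def powr_mult powr_add)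
    finally show ?thesis by (simp add: v_def)
  qed
  have gi: "integrable lborel (\<lambda>v. indicator {0<..} v * (v powr idx 0 * (K * (v powr (real m + real l / a) * (exp (- (1 / t * v)) * exp (E * sqrt v))))))"
  proof -
    have "real m + real l / a \<ge> 0" using a0 by simp
    then have ex: "idx 0 + (real m + real l / a) > - 1" using l1[of 0] by linarith
    have "integrable lborel (\<lambda>v. K * (indicator {0<..} v * (v powr (idx 0 + (real m + real l / a)) * (exp (- (1 / t * v)) * exp (E * sqrt v)))))"
      using t by (intro integrable_mult_right integrable_powr_exp_sqrt ex) simp
    then show ?thesis by (simp add: powr_add mult_ac)
  qed
  note polar = polar_integral_vec[OF a0 Fm Fb gi[unfolded idx_def] J]
  let ?L = "\<lambda>v. v powr (idx l + real m) * exp (- (1 / t * v)) * bessel_clifford (idx l) ((X / t\<^sup>2) * v)" and ?c = "\<Gamma> * S * a ^ m * t powr (- (idx l + 1)) * exp (- (X / t))"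
  \<comment> \<open>Brings the integrand to the form of \<open>laguerre_integral\<close>: the two
    factors r^l give v powr (2l/a), which lifts idx 0 to idx l, and their power of a cancels q
    l.\<close>
  have red: "indicator {0<..} v *\<^sub>R (v powr idx 0 *\<^sub>R (of_real (\<Gamma> * S * a ^ m * v ^ m * b l v * (((a * v) powr (1 / a)) ^ l * ((a * v) powr (1 / a)) ^ l)) * p x)) =
     complex_of_real (?c * (indicator {0<..} v * ?L v)) * p x" for v
  proof (cases "v > 0")
    case True
    have rl: "((a * v) powr (1 / a)) ^ l * ((a * v) powr (1 / a)) ^ l = a powr (2 * real l / a) * v powr (2 * real l / a)"
    proof -
      have "2 * real l / a = real l / a + real l / a" by simp
      then show ?thesis
        unfolding radius_facts(4)[OF a0 True] using a0 True by (simp only: powr_mult powr_add) (simp add: mult_ac)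
    qed
    have qa: "q l * a powr (2 * real l / a) = 1" using a0 by (simp add: q_def powr_minus)
    have ee: "exp (- ((X + v) / t)) = exp (- (X / t)) * exp (- (1 / t * v))"
      by (simp add: add_divide_distrib flip: exp_add)
    have vv: "v powr (idx l + real m) = v powr idx 0 * v powr (2 * real l / a) * v ^ m"
      using True unfolding idxk[of l] by (simp add: powr_add powr_realpow)
    have xv: "X * v / t\<^sup>2 = (X / t\<^sup>2) * v" by simp
    have "v powr idx 0 * (\<Gamma> * S * a ^ m * v ^ m * b l v * (a powr (2 * real l / a) * v powr (2 * real l / a))) =
      (q l * a powr (2 * real l / a)) * (?c * ?L v)"
      unfolding b_def ee vv xv bc_def by (simp only: mult_ac)
    then have "v powr idx 0 * (\<Gamma> * S * a ^ m * v ^ m * b l v * (a powr (2 * real l / a) * v powr (2 * real l / a))) =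
      ?c * ?L v"
      unfolding qa by simp
    from arg_cong[OF this, of "\<lambda>z. complex_of_real z * p x"]
    show ?thesis unfolding rl using True
      by (simp only: scaleR_conv_of_real of_real_mult indicator_simps greaterThan_iff of_real_1 mult_1_left mult.assoc)
  qed simp
  \<comment> \<open>The exponential decay rate is now 1 / t, so the prefactor of the Laguerre
    integral has a positive power of t; against the prefactor of the heat kernel only t^m
    remains.\<close>
  have tt: "t powr (- (idx l + 1)) * (1 / t) powr (- (idx l + real m + 1)) = t ^ m"
  proof -
    have "(1 / t) powr (- c) = t powr c" for c using t by (simp add: powr_divide powr_minus)
    then have "t powr (- (idx l + 1)) * (1 / t) powr (- (idx l + real m + 1)) = t powr (- (idx l + 1) + (idx l + real m + 1))"
      by (simp only: powr_add)
    also have "- (idx l + 1) + (idx l + real m + 1) = real m" by simp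
    finally show ?thesis using t by (simp add: powr_realpow)
  qed
  \<comment> \<open>The same quotient X / t stands in the exponential produced by the Laguerre
    integral, so it cancels the factor exp (- X / t) of the heat kernel and only a polynomial is
    left.\<close>
  have Xt: "(X / t\<^sup>2) / (1 / t) = X / t" using t by (simp add: power2_eq_square)
  have lag: "a ^ m * t ^ m * laguerre_sum m lam (X / t) = (\<Sum>i\<le>m. a ^ i * real (m choose i)
             * (Gamma (lam + real m + 1) / Gamma (lam + real m - real i + 1)) * (norm x powr a) ^ (m - i) * t ^ i)"
    unfolding X_def by (rule scaled_laguerre_sum[OF _ a0 t]) (simp add: lam l1)
  have t1: "1 / t > 0" using t by simp
  have "(LINT y|lborel. F y / of_real (norm y powr (2 - a))) = of_real (real CARD('n) * a powr idx 0) *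
     (LINT v|lborel. complex_of_real (?c * (indicator {0<..} v * ?L v)) * p x)"
    using polar(2) unfolding idx_def [symmetric] red .
  also have "\<dots> = of_real (real CARD('n) * a powr idx 0) * (of_real (?c *
      ((1 / t) powr (- (idx l + real m + 1)) * (exp (X / t) * laguerre_sum m lam (X / t)))) * p x)"
    using laguerre_integral[OF l1[of l] t1, of m "X / t\<^sup>2"] unfolding Xt lam
    by (simp only: integral_mult_left_zero integral_complex_of_real integral_mult_right_zero has_bochner_integral_iff)
  also have "\<dots> = of_real ((real CARD('n) * a powr idx 0 * S * \<Gamma>) * (a ^ m * (t powr (- (idx l + 1)) * (1 / t) powr (- (idx l + real m + 1))) * (exp (- (X / t)) * exp (X / t)) * laguerre_sum m lam (X / t))) * p x"
    by (simp only: of_real_mult mult_ac)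
  also have "exp (- (X / t)) * exp (X / t) = 1" by (simp flip: exp_add)
  finally have I: "(LINT y|lborel. F y / of_real (norm y powr (2 - a))) =
     of_real ((real CARD('n) * a powr idx 0 * S * \<Gamma>) * (a ^ m * t ^ m * laguerre_sum m lam (X / t))) * p x"
    unfolding tt by simp
  have "of_real (deformed_const TYPE('n) a) * (LINT y|lborel. F y / of_real (norm y powr (2 - a))) =
     of_real ((deformed_const TYPE('n) a * (real CARD('n) * a powr idx 0 * S * \<Gamma>)) * (a ^ m * t ^ m * laguerre_sum m lam (X / t))) * p x"
    unfolding I by (simp only: of_real_mult mult.assoc)
  also have "deformed_const TYPE('n) a * (real CARD('n) * a powr idx 0 * S * \<Gamma>) = 1"
    unfolding idx_def S_def \<Gamma>_def by (rule deformed_const_eq[OF a])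
  finally show ?thesis using polar(1) unfolding lag F_def by simp
qed

end
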